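(* Let $\tau$ be in the upper half plane and $\hbar\in\mathbb C$ with $2\hbar\notin\mathbb Z+\tau\mathbb Z$. Let $\hat S_0,\hat S_1,\hat S_2,\hat S_3,\tilde\nu_1,\tilde\nu_2,\tilde\nu_3$ be elements of a unital associative $\mathbb C$-algebra, and set $$ R^\pm(z,w)=\sum_{a=0}^3\varphi_a^{\hbar/2}(z\pm w)\,\sigma_a\otimes\sigma_a,\qquad \hat L(z)=\hat S_0\,\varphi^\hbar_0(z)\,\sigma_0+\sum_{\alpha=1}^3\bigl(\hat S_\alpha\varphi^\hbar_\alpha(z)+\tilde\nu_\alpha\varphi^\hbar_\alpha(z-\omega_\alpha)\bigr)\sigma_\alpha . $$ Then the quantum reflection equation $$ R^-(z,w)\hat L_1(z)R^+(z,w)\hat L_2(w)=\hat L_2(w)R^+(z,w)\hat L_1(z)R^-(z,w) $$ holds identically in $z,w$ if and only if the following relations hold: $$[\tilde\nu_\alpha,\tilde\nu_\beta]=0,\qquad[\tilde\nu_\alpha,\hat S_a]=0\qquad(\alpha,\beta=1,2,3;\ a=0,1,2,3),$$ and for every cyclic permutation $(\alpha,\beta,\gamma)$ of $(1,2,3)$ $$i[\hat S_0,\hat S_\alpha]_+=[\hat S_\beta,\hat S_\gamma],$$ $$[\hat S_\gamma,\hat S_0]=i\,\frac{K_\beta-K_\alpha}{K_\gamma}[\hat S_\alpha,\hat S_\beta]_+-\frac{2i}{K_\gamma}\bigl(\tilde\nu_\alpha\rho_\alpha\hat S_\beta-\tilde\nu_\beta\rho_\beta\hat S_\alpha\bigr),$$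 where $$K_\alpha=E_1(\hbar+\omega_\alpha)-E_1(\hbar)-E_1(\omega_\alpha),\qquad \rho_\alpha=\exp(-2\pi i\,\omega_\alpha\partial_\tau\omega_\alpha)\,\phi(\omega_\alpha+\hbar,-\omega_\alpha).$$
   Context: $\omega_0=0$, $\omega_1=\frac12$, $\omega_2=\frac\tau2$, $\omega_3=\frac{1+\tau}2$, with $\partial_\tau\omega_0=\partial_\tau\omega_1=0$, $\partial_\tau\omega_2=\partial_\tau\omega_3=\frac12$. $\sigma_0$ is the identity, $\sigma_1,\sigma_2,\sigma_3$ the Pauli matrices. $\vartheta(z)=\sum_{j\in\mathbb Z}\exp\bigl(\pi i(j+\frac12)^2\tau+2\pi i(j+\frac12)(z+\frac12)\bigr)$, $E_1(z)=\partial_z\log\vartheta(z)$, $$\phi(u,z)=\frac{\vartheta(u+z)\vartheta'(0)}{\vartheta(u)\vartheta(z)},\qquad \varphi_a^\eta(z)=\exp(2\pi i z\,\partial_\tau\omega_a)\,\phi(\omega_a+\eta,z).$$ $[x,y]_+=xy+yx$. For a $2\times2$ matrix $\hat L$ with entries in the algebra, $\hat L_1=\hat L\otimes\sigma_0$, $\hat L_2=\sigma_0\otimes\hat L$ (products of entries taken in the written order). *)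

theory Defs
  imports "HOL-Analysis.Analysis"
begin

section \<open>Elliptic functions\<close>

definition omega :: "complex \<Rightarrow> nat \<Rightarrow> complex" where
  "omega \<tau> a = [0, 1/2, \<tau>/2, (1 + \<tau>)/2] ! a"

definition domega :: "nat \<Rightarrow> complex" where
  "domega a = [0, 0, 1/2, 1/2] ! a"

lemma omega_has_field_derivative:
  assumes "a \<le> 3"
  shows "((\<lambda>t. omega t a) has_field_derivative domega a) (at \<tau>)"
proof -
  from assms have "a = 0 \<or> a = 1 \<or> a = 2 \<or> a = 3" by linarith
  then show ?thesis
    by (elim disjE) (auto simp: omega_def domega_def eval_nat_numeral intro!: derivative_eq_intros)
qed

definition lattice :: "complex \<Rightarrow> complex set" where
  "lattice \<tau> = {of_int m + of_int n * \<tau> | m n. True}"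

definition theta :: "complex \<Rightarrow> complex \<Rightarrow> complex" where
  "theta \<tau> z = (\<Sum>\<^sub>\<infinity>j\<in>(UNIV :: int set).
     exp (of_real pi * \<i> * (of_int j + 1/2)^2 * \<tau>
          + 2 * of_real pi * \<i> * (of_int j + 1/2) * (z + 1/2)))"

text \<open>
  The function \<open>\<partial>\<^sub>z log \<vartheta>\<close> is read as the logarithmic derivative \<open>\<vartheta>'/\<vartheta>\<close>, since the
  principal branch \<open>Ln\<close> is not differentiable on its cut.
\<close>
definition E1 :: "complex \<Rightarrow> complex \<Rightarrow> complex" where
  "E1 \<tau> z = deriv (theta \<tau>) z / theta \<tau> z"

definition phi :: "complex \<Rightarrow> complex \<Rightarrow> complex \<Rightarrow> complex" where
  "phi \<tau> u z = theta \<tau> (u + z) * deriv (theta \<tau>) 0 / (theta \<tau> u * theta \<tau> z)"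

definition varphi :: "complex \<Rightarrow> complex \<Rightarrow> nat \<Rightarrow> complex \<Rightarrow> complex" where
  "varphi \<tau> \<eta> a z = exp (2 * of_real pi * \<i> * z * domega a) * phi \<tau> (omega \<tau> a + \<eta>) z"

definition K :: "complex \<Rightarrow> complex \<Rightarrow> nat \<Rightarrow> complex" where
  "K \<tau> h \<alpha> = E1 \<tau> (h + omega \<tau> \<alpha>) - E1 \<tau> h - E1 \<tau> (omega \<tau> \<alpha>)"

definition rho :: "complex \<Rightarrow> complex \<Rightarrow> nat \<Rightarrow> complex" where
  "rho \<tau> h \<alpha> = exp (- 2 * of_real pi * \<i> * omega \<tau> \<alpha> * domega \<alpha>)
     * phi \<tau> (omega \<tau> \<alpha> + h) (- omega \<tau> \<alpha>)"


section \<open>Algebras and matrices\<close>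

text \<open>The sort \<open>{ring, monoid_mult}\<close> is used instead of \<open>ring_1\<close> so that the zero algebra is allowed.\<close>
locale complex_algebra = vector_space smul
  for smul :: "complex \<Rightarrow> 'a::{ring, monoid_mult} \<Rightarrow> 'a" +
  assumes smul_mult_left: "smul c x * y = smul c (x * y)"
    and smul_mult_right: "x * smul c y = smul c (x * y)"

definition commutator :: "'a::ring \<Rightarrow> 'a \<Rightarrow> 'a" where
  "commutator x y = x * y - y * x"

definition anticommutator :: "'a::ring \<Rightarrow> 'a \<Rightarrow> 'a" where
  "anticommutator x y = x * y + y * x"

text \<open>
  The matrix product of the library requires \<open>semiring_1\<close>, hence \<open>0 \<noteq> 1\<close>; on that sort the
  following is the same function.
\<close>
definition mat_mult :: "'a::semiring_0 ^ 'n ^ 'm \<Rightarrow> 'a ^ 'p ^ 'n \<Rightarrow> 'a ^ 'p ^ 'm"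
    (infixl "\<bullet>\<bullet>" 70) where
  "A \<bullet>\<bullet> B = (\<chi> i j. \<Sum>k\<in>UNIV. A $ i $ k * B $ k $ j)"

lemma mat_mult_eq_matrix_matrix_mult:
  fixes A :: "'a::semiring_1 ^ 'n ^ 'm"
  shows "A \<bullet>\<bullet> B = A ** B"
  by (simp add: mat_mult_def matrix_matrix_mult_def)

definition kron :: "'a::times ^ 'n ^ 'm \<Rightarrow> 'a ^ 'q ^ 'p \<Rightarrow> 'a ^ ('n \<times> 'q) ^ ('m \<times> 'p)"
    (infixl "\<otimes>\<otimes>" 75) where
  "A \<otimes>\<otimes> B = (\<chi> r c. A $ fst r $ fst c * B $ snd r $ snd c)"

definition sigma :: "nat \<Rightarrow> complex ^ 2 ^ 2" where
  "sigma a =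
     [mat 1,
      vector [vector [0, 1], vector [1, 0]],
      vector [vector [0, - \<i>], vector [\<i>, 0]],
      vector [vector [1, 0], vector [0, - 1]]] ! a"

text \<open>A complex matrix regarded as a matrix over the algebra via \<open>c \<mapsto> c \<cdot> 1\<close>.\<close>
abbreviation lift_mat ::
    "(complex \<Rightarrow> 'a::{ring, monoid_mult} \<Rightarrow> 'a) \<Rightarrow> complex ^ 'n ^ 'm \<Rightarrow> 'a ^ 'n ^ 'm" where
  "lift_mat smul \<equiv> map_matrix (\<lambda>c. smul c 1)"


section \<open>The reflection equation\<close>

text \<open>\<open>R\<^sup>\<plusminus>(z,w)\<close> is \<open>Rmat \<tau> h (z \<plusminus> w)\<close>.\<close>
definition Rmat :: "complex \<Rightarrow> complex \<Rightarrow> complex \<Rightarrow> complex ^ (2 \<times> 2) ^ (2 \<times> 2)" where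
  "Rmat \<tau> h x = (\<Sum>a\<in>{0..3}. map_matrix ((*) (varphi \<tau> (h/2) a x)) (sigma a \<otimes>\<otimes> sigma a))"

definition Lhat ::
    "(complex \<Rightarrow> 'a::{ring, monoid_mult} \<Rightarrow> 'a) \<Rightarrow> complex \<Rightarrow> complex \<Rightarrow> (nat \<Rightarrow> 'a) \<Rightarrow> (nat \<Rightarrow> 'a)
      \<Rightarrow> complex \<Rightarrow> 'a ^ 2 ^ 2" where
  "Lhat smul \<tau> h S \<nu> z =
     map_matrix (\<lambda>c. smul c (smul (varphi \<tau> h 0 z) (S 0))) (sigma 0)
     + (\<Sum>\<alpha>\<in>{1..3}. map_matrix
         (\<lambda>c. smul c (smul (varphi \<tau> h \<alpha> z) (S \<alpha>)
                       + smul (varphi \<tau> h \<alpha> (z - omega \<tau> \<alpha>)) (\<nu> \<alpha>)))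
         (sigma \<alpha>))"

text \<open>
  An identity of meromorphic functions of \<open>z, w\<close>: it is required wherever no denominator in it
  vanishes. The zeros of \<open>\<vartheta>\<close> are the lattice points, so the poles of the entries of \<open>Lhat\<close> lie at
  \<open>z \<in> \<omega>\<^sub>a + lattice \<tau>\<close>, i.e. at \<open>2 z \<in> lattice \<tau>\<close>, and those of \<open>R\<^sup>\<plusminus>\<close> at \<open>z \<plusminus> w \<in> lattice \<tau>\<close>.
\<close>
definition reflection_equation ::
    "(complex \<Rightarrow> 'a::{ring, monoid_mult} \<Rightarrow> 'a) \<Rightarrow> complex \<Rightarrow> complex \<Rightarrow> (nat \<Rightarrow> 'a) \<Rightarrow> (nat \<Rightarrow> 'a)
      \<Rightarrow> bool" where
  "reflection_equation smul \<tau> h S \<nu> \<longleftrightarrow>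
     (\<forall>z w. 2 * z \<notin> lattice \<tau> \<longrightarrow> 2 * w \<notin> lattice \<tau> \<longrightarrow>
        z - w \<notin> lattice \<tau> \<longrightarrow> z + w \<notin> lattice \<tau> \<longrightarrow>
        (let Rm = lift_mat smul (Rmat \<tau> h (z - w));
             Rp = lift_mat smul (Rmat \<tau> h (z + w));
             L1 = Lhat smul \<tau> h S \<nu> z \<otimes>\<otimes> lift_mat smul (sigma 0);
             L2 = lift_mat smul (sigma 0) \<otimes>\<otimes> Lhat smul \<tau> h S \<nu> w
         in Rm \<bullet>\<bullet> L1 \<bullet>\<bullet> Rp \<bullet>\<bullet> L2 = L2 \<bullet>\<bullet> Rp \<bullet>\<bullet> L1 \<bullet>\<bullet> Rm))"

end

theory Submission
  imports Defs "HOL-Complex_Analysis.Complex_Analysis"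
begin

text \<open>
  Write \<open>f\<^sub>a(z) = \<theta>'(0) \<theta>\<^sub>a(z) / (\<theta>\<^sub>a(0) \<theta>(z))\<close> for \<open>a = 1, 2, 3\<close>, where \<open>\<theta>\<^sub>a\<close> is theta
  translated by \<open>\<omega>\<^sub>a\<close> up to an exponential factor; then \<open>\<phi>\<^sub>a(z) = \<phi>\<^sub>0(z) f\<^sub>a(z + \<eta>) / f\<^sub>a(\<eta>)\<close>, so all coefficients
  become elliptic up to signs after division by \<open>\<phi>\<^sub>0\<close>. Liouville's theorem gives
  \<open>f\<^sub>c(u) f\<^sub>b(v) = f\<^sub>b(u + v) f\<^sub>a(u) + f\<^sub>c(u + v) f\<^sub>a(v)\<close>, from which \<open>f\<^sub>a\<^sup>2 = \<wp> - e\<^sub>a\<close> and the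
  addition theorem follow. There is one function \<open>G\<close>, the same for all \<open>a\<close>, with
  \<open>f\<^sub>a(z) f\<^sub>a(z + h) = f\<^sub>a(h) (G(z) + K\<^sub>a)\<close>, so the scaled L-operator is
  \<open>S\<^sub>0 + \<Sum>\<^sub>a \<sigma>\<^sub>a ((G(z) + K\<^sub>a) S\<^sub>a + \<rho>\<^sub>a \<nu>\<^sub>a) / f\<^sub>a(z)\<close>, and the sums of products of coefficients of
  \<open>R\<^sup>-\<close> and \<open>R\<^sup>+\<close> that occur in the reflection equation all share a common factor.

  Linear functionals separate the points of the algebra. Applying one to the coefficients of
  \<open>\<sigma>\<^sub>a \<otimes> \<sigma>\<^sub>b\<close> leaves sixteen scalar identities, polynomial in \<open>G(z)\<close>, \<open>G(w)\<close> and \<open>\<wp>(w)\<close> up to factors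
  that do not vanish. They follow from the relations, first at generic \<open>(z, w)\<close> and then everywhere by
  continuity. Conversely, \<open>G\<close> and \<open>\<wp>\<close> blow up at \<open>0\<close>, so the coefficients of these polynomials have to
  vanish, and these are the relations.
\<close>

text \<open>The R-matrices contain h/2, the L-operator contains h. With p = z + h/2 the values of
  \<open>f\<^sub>a\<close> in \<open>R\<^sup>+\<close> and \<open>R\<^sup>-\<close> are taken at p +
  w and p - w, while z + h and z are p + h/2 and p - h/2. The formulas for products of values at p +
  v and p - v, taken at v = w and at v = h/2, therefore link the two; this is the origin of the
  common factor. The function G is classical: it is \<zeta>(z) + \<zeta>(h) - \<zeta>(z + h), so
  G(w) is, up to the factor -1/2, the slope of the chord of the Weierstrass cubic through the points
  with parameters w and h. Liouville's theorem is applied to quotients, so the zeros of theta must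
  be known to be simple and to lie only on the lattice. The series does not show this. For necessity
  the order of the limits matters: z tends to 0 with w fixed, and w tends to 0 afterwards. The
  component of \<open>1 \<otimes> 1\<close> gives \<open>[\<nu>\<^sub>a, S\<^sub>a] = 0\<close>,
  those of \<open>1 \<otimes> \<sigma>\<^sub>a\<close> lead to
  \<open>[\<nu>\<^sub>a, S\<^sub>0] = 0\<close> and the second relation, those of
  \<open>\<sigma>\<^sub>b \<otimes> \<sigma>\<^sub>c\<close> with distinct b, c to the rest.\<close>

lemma entire_power_series:
  fixes a :: "nat \<Rightarrow> complex"
  assumes a: "\<And>n. norm (a (Suc n)) \<le> C * r ^ n * norm (a n)" and r: "0 \<le> r" "r < 1"
  shows "summable (\<lambda>n. norm (a n * x ^ n))"
    and "(\<lambda>x. \<Sum>n. a n * x ^ n) holomorphic_on UNIV"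
proof -
  have *: "summable (\<lambda>n. norm (a n * x ^ n))" for x
  proof -
    have "(\<lambda>n. \<bar>C\<bar> * norm x * r ^ n) \<longlonglongrightarrow> \<bar>C\<bar> * norm x * 0"
      using r by (intro tendsto_intros LIMSEQ_realpow_zero) auto
    then have "eventually (\<lambda>n. \<bar>C\<bar> * norm x * r ^ n < 1/2) sequentially"
      by (rule order_tendstoD) auto
    then obtain N where N: "\<And>n. n \<ge> N \<Longrightarrow> \<bar>C\<bar> * norm x * r ^ n < 1/2"
      unfolding eventually_sequentially by blast
    show ?thesis
    proof (rule summable_ratio_test[where c = "1/2" and N = N])
      fix n assume n: "N \<le> n"
      have "norm (a (Suc n)) * norm x ^ Suc n \<le> (C * r ^ n * norm (a n)) * norm x ^ Suc n"
        by (intro mult_right_mono a) auto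
      also have "\<dots> = (C * norm x * r ^ n) * (norm (a n) * norm x ^ n)"
        by (simp add: algebra_simps)
      also have "\<dots> \<le> (1/2) * (norm (a n) * norm x ^ n)"
      proof (intro mult_right_mono)
        have "C * norm x * r ^ n \<le> \<bar>C\<bar> * norm x * r ^ n"
          using r by (intro mult_right_mono) auto
        with N[OF n] show "C * norm x * r ^ n \<le> 1/2" by linarith
      qed auto
      finally show "norm (norm (a (Suc n) * x ^ Suc n)) \<le> 1/2 * norm (norm (a n * x ^ n))"
        by (simp add: norm_mult norm_power del: power_Suc)
    qed simp
  qed
  show "summable (\<lambda>n. norm (a n * x ^ n))" by (rule *)
  show "(\<lambda>x. \<Sum>n. a n * x ^ n) holomorphic_on UNIV"
    unfolding holomorphic_on_open[OF open_UNIV]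
    using termdiffs_strong_converges_everywhere[of a] summable_norm_cancel[OF *] by blast
qed


section \<open>Theta function\<close>

definition xexp :: "complex \<Rightarrow> complex" where
  "xexp z = exp (2 * of_real pi * \<i> * z)"

lemma xexp_nz [simp]: "xexp z \<noteq> 0" by (simp add: xexp_def)
lemma xexp_0 [simp]: "xexp 0 = 1" by (simp add: xexp_def)
lemma xexp_add: "xexp (y + z) = xexp y * xexp z"
  by (simp add: xexp_def distrib_left exp_add)
lemma xexp_minus: "xexp (- z) = inverse (xexp z)"
  by (simp add: xexp_def exp_minus)
lemma xexp_half: "xexp (1/2) = -1"
  by (simp add: xexp_def)
lemma xexp_1 [simp]: "xexp 1 = 1"
  using xexp_add[of "1/2" "1/2"] by (simp add: xexp_half)
lemma norm_xexp_less_1: "Im \<tau> > 0 \<Longrightarrow> norm (xexp \<tau>) < 1"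
  by (simp add: xexp_def)

text \<open>
  Up to elementary factors \<open>theta\<close> is \<open>h(x) - h(1/x)/x\<close> for \<open>h = half_series\<close>: its positive and
  negative terms are summed separately.
\<close>

definition half_series :: "complex \<Rightarrow> complex \<Rightarrow> complex" where
  "half_series q x = (\<Sum>n. ((-1) ^ n * q ^ (n * (n + 1) div 2)) * x ^ n)"

text \<open>
  Euler's series for the infinite product \<open>(1 - x) (1 - q x) (1 - q\<^sup>2 x) \<cdots>\<close>; its functional equation
  gives the zeros without any discussion of infinite products.
\<close>

definition qpoch_series_coeff :: "complex \<Rightarrow> nat \<Rightarrow> complex" where
  "qpoch_series_coeff q n = (\<Prod>k<n. - (q ^ k) / (1 - q ^ Suc k))"

definition qpoch :: "complex \<Rightarrow> complex \<Rightarrow> complex" where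
  "qpoch q x = (\<Sum>n. qpoch_series_coeff q n * x ^ n)"

lemma triangle_Suc: "Suc n * (Suc n + 1) div 2 = n * (n + 1) div 2 + Suc n"
proof -
  have "Suc n * (Suc n + 1) = n * (n + 1) + 2 * Suc n" by (simp add: algebra_simps)
  then show ?thesis by simp
qed

context
  fixes q :: complex
  assumes q: "norm q < 1"
begin

lemma half_series_summable: "summable (\<lambda>n. norm (((-1) ^ n * q ^ (n * (n + 1) div 2)) * x ^ n))"
  and half_series_holomorphic: "half_series q holomorphic_on UNIV"
proof -
  have "norm ((-1) ^ Suc n * q ^ (Suc n * (Suc n + 1) div 2)) \<le>
        norm q * norm q ^ n * norm ((-1) ^ n * q ^ (n * (n + 1) div 2))" for n
    unfolding triangle_Suc by (simp add: norm_mult norm_power power_add)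
  from entire_power_series[OF this] q
  show "summable (\<lambda>n. norm (((-1) ^ n * q ^ (n * (n + 1) div 2)) * x ^ n))"
    "half_series q holomorphic_on UNIV"
    unfolding half_series_def[abs_def] by auto
qed

lemma half_series_0: "half_series q 0 = 1"
  unfolding half_series_def using powser_zero[of "\<lambda>n. (-1) ^ n * q ^ (n * (n + 1) div 2)"] by simp

text \<open>Without its first term the series reproduces itself at \<open>q * x\<close>, because
  consecutive triangular numbers \<open>n * (n + 1) div 2\<close> differ by \<open>Suc n\<close>.
  This is the source of the quasi-periodicity of \<open>theta\<close> under \<tau>.\<close>

lemma half_series_shift: "half_series q x = 1 - q * x * half_series q (q * x)"
proof -
  let ?a = "\<lambda>n. ((-1) ^ n * q ^ (n * (n + 1) div 2)) * x ^ n"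
  have "suminf ?a = ?a 0 + (\<Sum>n. ?a (Suc n))"
    using summable_norm_cancel[OF half_series_summable] suminf_split_head[of ?a] by simp
  also have "(\<lambda>n. ?a (Suc n)) =
      (\<lambda>n. (- q * x) * (((-1) ^ n * q ^ (n * (n + 1) div 2)) * (q * x) ^ n))"
    unfolding triangle_Suc
    by (rule ext) (simp add: power_add power_mult_distrib algebra_simps)
  also have "suminf \<dots> = (- q * x) * half_series q (q * x)"
    unfolding half_series_def
    by (intro suminf_mult summable_norm_cancel[OF half_series_summable])
  finally show ?thesis by (simp add: half_series_def)
qed

lemma qpoch_summable: "summable (\<lambda>n. norm (qpoch_series_coeff q n * x ^ n))"
  and qpoch_holomorphic: "qpoch q holomorphic_on UNIV"
proof -
  have "norm (qpoch_series_coeff q (Suc n)) \<le>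
        (1 / (1 - norm q)) * norm q ^ n * norm (qpoch_series_coeff q n)" for n
  proof -
    have "1 - norm q \<le> 1 - norm (q ^ Suc n)"
      using q power_le_one[of "norm q" n] mult_left_le[of "norm q ^ n" "norm q"]
      by (simp add: norm_mult norm_power)
    also have "\<dots> \<le> norm (1 - q ^ Suc n)"
      by (metis norm_one norm_triangle_ineq2)
    finally have "norm (- (q ^ n) / (1 - q ^ Suc n)) \<le> norm q ^ n / (1 - norm q)"
      using q by (simp add: norm_divide norm_power frac_le del: power_Suc)
    then have "norm (- (q ^ n) / (1 - q ^ Suc n)) * norm (qpoch_series_coeff q n) \<le>
      norm q ^ n / (1 - norm q) * norm (qpoch_series_coeff q n)"
      by (rule mult_right_mono) simp
    then show ?thesis
      by (simp add: qpoch_series_coeff_def norm_mult norm_divide mult.commute del: power_Suc)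
  qed
  from entire_power_series[OF this] q
  show "summable (\<lambda>n. norm (qpoch_series_coeff q n * x ^ n))" "qpoch q holomorphic_on UNIV"
    unfolding qpoch_def[abs_def] by auto
qed

lemma qpoch_0: "qpoch q 0 = 1"
  unfolding qpoch_def using powser_zero[of "qpoch_series_coeff q"]
  by (simp add: qpoch_series_coeff_def)

text \<open>Compared coefficientwise, the claim is the recursion that links consecutive values of
  \<open>qpoch_series_coeff\<close>.\<close>

lemma qpoch_shift: "qpoch q x = (1 - x) * qpoch q (q * x)"
proof -
  let ?c = "qpoch_series_coeff q"
  have sx: "summable (\<lambda>n. ?c n * x ^ n)" "summable (\<lambda>n. ?c n * (q * x) ^ n)"
    using summable_norm_cancel[OF qpoch_summable] by blast+
  have rec: "?c (Suc n) * x ^ Suc n - ?c (Suc n) * (q * x) ^ Suc n = - x * (?c n * (q * x) ^ n)" for n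
  proof -
    have "norm (q ^ Suc n) < 1"
      using q by (metis norm_ge_zero norm_power power_less_one_iff nat.distinct(1) zero_less_Suc)
    then have "1 - q ^ Suc n \<noteq> 0" by auto
    then have "?c (Suc n) * (1 - q ^ Suc n) = - (q ^ n) * ?c n"
      by (simp add: qpoch_series_coeff_def del: power_Suc)
    then have "?c (Suc n) * (1 - q ^ Suc n) * x ^ Suc n = - (q ^ n) * ?c n * x ^ Suc n" by simp
    then show ?thesis by (simp add: power_mult_distrib algebra_simps)
  qed
  have "qpoch q x - qpoch q (q * x) = (\<Sum>n. ?c n * x ^ n - ?c n * (q * x) ^ n)"
    unfolding qpoch_def by (rule suminf_diff[OF sx])
  also have "\<dots> = (\<Sum>n. ?c (Suc n) * x ^ Suc n - ?c (Suc n) * (q * x) ^ Suc n)"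
    using suminf_split_head[OF summable_diff[OF sx]] by simp
  also have "\<dots> = (\<Sum>n. - x * (?c n * (q * x) ^ n))"
    unfolding rec ..
  also have "\<dots> = - x * qpoch q (q * x)"
    unfolding qpoch_def by (rule suminf_mult[OF sx(2)])
  finally show ?thesis by (simp add: algebra_simps)
qed

lemma qpoch_iterate: "qpoch q x = (\<Prod>k<n. 1 - q ^ k * x) * qpoch q (q ^ n * x)"
proof (induction n)
  case (Suc n)
  have "qpoch q (q ^ n * x) = (1 - q ^ n * x) * qpoch q (q ^ Suc n * x)"
    by (subst qpoch_shift) (simp add: mult.assoc)
  with Suc show ?case by (simp add: mult.assoc)
qed simp

text \<open>Iterating the shift moves the argument to \<open>q ^ n * x\<close>, which tends to 0,
  where the function is 1. A zero must therefore come from one of finitely many explicit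
  factors.\<close>

lemma qpoch_eq_0_iff: "qpoch q x = 0 \<longleftrightarrow> (\<exists>n. q ^ n * x = 1)"
proof
  assume 0: "qpoch q x = 0"
  have "isCont (qpoch q) 0"
    using holomorphic_on_imp_continuous_on[OF qpoch_holomorphic]
    by (simp add: continuous_on_eq_continuous_at)
  moreover have "(\<lambda>n. q ^ n * x) \<longlonglongrightarrow> 0"
    using q by (intro tendsto_mult_left_zero LIMSEQ_power_zero)
  ultimately have "(\<lambda>n. qpoch q (q ^ n * x)) \<longlonglongrightarrow> 1"
    using isCont_tendsto_compose[of 0 "qpoch q"] by (simp add: qpoch_0)
  then have "eventually (\<lambda>n. qpoch q (q ^ n * x) \<noteq> 0) sequentially"
    by (rule tendsto_imp_eventually_ne) simp
  then obtain n where "qpoch q (q ^ n * x) \<noteq> 0"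
    using eventually_happens' sequentially_bot by blast
  then have "(\<Prod>k<n. 1 - q ^ k * x) = 0"
    using 0 qpoch_iterate[of x n] by simp
  then show "\<exists>n. q ^ n * x = 1" by auto
next
  assume "\<exists>n. q ^ n * x = 1"
  then obtain n where "q ^ n * x = 1" ..
  then show "qpoch q x = 0"
    by (subst qpoch_iterate[of x "Suc n"]) simp
qed

end

locale upper_half_plane =
  fixes \<tau> :: complex
  assumes \<tau>: "Im \<tau> > 0"
begin

text \<open>The index j is split into n and -1 - n with n \<ge> 0. For both,
  \<open>(j + 1/2)\<^sup>2\<close> is \<open>n * (n + 1) + 1/4\<close>, which produces the
  triangular exponents of \<open>xexp \<tau>\<close> and the constant
  \<open>exp (of_real pi * \<i> * \<tau> / 4)\<close>. The shift of z by 1/2 produces \<i> and the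
  signs.\<close>

lemma theta_eq_half_series:
  "theta \<tau> z = \<i> * exp (of_real pi * \<i> * \<tau> / 4) * exp (of_real pi * \<i> * z) *
    (half_series (xexp \<tau>) (xexp z) - half_series (xexp \<tau>) (xexp (- z)) * xexp (- z))"
proof -
  define q where "q = xexp \<tau>"
  have q: "norm q < 1" using norm_xexp_less_1[OF \<tau>] by (simp add: q_def)
  define C where "C = \<i> * exp (of_real pi * \<i> * \<tau> / 4) * exp (of_real pi * \<i> * z)"
  define t where "t = (\<lambda>j::int. exp (of_real pi * \<i> * (of_int j + 1/2)^2 * \<tau>
          + 2 * of_real pi * \<i> * (of_int j + 1/2) * (z + 1/2)))"
  define a where "a = (\<lambda>n::nat. (-1) ^ n * q ^ (n * (n + 1) div 2))"
  have tri: "2 * of_nat (n * (n + 1) div 2) = (of_nat n * (of_nat n + 1) :: complex)" for n :: nat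
  proof -
    have "2 * (n * (n + 1) div 2) = n * (n + 1)" by simp
    then have "of_nat (2 * (n * (n + 1) div 2)) = (of_nat (n * (n + 1)) :: complex)" by (rule arg_cong)
    then show ?thesis by (simp only: of_nat_mult of_nat_add of_nat_1 of_nat_numeral)
  qed
  have qp: "q ^ (n * (n + 1) div 2) = exp (of_real pi * \<i> * \<tau> * (of_nat n * (of_nat n + 1)))" for n :: nat
    unfolding q_def xexp_def by (subst tri[symmetric]) (simp add: exp_of_nat_mult[symmetric] algebra_simps)
  have m1: "(-1 :: complex) ^ n = exp (of_nat n * (\<i> * of_real pi))" for n :: nat
    by (simp add: exp_of_nat_mult)
  have I: "exp (\<i> * of_real pi / 2) = \<i>"
    using cis_conv_exp[of "pi / 2"] by simp
  have t_pos: "t (int n) = C * (a n * xexp z ^ n)" for n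
  proof -
    have "C * (a n * xexp z ^ n) = exp (\<i> * of_real pi / 2) * exp (of_real pi * \<i> * \<tau> / 4) * exp (of_real pi * \<i> * z)
       * (exp (of_nat n * (\<i> * of_real pi)) * exp (of_real pi * \<i> * \<tau> * (of_nat n * (of_nat n + 1)))
          * exp (of_nat n * (2 * of_real pi * \<i> * z)))"
      unfolding C_def a_def qp m1 xexp_def exp_of_nat_mult I by simp
    also have "\<dots> = t (int n)"
      unfolding t_def exp_add[symmetric]
      by (rule arg_cong[where f = exp]) (simp add: field_simps power2_eq_square)
    finally show ?thesis by simp
  qed
  have t_neg: "t (- 1 - int n) = - C * xexp (- z) * (a n * xexp (- z) ^ n)" for n
  proof -
    have e1: "- 1 = exp (- (\<i> * of_real pi))" by (simp add: exp_minus)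
    have e2: "(-1 :: complex) ^ n = exp (of_nat n * (- \<i> * of_real pi))"
      using exp_of_nat_mult[of n "- \<i> * of_real pi"] by (simp add: exp_minus)
    have "- C * xexp (- z) * (a n * xexp (- z) ^ n) = (- 1) * (exp (\<i> * of_real pi / 2) * exp (of_real pi * \<i> * \<tau> / 4) * exp (of_real pi * \<i> * z)) * exp (2 * of_real pi * \<i> * - z)
       * (exp (of_nat n * (- \<i> * of_real pi)) * exp (of_real pi * \<i> * \<tau> * (of_nat n * (of_nat n + 1)))
          * exp (of_nat n * (2 * of_real pi * \<i> * - z)))"
      unfolding C_def a_def qp e2 xexp_def exp_of_nat_mult I by simp
    also have "\<dots> = t (- 1 - int n)"
      unfolding t_def e1 exp_add[symmetric]
      by (rule arg_cong[where f = exp]) (simp add: field_simps power2_eq_square)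
    finally show ?thesis by simp
  qed
  have sum_a: "((\<lambda>n. a n * x ^ n) has_sum half_series q x) UNIV" for x
    unfolding half_series_def a_def
    using half_series_summable[OF q, of x]
    by (intro norm_summable_imp_has_sum summable_sums) (auto dest: summable_norm_cancel)
  have P: "(t has_sum (C * half_series q (xexp z))) {0..}"
  proof -
    have "((\<lambda>n. t (int n)) has_sum (C * half_series q (xexp z))) UNIV"
      unfolding t_pos by (intro has_sum_cmult_right sum_a)
    moreover have "bij_betw int UNIV {0..}"
      by (rule bij_betwI[where g = nat]) auto
    ultimately show ?thesis
      using has_sum_reindex_bij_betw[of int UNIV "{0..}" t] by simp
  qed
  have N: "(t has_sum (- C * xexp (- z) * half_series q (xexp (- z)))) {..<0}"
  proof -
    have "((\<lambda>n. t (- 1 - int n)) has_sum (- C * xexp (- z) * half_series q (xexp (- z)))) UNIV"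
      unfolding t_neg by (intro has_sum_cmult_right sum_a)
    moreover have "bij_betw (\<lambda>n. - 1 - int n) UNIV {..<0}"
      by (rule bij_betwI[where g = "\<lambda>j. nat (- 1 - j)"]) auto
    ultimately show ?thesis
      using has_sum_reindex_bij_betw[of "\<lambda>n. - 1 - int n" UNIV "{..<0}" t] by simp
  qed
  have "{0..} \<union> {..<0::int} = UNIV" "{0..} \<inter> {..<0::int} = {}" by auto
  with has_sum_Un_disjoint[OF P N]
  have "(t has_sum (C * half_series q (xexp z) + - C * xexp (- z) * half_series q (xexp (- z)))) UNIV"
    by auto
  then have "theta \<tau> z = C * half_series q (xexp z) + - C * xexp (- z) * half_series q (xexp (- z))"
    unfolding theta_def t_def by (rule infsumI)
  then show ?thesis by (simp add: C_def q_def algebra_simps)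
qed

lemma theta_holomorphic: "theta \<tau> holomorphic_on UNIV"
proof -
  have 1: "(\<lambda>z. half_series (xexp \<tau>) (g z)) holomorphic_on UNIV" if "g holomorphic_on UNIV" for g
    using holomorphic_on_compose[OF that holomorphic_on_subset[OF half_series_holomorphic]]
      norm_xexp_less_1[OF \<tau>] by (auto simp: o_def)
  have "(\<lambda>z. \<i> * exp (of_real pi * \<i> * \<tau> / 4) * exp (of_real pi * \<i> * z) *
    (half_series (xexp \<tau>) (xexp z) - half_series (xexp \<tau>) (xexp (- z)) * xexp (- z))) holomorphic_on UNIV"
    by (intro holomorphic_intros 1) (auto simp: xexp_def intro!: holomorphic_intros)
  then show ?thesis
    using theta_eq_half_series by presburger
qed

lemma theta_minus: "theta \<tau> (- z) = - theta \<tau> z"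
proof -
  have "exp (of_real pi * \<i> * z) * xexp (- z) = exp (of_real pi * \<i> * - z)"
    by (simp add: xexp_def exp_add[symmetric] algebra_simps)
  moreover have "exp (of_real pi * \<i> * - z) * xexp z = exp (of_real pi * \<i> * z)"
    by (simp add: xexp_def exp_add[symmetric] algebra_simps)
  moreover have "c * b * (v - u * x) = - (c * a * (u - v * y))"
    if "a * y = b" "b * x = a" for a b c u v x y :: complex
  proof -
    have "c * b * (v - u * x) = c * b * v - c * u * (b * x)"
      and "- (c * a * (u - v * y)) = c * v * (a * y) - c * u * a"
      by (simp_all add: algebra_simps)
    then show ?thesis using that by simp
  qed
  ultimately show ?thesis
    unfolding theta_eq_half_series minus_minus by blast
qed

lemma theta_0 [simp]: "theta \<tau> 0 = 0"
  using theta_minus[of 0] by simp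

lemma theta_plus_1: "theta \<tau> (z + 1) = - theta \<tau> z"
  using xexp_add[of z 1] xexp_add[of "-z" "-1"]
  by (simp add: theta_eq_half_series xexp_minus[of 1] exp_add distrib_left)

text \<open>\<open>half_series_shift\<close> is applied at x and at \<open>inverse (q * x)\<close>,
  where x is \<open>xexp z\<close> and q is \<open>xexp \<tau>\<close>. Each application contributes
  a constant 1, and these cancel in the difference of the two half series.\<close>

lemma theta_plus_tau: "theta \<tau> (z + \<tau>) = - exp (- (of_real pi * \<i> * \<tau>)) * xexp (- z) * theta \<tau> z"
proof -
  define q x where "q = xexp \<tau>" and "x = xexp z"
  have nz: "x \<noteq> 0" "q \<noteq> 0" by (auto simp: q_def x_def)
  have q: "norm q < 1" using norm_xexp_less_1[OF \<tau>] by (simp add: q_def)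
  have 1: "half_series q (q * x) = (1 - half_series q x) / (q * x)"
    using half_series_shift[OF q, of x] nz by (simp add: field_simps)
  have 2: "half_series q (inverse (q * x)) = 1 - half_series q (inverse x) / x"
    using half_series_shift[OF q, of "inverse (q * x)"] nz by (simp add: field_simps)
  have 3: "half_series q (q * x) - half_series q (inverse (q * x)) * inverse (q * x)
      = - (half_series q x - half_series q (inverse x) * inverse x) / (q * x)"
    unfolding 1 2 using nz by (simp add: field_simps)
  have 4: "exp (of_real pi * \<i> * \<tau>) * exp (- (of_real pi * \<i> * \<tau>)) = 1"
    by (simp add: exp_add[symmetric])
  have 5: "q = exp (of_real pi * \<i> * \<tau>) * exp (of_real pi * \<i> * \<tau>)"
    unfolding q_def xexp_def exp_add[symmetric] by (rule arg_cong[where f = exp]) simp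
  have 6: "xexp (- z - \<tau>) = inverse (q * x)"
    using xexp_minus[of "z + \<tau>"] by (simp add: q_def x_def xexp_add)
  have "theta \<tau> (z + \<tau>) = \<i> * exp (of_real pi * \<i> * \<tau> / 4) * (exp (of_real pi * \<i> * z) * exp (of_real pi * \<i> * \<tau>))
    * (half_series q (q * x) - half_series q (inverse (q * x)) * inverse (q * x))"
    unfolding theta_eq_half_series
    by (simp add: 6 xexp_add flip: q_def x_def) (simp add: exp_add distrib_left mult_ac)
  also have "\<dots> = - exp (- (of_real pi * \<i> * \<tau>)) * inverse x *
     (\<i> * exp (of_real pi * \<i> * \<tau> / 4) * exp (of_real pi * \<i> * z) * (half_series q x - half_series q (inverse x) * inverse x))"
    unfolding 3 by (subst 5) (use nz in \<open>simp add: field_simps exp_minus\<close>)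
  also have "\<dots> = - exp (- (of_real pi * \<i> * \<tau>)) * xexp (- z) * theta \<tau> z"
    unfolding theta_eq_half_series by (simp add: q_def x_def xexp_minus)
  finally show ?thesis .
qed

text \<open>If \<open>theta\<close> vanished, the half series h would satisfy h(x) = h(1/x)/x for
  all x \<noteq> 0. Then h tends to 0 at infinity and is 0 by Liouville's theorem, against h(0) =
  1.\<close>

lemma theta_not_identically_0: "\<exists>z. theta \<tau> z \<noteq> 0"
proof (rule ccontr)
  assume "\<not> ?thesis"
  then have z: "theta \<tau> z = 0" for z by blast
  let ?h = "half_series (xexp \<tau>)"
  note q = norm_xexp_less_1[OF \<tau>]
  have h: "?h x = ?h (inverse x) * inverse x" if "x \<noteq> 0" for x
  proof -
    have "\<exists>z. xexp z = x"
    proof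
      show "xexp (Ln x / (2 * of_real pi * \<i>)) = x" using that by (simp add: xexp_def)
    qed
    then obtain z where "xexp z = x" ..
    with z[of z] show ?thesis
      unfolding theta_eq_half_series by (simp add: xexp_minus)
  qed
  have "isCont ?h 0"
    using holomorphic_on_imp_continuous_on[OF half_series_holomorphic[OF q]]
    by (simp add: continuous_on_eq_continuous_at)
  then have "((\<lambda>x. ?h (inverse x)) \<longlongrightarrow> ?h 0) at_infinity"
    by (intro isCont_tendsto_compose[of 0 ?h] tendsto_inverse_0)
  then have "((\<lambda>x. ?h (inverse x) * inverse x) \<longlongrightarrow> ?h 0 * 0) at_infinity"
    by (intro tendsto_intros tendsto_inverse_0)
  moreover have "eventually (\<lambda>x. ?h (inverse x) * inverse x = ?h x) at_infinity"
    unfolding eventually_at_infinity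
  proof (intro exI[of _ 1] allI impI)
    fix x :: complex assume "1 \<le> norm x"
    then have "x \<noteq> 0" by auto
    then show "?h (inverse x) * inverse x = ?h x" by (rule h[symmetric])
  qed
  ultimately have "(?h \<longlongrightarrow> ?h 0 * 0) at_infinity"
    by (rule Lim_transform_eventually)
  then have "(?h \<longlongrightarrow> 0) at_infinity" by simp
  then have "?h 0 = 0"
    by (rule Liouville_weak_0[OF half_series_holomorphic[OF q]])
  then show False by (simp add: half_series_0[OF q])
qed

end

section \<open>Quotients of quasi-periodic entire functions\<close>

lemma entire_isCont: "f holomorphic_on UNIV \<Longrightarrow> isCont f z"
  using holomorphic_on_imp_continuous_on continuous_on_eq_continuous_at open_UNIV by blast

lemma entire_has_deriv: "f holomorphic_on UNIV \<Longrightarrow> (f has_field_derivative deriv f z) (at z)"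
  by (rule holomorphic_derivI[of f UNIV]) auto

lemma xexp_holomorphic [holomorphic_intros]:
  "f holomorphic_on A \<Longrightarrow> (\<lambda>z. xexp (f z)) holomorphic_on A"
  unfolding xexp_def by (intro holomorphic_intros)

lemma entire_compose:
  "f holomorphic_on UNIV \<Longrightarrow> g holomorphic_on UNIV \<Longrightarrow> (\<lambda>z. f (g z)) holomorphic_on UNIV"
  using holomorphic_on_compose[of g UNIV f] holomorphic_on_subset[of f UNIV] by (auto simp: o_def)

lemma entire_nonzero_nearby:
  assumes "f holomorphic_on UNIV" "f b \<noteq> 0"
  shows "eventually (\<lambda>w. f w \<noteq> 0) (at z)"
  using non_zero_neighbour_alt[OF assms(1) open_UNIV connected_UNIV] assms(2) by simp

lemma entire_mult_eq_0D:
  assumes "P holomorphic_on UNIV" "f holomorphic_on UNIV" "P b \<noteq> 0" "\<And>z. P z * f z = (0 :: complex)"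
  shows "f z = 0"
proof -
  have "eventually (\<lambda>w. f w = 0) (at z)"
    by (rule eventually_mono[OF entire_nonzero_nearby[OF assms(1,3)]]) (use assms(4) in auto)
  then have "(f \<longlongrightarrow> 0) (at z)"
    by (rule tendsto_eventually)
  moreover have "(f \<longlongrightarrow> f z) (at z)"
    using entire_isCont[OF assms(2)] by (simp add: isCont_def)
  ultimately show ?thesis
    using tendsto_unique by force
qed

text \<open>At a zero z of \<open>P\<close> both functions are divided by \<open>w - z\<close>. The
  difference quotients are entire, and the one of \<open>P\<close> is nonzero at z because the zero
  is simple, so the singularities of the quotient are removable.\<close>

lemma entire_quotient:
  fixes P N :: "complex \<Rightarrow> complex"
  assumes P: "P holomorphic_on UNIV" and N: "N holomorphic_on UNIV"
    and zeros: "\<And>z. P z = 0 \<Longrightarrow> deriv P z \<noteq> 0" "\<And>z. P z = 0 \<Longrightarrow> N z = 0"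
  obtains Q where "Q holomorphic_on UNIV" "\<And>z. N z = P z * Q z"
proof -
  define Q where "Q = (\<lambda>z. if P z = 0 then deriv N z / deriv P z else N z / P z)"
  have opn: "open {z. f z \<noteq> 0}" if "f holomorphic_on UNIV" for f :: "complex \<Rightarrow> complex"
    using open_Collect_neq[of f "\<lambda>_. 0"] holomorphic_on_imp_continuous_on[OF that] by auto
  have "\<exists>U. open U \<and> z \<in> U \<and> Q holomorphic_on U" for z
  proof (cases "P z = 0")
    case False
    have "(\<lambda>z. N z / P z) holomorphic_on {z. P z \<noteq> 0}"
      by (intro holomorphic_on_divide holomorphic_on_subset[OF P] holomorphic_on_subset[OF N]) auto
    then have "Q holomorphic_on {z. P z \<noteq> 0}"
      by (rule holomorphic_transform) (simp add: Q_def)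
    then show ?thesis using False opn[OF P] by blast
  next
    case True
    define P1 where "P1 = (\<lambda>w. if w = z then deriv P z else (P w - P z) / (w - z))"
    define N1 where "N1 = (\<lambda>w. if w = z then deriv N z else (N w - N z) / (w - z))"
    have P1: "P1 holomorphic_on UNIV" and N1: "N1 holomorphic_on UNIV"
      unfolding P1_def N1_def using pole_lemma_open[OF P] pole_lemma_open[OF N] by auto
    have "(\<lambda>w. N1 w / P1 w) holomorphic_on {w. P1 w \<noteq> 0}"
      by (intro holomorphic_on_divide holomorphic_on_subset[OF P1] holomorphic_on_subset[OF N1]) auto
    then have "Q holomorphic_on {w. P1 w \<noteq> 0}"
      by (rule holomorphic_transform) (use True zeros in \<open>auto simp: Q_def P1_def N1_def split: if_splits\<close>)
    moreover have "P1 z \<noteq> 0" using True zeros(1) by (simp add: P1_def)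
    ultimately show ?thesis using opn[OF P1] by blast
  qed
  then have "Q holomorphic_on UNIV"
    unfolding holomorphic_on_open[OF open_UNIV] by (metis holomorphic_on_open)
  moreover have "N z = P z * Q z" for z
    using zeros(2) by (simp add: Q_def)
  ultimately show thesis by (rule that)
qed

section \<open>The period lattice\<close>

lemma lattice_0 [simp]: "0 \<in> lattice \<tau>"
  unfolding lattice_def by (auto intro!: exI[of _ 0])

lemma lattice_add: "x \<in> lattice \<tau> \<Longrightarrow> y \<in> lattice \<tau> \<Longrightarrow> x + y \<in> lattice \<tau>"
  unfolding lattice_def
proof clarify
  fix m n m' n' :: int
  show "\<exists>k l. of_int m + of_int n * \<tau> + (of_int m' + of_int n' * \<tau>) = of_int k + of_int l * \<tau> \<and> True"
    by (intro exI[of _ "m + m'"] exI[of _ "n + n'"]) (simp add: algebra_simps)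
qed

lemma lattice_minus: "x \<in> lattice \<tau> \<Longrightarrow> - x \<in> lattice \<tau>"
  unfolding lattice_def
proof clarify
  fix m n :: int
  show "\<exists>k l. - (of_int m + of_int n * \<tau>) = of_int k + of_int l * \<tau> \<and> True"
    by (intro exI[of _ "- m"] exI[of _ "- n"]) (simp add: algebra_simps)
qed

lemma lattice_minus_iff [simp]: "- x \<in> lattice \<tau> \<longleftrightarrow> x \<in> lattice \<tau>"
  using lattice_minus[of x \<tau>] lattice_minus[of "- x" \<tau>] by auto

lemma lattice_diff: "x \<in> lattice \<tau> \<Longrightarrow> y \<in> lattice \<tau> \<Longrightarrow> x - y \<in> lattice \<tau>"
  using lattice_add[of x \<tau> "- y"] by simp

lemma lattice_1 [simp]: "1 \<in> lattice \<tau>"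
  unfolding lattice_def by (rule CollectI, rule exI[of _ 1], rule exI[of _ 0]) simp

lemma lattice_tau [simp]: "\<tau> \<in> lattice \<tau>"
  unfolding lattice_def by (rule CollectI, rule exI[of _ 0], rule exI[of _ 1]) simp

lemma lattice_add_left_iff: "l \<in> lattice \<tau> \<Longrightarrow> l + x \<in> lattice \<tau> \<longleftrightarrow> x \<in> lattice \<tau>"
  using lattice_add[of l \<tau> x] lattice_diff[of "l + x" \<tau> l] by auto

lemma invariant_shift_int:
  assumes "\<And>z :: complex. R (z + c) \<longleftrightarrow> R z"
  shows "R (z + of_int n * c) \<longleftrightarrow> R z"
proof (induction n rule: int_induct[where k = 0])
  case (step1 i)
  then show ?case using assms[of "z + of_int i * c"] by (simp add: algebra_simps)
next
  case (step2 i)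
  then show ?case using assms[of "z + of_int (i - 1) * c"] by (simp add: algebra_simps)
qed simp

text \<open>Stated for predicates, since the functions in question are only quasi-periodic: what a
  lattice shift preserves is that they vanish, that a zero is simple, or that their norm is bounded
  by a given constant.\<close>

lemma lattice_invariant:
  assumes "l \<in> lattice \<tau>" "\<And>z. R (z + 1) \<longleftrightarrow> R z" "\<And>z. R (z + \<tau>) \<longleftrightarrow> R z"
  shows "R (z + l) \<longleftrightarrow> R z"
proof -
  obtain m n where l: "l = of_int m + of_int n * \<tau>"
    using assms(1) by (auto simp: lattice_def)
  have "R (z + l) \<longleftrightarrow> R ((z + of_int m * 1) + of_int n * \<tau>)" by (simp add: l add.assoc)
  also have "\<dots> \<longleftrightarrow> R (z + of_int m * 1)" by (rule invariant_shift_int) (rule assms(3))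
  also have "\<dots> \<longleftrightarrow> R z" by (rule invariant_shift_int) (rule assms(2))
  finally show ?thesis .
qed

lemma xexp_eq_1_iff: "xexp z = 1 \<longleftrightarrow> (\<exists>m::int. z = of_int m)"
proof
  assume "xexp z = 1"
  then obtain n :: int where "Re (2 * of_real pi * \<i> * z) = 0" "Im (2 * of_real pi * \<i> * z) = of_int (2 * n) * pi"
    unfolding xexp_def exp_eq_1 by blast
  then have "z = of_int n" by (simp add: complex_eq_iff)
  then show "\<exists>m::int. z = of_int m" ..
next
  assume "\<exists>m::int. z = of_int m"
  then obtain m :: int where z: "z = of_int m" ..
  have "(xexp (0 + of_int m * 1) = 1) = (xexp 0 = 1)"
    by (rule invariant_shift_int[where R = "\<lambda>z. xexp z = 1"]) (simp add: xexp_add)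
  then show "xexp z = 1" by (simp add: z)
qed

lemma xexp_of_nat_mult: "xexp (of_nat n * z) = xexp z ^ n"
  unfolding xexp_def exp_of_nat_mult[symmetric] by (simp add: algebra_simps)

lemma simple_zero_shift:
  fixes P m :: "complex \<Rightarrow> complex"
  assumes P: "P holomorphic_on UNIV" and m: "m holomorphic_on UNIV" and nz: "m z \<noteq> 0"
    and eq: "\<And>z. P (z + c) = m z * P z"
  shows "P (z + c) = 0 \<and> deriv P (z + c) \<noteq> 0 \<longleftrightarrow> P z = 0 \<and> deriv P z \<noteq> 0"
proof -
  have "((\<lambda>z. P (z + c)) has_field_derivative deriv P (z + c)) (at z)"
    using DERIV_shift[of P "deriv P (z + c)" z c] entire_has_deriv[OF P] by simp
  then have "((\<lambda>z. m z * P z) has_field_derivative deriv P (z + c)) (at z)"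
    by (simp add: eq)
  moreover have "((\<lambda>z. m z * P z) has_field_derivative (deriv m z * P z + deriv P z * m z)) (at z)"
    by (rule DERIV_mult[OF entire_has_deriv[OF m] entire_has_deriv[OF P]])
  ultimately have "deriv P (z + c) = deriv m z * P z + deriv P z * m z"
    by (rule DERIV_unique)
  then show ?thesis using nz eq by auto
qed

text \<open>
  The product side of Jacobi's triple product identity. The identity itself, up to a constant, is only
  obtained in the proof of \<open>theta_eq_0_iff\<close>, as both sides are quasi-periodic in the same way.
\<close>

definition theta_product :: "complex \<Rightarrow> complex \<Rightarrow> complex" where
  "theta_product \<tau> z = exp (- (of_real pi * \<i> * z)) * qpoch (xexp \<tau>) (xexp z) * qpoch (xexp \<tau>) (xexp \<tau> * xexp (- z))"

context upper_half_plane
begin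

section \<open>Liouville's theorem for quasi-periodic functions\<close>

lemma lattice_reduce:
  obtains l a b where "l \<in> lattice \<tau>" "0 \<le> a" "a \<le> 1" "0 \<le> b" "b \<le> 1"
    "z = (complex_of_real a + complex_of_real b * \<tau>) + l"
proof -
  define s where "s = Im z / Im \<tau>"
  define r where "r = Re z - s * Re \<tau>"
  have z: "z = of_real r + of_real s * \<tau>"
    using \<tau> by (simp add: complex_eq_iff r_def s_def)
  have "z = (of_real (frac r) + of_real (frac s) * \<tau>) + (of_int \<lfloor>r\<rfloor> + of_int \<lfloor>s\<rfloor> * \<tau>)"
  proof -
    have "of_real r = (of_real (frac r) + of_int \<lfloor>r\<rfloor> :: complex)"
      "of_real s = (of_real (frac s) + of_int \<lfloor>s\<rfloor> :: complex)"
      by (simp_all add: frac_def)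
    then show ?thesis using z by (simp add: algebra_simps)
  qed
  moreover have "of_int \<lfloor>r\<rfloor> + of_int \<lfloor>s\<rfloor> * \<tau> \<in> lattice \<tau>"
    by (auto simp: lattice_def)
  ultimately show thesis
    using that frac_ge_0 frac_lt_1 by (metis less_imp_le)
qed

text \<open>Periodicity is required of the norm only, so that multipliers of modulus 1, in
  particular signs, are covered. The values on a compact period parallelogram bound the function
  everywhere.\<close>

lemma elliptic_entire_constant:
  assumes Q: "Q holomorphic_on UNIV"
    and per: "\<And>z. norm (Q (z + 1)) = norm (Q z)" "\<And>z. norm (Q (z + \<tau>)) = norm (Q z)"
  obtains c where "\<And>z. Q z = c"
proof -
  let ?K = "(\<lambda>(a, b). complex_of_real a + complex_of_real b * \<tau>) ` ({0..1} \<times> {0..1})"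
  have "compact ?K"
    by (intro compact_continuous_image compact_Times compact_Icc)
      (auto simp: case_prod_unfold intro!: continuous_intros)
  then have "compact (Q ` ?K)"
    by (rule compact_continuous_image[rotated])
      (rule continuous_on_subset[OF holomorphic_on_imp_continuous_on[OF Q]], simp)
  then obtain B where B: "\<And>w. w \<in> ?K \<Longrightarrow> norm (Q w) \<le> B"
    using compact_imp_bounded[of "Q ` ?K"] unfolding bounded_iff by blast
  have "norm (Q z) \<le> B" for z
  proof -
    obtain l a b where l: "l \<in> lattice \<tau>" and ab: "0 \<le> a" "a \<le> 1" "0 \<le> b" "b \<le> 1"
      and z: "z = (complex_of_real a + complex_of_real b * \<tau>) + l"
      using lattice_reduce by metis
    have "norm (Q z) \<le> B \<longleftrightarrow> norm (Q (complex_of_real a + complex_of_real b * \<tau>)) \<le> B"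
      unfolding z by (rule lattice_invariant[OF l]) (simp_all only: per)
    moreover have "complex_of_real a + complex_of_real b * \<tau> \<in> ?K" using ab by force
    ultimately show ?thesis using B by blast
  qed
  then have "bounded (range Q)" unfolding bounded_iff by blast
  then show thesis
    using Liouville_theorem[OF Q] that unfolding constant_on_def by blast
qed

text \<open>\<open>m1\<close> and \<open>m2\<close> are the multipliers of \<open>P\<close>; those
  of \<open>N\<close> may differ from them by constants \<open>e1\<close>, \<open>e2\<close> of
  modulus 1. The quotient is entire with constant multipliers, hence constant, and a nonzero
  constant forces \<open>e1\<close> and \<open>e2\<close> to be 1. If they are not both 1,
  \<open>N\<close> must vanish.\<close>

lemma quasi_periodic_proportional:
  assumes P: "P holomorphic_on UNIV" and N: "N holomorphic_on UNIV"
    and zeros: "\<And>z. P z = 0 \<Longrightarrow> deriv P z \<noteq> 0" "\<And>z. P z = 0 \<Longrightarrow> N z = 0"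
    and nz: "P b \<noteq> 0"
    and m: "\<And>z. m1 z \<noteq> 0" "\<And>z. m2 z \<noteq> 0" and e: "norm e1 = 1" "norm e2 = 1"
    and P1: "\<And>z. P (z + 1) = m1 z * P z" and P2: "\<And>z. P (z + \<tau>) = m2 z * P z"
    and N1: "\<And>z. N (z + 1) = e1 * m1 z * N z" and N2: "\<And>z. N (z + \<tau>) = e2 * m2 z * N z"
  obtains c where "\<And>z. N z = c * P z" "c = 0 \<or> e1 = 1 \<and> e2 = 1"
proof -
  obtain Q where Q: "Q holomorphic_on UNIV" and NPQ: "\<And>z. N z = P z * Q z"
    using entire_quotient[OF P N zeros] by blast
  have shift: "Q (z + a) = e * Q z"
    if Pa: "\<And>z. P (z + a) = m z * P z" and Na: "\<And>z. N (z + a) = e * m z * N z" and m: "\<And>z. m z \<noteq> 0"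
    for a e m z
  proof -
    \<comment> \<open>The multiplier can be cancelled pointwise, but \<open>P\<close> has zeros;
      \<open>entire_mult_eq_0D\<close> removes it afterwards.\<close>
    have "P z * (Q (z + a) - e * Q z) = 0" for z
    proof -
      have "m z * (P z * (Q (z + a) - e * Q z)) = P (z + a) * Q (z + a) - e * m z * (P z * Q z)"
        unfolding Pa by (simp add: algebra_simps)
      also have "\<dots> = N (z + a) - e * m z * N z"
        unfolding NPQ ..
      also have "\<dots> = 0" by (simp add: Na)
      finally show ?thesis using m by simp
    qed
    moreover have "(\<lambda>z. Q (z + a) - e * Q z) holomorphic_on UNIV"
      by (intro holomorphic_intros Q entire_compose[OF Q])
    ultimately have "Q (z + a) - e * Q z = 0"
      using entire_mult_eq_0D[OF P _ nz] by blast
    then show ?thesis by simp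
  qed
  have s1: "Q (z + 1) = e1 * Q z" and s2: "Q (z + \<tau>) = e2 * Q z" for z
    using shift[OF P1 N1 m(1)] shift[OF P2 N2 m(2)] by auto
  obtain c where c: "\<And>z. Q z = c"
    using elliptic_entire_constant[OF Q] by (metis s1 s2 e norm_mult mult_1)
  show thesis
  proof (rule that)
    show "N z = c * P z" for z using NPQ c by simp
    show "c = 0 \<or> e1 = 1 \<and> e2 = 1" using s1[of 0] s2[of 0] c by auto
  qed
qed

section \<open>Zeros of the theta function\<close>

lemma theta_product_holomorphic: "theta_product \<tau> holomorphic_on UNIV"
proof -
  have 1: "(\<lambda>z. qpoch (xexp \<tau>) (g z)) holomorphic_on UNIV" if "g holomorphic_on UNIV" for g
    using entire_compose[OF qpoch_holomorphic that] norm_xexp_less_1[OF \<tau>] by blast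
  then show ?thesis
    unfolding theta_product_def[abs_def]
    by (intro holomorphic_intros 1)
qed

lemma theta_product_plus_1: "theta_product \<tau> (z + 1) = - theta_product \<tau> z"
proof -
  have "xexp (- z - 1) = xexp (- z)"
    using xexp_add[of "- z" "- 1"] xexp_minus[of 1] by simp
  then show ?thesis
    by (simp add: theta_product_def xexp_add distrib_left exp_diff exp_minus)
qed

lemma theta_product_plus_tau:
  "theta_product \<tau> (z + \<tau>) = - exp (- (of_real pi * \<i> * \<tau>)) * xexp (- z) * theta_product \<tau> z"
proof -
  define q x where "q = xexp \<tau>" and "x = xexp z"
  have nz: "x \<noteq> 0" "q \<noteq> 0" by (auto simp: q_def x_def)
  have q: "norm q < 1" using norm_xexp_less_1[OF \<tau>] by (simp add: q_def)
  have 1: "xexp (- (z + \<tau>)) = inverse (q * x)" "xexp (z + \<tau>) = q * x"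
    unfolding xexp_minus by (simp_all add: q_def x_def xexp_add)
  have 4: "q * inverse (q * x) = inverse x" using nz by (simp add: field_simps)
  have 2: "qpoch q (inverse x) = (1 - inverse x) * qpoch q (q * inverse x)"
    by (rule qpoch_shift[OF q])
  have 3: "qpoch q (q * x) * qpoch q (inverse x) = - inverse x * (qpoch q x * qpoch q (q * inverse x))"
    unfolding 2 qpoch_shift[OF q, of x] using nz by (simp add: field_simps)
  have "theta_product \<tau> (z + \<tau>) = exp (- (of_real pi * \<i> * (z + \<tau>))) * (qpoch q (q * x) * qpoch q (inverse x))"
    by (simp only: theta_product_def q_def[symmetric] 1 4 mult.assoc)
  also have "\<dots> = - exp (- (of_real pi * \<i> * \<tau>)) * xexp (- z) * theta_product \<tau> z"
    unfolding 3 theta_product_def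
    by (simp add: q_def[symmetric] x_def[symmetric] xexp_minus exp_add exp_diff exp_minus distrib_left field_simps)
  finally show ?thesis .
qed

text \<open>The first \<open>qpoch\<close> factor vanishes at m - n\<tau> and the second at m + (n +
  1)\<tau>, for integers m and n \<ge> 0; together these points make up the lattice.\<close>

lemma theta_product_eq_0_iff: "theta_product \<tau> z = 0 \<longleftrightarrow> z \<in> lattice \<tau>"
proof -
  note q = norm_xexp_less_1[OF \<tau>]
  have "qpoch (xexp \<tau>) (xexp z) = 0 \<longleftrightarrow> (\<exists>n::nat. \<exists>m::int. of_nat n * \<tau> + z = of_int m)"
    unfolding qpoch_eq_0_iff[OF q] xexp_eq_1_iff[symmetric] xexp_add xexp_of_nat_mult ..
  moreover have "qpoch (xexp \<tau>) (xexp \<tau> * xexp (- z)) = 0 \<longleftrightarrow>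
      (\<exists>n::nat. \<exists>m::int. of_nat n * \<tau> + (\<tau> + - z) = of_int m)"
    unfolding qpoch_eq_0_iff[OF q] xexp_eq_1_iff[symmetric] xexp_add xexp_of_nat_mult ..
  moreover have "(\<exists>n::nat. \<exists>m::int. of_nat n * \<tau> + z = of_int m) \<or>
      (\<exists>n::nat. \<exists>m::int. of_nat n * \<tau> + (\<tau> + - z) = of_int m) \<longleftrightarrow> z \<in> lattice \<tau>"
  proof (intro iffI; (elim disjE exE)?)
    fix n :: nat and m :: int assume "of_nat n * \<tau> + z = of_int m"
    then have "z = of_int m + of_int (- int n) * \<tau>" by (simp add: algebra_simps)
    then show "z \<in> lattice \<tau>" unfolding lattice_def by blast
  next
    fix n :: nat and m :: int assume "of_nat n * \<tau> + (\<tau> + - z) = of_int m"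
    then have "z = of_int (- m) + of_int (int n + 1) * \<tau>" by (simp add: algebra_simps)
    then show "z \<in> lattice \<tau>" unfolding lattice_def by blast
  next
    assume "z \<in> lattice \<tau>"
    then obtain m n where z: "z = of_int m + of_int n * \<tau>" by (auto simp: lattice_def)
    show "(\<exists>n::nat. \<exists>m::int. of_nat n * \<tau> + z = of_int m) \<or>
      (\<exists>n::nat. \<exists>m::int. of_nat n * \<tau> + (\<tau> + - z) = of_int m)"
    proof (cases "n \<le> 0")
      case True
      then have "of_nat (nat (- n)) * \<tau> + z = of_int m" by (simp add: z algebra_simps)
      then show ?thesis by blast
    next
      case False
      then have "of_nat (nat (n - 1)) * \<tau> + (\<tau> + - z) = of_int (- m)" by (simp add: z algebra_simps)
      then show ?thesis by blast
    qed
  qed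
  ultimately show ?thesis by (simp add: theta_product_def)
qed

text \<open>At 0 the factor \<open>1 - xexp z\<close> splits off and leaves a function that is
  nonzero there. Having a simple zero is then carried from 0 to all lattice points.\<close>

lemma theta_product_deriv_nonzero:
  assumes "theta_product \<tau> z = 0"
  shows "deriv (theta_product \<tau>) z \<noteq> 0"
proof -
  define q where "q = xexp \<tau>"
  have q: "norm q < 1" using norm_xexp_less_1[OF \<tau>] by (simp add: q_def)
  define R where "R = (\<lambda>z. exp (- (of_real pi * \<i> * z)) * qpoch q (q * xexp z) * qpoch q (q * xexp (- z)))"
  have PR: "theta_product \<tau> z = (1 - xexp z) * R z" for z
    unfolding theta_product_def R_def q_def[symmetric] by (subst qpoch_shift[OF q]) simp
  have R: "R holomorphic_on UNIV"
  proof -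
    have 1: "(\<lambda>z. qpoch q (g z)) holomorphic_on UNIV" if "g holomorphic_on UNIV" for g
      using entire_compose[OF qpoch_holomorphic that] q by blast
    then show ?thesis
      unfolding R_def by (intro holomorphic_intros 1)
  qed
  have "qpoch q q \<noteq> 0"
  proof
    assume "qpoch q q = 0"
    then obtain n where "q ^ Suc n = 1" unfolding qpoch_eq_0_iff[OF q] by (auto simp: mult.commute)
    moreover have "norm q ^ Suc n < 1"
      using q by (subst power_less_one_iff) auto
    ultimately show False
      using norm_power[of q "Suc n"] by (simp del: power_Suc)
  qed
  then have R0: "R 0 \<noteq> 0" by (simp add: R_def)
  have "((\<lambda>z. (1 - xexp z) * R z) has_field_derivative
      (- (2 * of_real pi * \<i> * xexp 0) * R 0 + deriv R 0 * (1 - xexp 0))) (at 0)"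
    by (rule DERIV_mult[OF _ entire_has_deriv[OF R]])
      (auto simp: xexp_def intro!: derivative_eq_intros)
  then have "deriv (theta_product \<tau>) 0 = - (2 * of_real pi * \<i>) * R 0"
    using DERIV_imp_deriv by (fastforce simp: PR[abs_def])
  then have 0: "theta_product \<tau> 0 = 0 \<and> deriv (theta_product \<tau>) 0 \<noteq> 0"
    using R0 theta_product_eq_0_iff by simp
  let ?S = "\<lambda>z. theta_product \<tau> z = 0 \<and> deriv (theta_product \<tau>) z \<noteq> 0"
  have "?S (0 + z) \<longleftrightarrow> ?S 0"
  proof (rule lattice_invariant[where R = ?S])
    show "z \<in> lattice \<tau>" using assms theta_product_eq_0_iff by simp
    show "?S (z + 1) \<longleftrightarrow> ?S z" for z
      using simple_zero_shift[OF theta_product_holomorphic, of "\<lambda>_. -1" z 1] theta_product_plus_1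
      by (simp add: holomorphic_intros)
    show "?S (z + \<tau>) \<longleftrightarrow> ?S z" for z
    proof (rule simple_zero_shift[OF theta_product_holomorphic])
      show "theta_product \<tau> (z + \<tau>) = (- exp (- (of_real pi * \<i> * \<tau>)) * xexp (- z)) * theta_product \<tau> z" for z
        by (rule theta_product_plus_tau)
      show "(\<lambda>z. - exp (- (of_real pi * \<i> * \<tau>)) * xexp (- z)) holomorphic_on UNIV"
        by (auto simp: xexp_def intro!: holomorphic_intros)
    qed simp
  qed
  then show ?thesis using 0 by simp
qed

text \<open>Oddness makes \<open>theta\<close> vanish at 0, and quasi-periodicity spreads this zero
  over the lattice, that is, over all zeros of \<open>theta_product\<close>. So \<open>theta\<close>
  is a multiple of \<open>theta_product\<close>, and \<open>theta_not_identically_0\<close> excludes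
  the factor 0.\<close>

lemma theta_eq_0_iff: "theta \<tau> z = 0 \<longleftrightarrow> z \<in> lattice \<tau>"
  and theta_deriv_nonzero: "z \<in> lattice \<tau> \<Longrightarrow> deriv (theta \<tau>) z \<noteq> 0"
proof -
  have zero_on_lattice: "theta \<tau> l = 0" if "l \<in> lattice \<tau>" for l
    using lattice_invariant[OF that, of "\<lambda>z. theta \<tau> z = 0" 0]
    by (simp add: theta_plus_1 theta_plus_tau theta_0)
  obtain b where b: "theta \<tau> b \<noteq> 0" using theta_not_identically_0 ..
  then have "b \<notin> lattice \<tau>" using zero_on_lattice by blast
  then have Pb: "theta_product \<tau> b \<noteq> 0" by (simp add: theta_product_eq_0_iff)
  obtain c where c: "\<And>z. theta \<tau> z = c * theta_product \<tau> z"
  proof (rule quasi_periodic_proportional[OF theta_product_holomorphic theta_holomorphic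
        theta_product_deriv_nonzero _ Pb, where ?e1.0 = 1 and ?e2.0 = 1])
    show "theta \<tau> z = 0" if "theta_product \<tau> z = 0" for z
      using that zero_on_lattice theta_product_eq_0_iff by blast
    show "theta_product \<tau> (z + 1) = (-1) * theta_product \<tau> z" for z by (simp add: theta_product_plus_1)
    show "theta_product \<tau> (z + \<tau>) = (- exp (- (of_real pi * \<i> * \<tau>)) * xexp (- z)) * theta_product \<tau> z" for z
      by (rule theta_product_plus_tau)
    fix c assume "\<And>z. theta \<tau> z = c * theta_product \<tau> z"
    then show thesis by (rule that)
  qed (simp_all add: theta_plus_1 theta_plus_tau)
  have cnz: "c \<noteq> 0" using b c by auto
  show "theta \<tau> z = 0 \<longleftrightarrow> z \<in> lattice \<tau>"
    using cnz by (simp add: c theta_product_eq_0_iff)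
  assume "z \<in> lattice \<tau>"
  then have "deriv (theta_product \<tau>) z \<noteq> 0"
    using theta_product_deriv_nonzero theta_product_eq_0_iff by blast
  moreover have "deriv (theta \<tau>) z = c * deriv (theta_product \<tau>) z"
    unfolding c[abs_def]
    by (rule DERIV_imp_deriv[OF DERIV_cmult[OF entire_has_deriv[OF theta_product_holomorphic]]])
  ultimately show "deriv (theta \<tau>) z \<noteq> 0" using cnz by simp
qed

end

section \<open>The functions \<open>f\<^sub>1, f\<^sub>2, f\<^sub>3\<close>\<close>

text \<open>The exponential factor makes these functions even for a = 1, 2, 3. They are then
  multiples of Jacobi's \<open>\<theta>\<^sub>2\<close>, \<open>\<theta>\<^sub>4\<close>,
  \<open>\<theta>\<^sub>3\<close>.\<close>

definition jtheta :: "complex \<Rightarrow> nat \<Rightarrow> complex \<Rightarrow> complex" where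
  "jtheta \<tau> a z = xexp (z * domega a) * theta \<tau> (z + omega \<tau> a)"

text \<open>Normalised to have residue 1 at 0. Up to rescaling of argument and value these are
  Jacobi's functions cs, ns, ds for a = 1, 2, 3.\<close>

definition ellf :: "complex \<Rightarrow> nat \<Rightarrow> complex \<Rightarrow> complex" where
  "ellf \<tau> a z = deriv (theta \<tau>) 0 * jtheta \<tau> a z / (jtheta \<tau> a 0 * theta \<tau> z)"

lemma omega_simps [simp]:
  "omega \<tau> 0 = 0" "omega \<tau> (Suc 0) = 1/2" "omega \<tau> 2 = \<tau>/2" "omega \<tau> 3 = (1 + \<tau>)/2"
  by (simp_all add: omega_def numeral_2_eq_2 numeral_3_eq_3)

lemma domega_simps [simp]:
  "domega 0 = 0" "domega (Suc 0) = 0" "domega 2 = 1/2" "domega 3 = 1/2"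
  by (simp_all add: domega_def numeral_2_eq_2 numeral_3_eq_3)

text \<open>\<open>sign_1 a\<close> and \<open>sign_tau a\<close> are the multipliers of
  \<open>ellf \<tau> a\<close> under the periods 1 and \<tau>. For a = 1, 2, 3 they run through the
  three nontrivial pairs of signs.\<close>

definition sign_1 :: "nat \<Rightarrow> complex" where "sign_1 a = (if a = 1 then 1 else -1)"
definition sign_tau :: "nat \<Rightarrow> complex" where "sign_tau a = (if a = 2 then 1 else -1)"

lemma index_123: "a \<in> {1..3::nat} \<longleftrightarrow> a = 1 \<or> a = 2 \<or> a = 3"
  by auto

definition triple :: "nat \<Rightarrow> nat \<Rightarrow> nat \<Rightarrow> bool" where
  "triple a b c \<longleftrightarrow> a \<in> {1..3} \<and> b \<in> {1..3} \<and> c \<in> {1..3} \<and> a \<noteq> b \<and> b \<noteq> c \<and> a \<noteq> c"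

lemma tripleD: "triple a b c \<Longrightarrow> a \<in> {1..3}" "triple a b c \<Longrightarrow> b \<in> {1..3}" "triple a b c \<Longrightarrow> c \<in> {1..3}"
  by (simp_all add: triple_def)

lemma triple_rot: "triple a b c \<Longrightarrow> triple b c a"
  and triple_swap: "triple a b c \<Longrightarrow> triple a c b"
  by (auto simp: triple_def)

lemmas triple_perms = triple_rot triple_rot[OF triple_rot] triple_swap triple_swap[OF triple_rot]
  triple_swap[OF triple_rot[OF triple_rot]]

lemma triple_exists_middle:
  assumes "a \<in> {1..3}" "c \<in> {1..3}" "a \<noteq> c"
  shows "\<exists>b. triple a b c"
proof -
  have "triple a 1 c \<or> triple a 2 c \<or> triple a 3 c"
    using assms unfolding triple_def index_123 by auto
  then show ?thesis by blast
qed

lemma triple_exists: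
  assumes "a \<in> {1..3}"
  shows "\<exists>b c. triple a b c"
  using assms triple_exists_middle[of a 1] triple_exists_middle[of a 2] by fastforce

lemma triple_123: "triple 1 2 3" "triple 2 3 1" "triple 3 1 2"
  by (simp_all add: triple_def)

lemma triple_cases:
  "triple a b c \<longleftrightarrow> (a, b, c) \<in> {(1, 2, 3), (1, 3, 2), (2, 1, 3), (2, 3, 1), (3, 1, 2), (3, 2, 1)}"
  unfolding triple_def index_123 by auto

context upper_half_plane
begin

lemma lattice_coords:
  assumes "complex_of_real a + complex_of_real b * \<tau> \<in> lattice \<tau>"
  shows "a \<in> \<int>" "b \<in> \<int>"
proof -
  obtain m n where *: "complex_of_real a + complex_of_real b * \<tau> = of_int m + of_int n * \<tau>"
    using assms by (auto simp: lattice_def)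
  have "b * Im \<tau> = of_int n * Im \<tau>" using arg_cong[OF *, of Im] by simp
  then have b: "b = of_int n" using \<tau> by simp
  then have "a = of_int m" using arg_cong[OF *, of Re] by simp
  with b show "a \<in> \<int>" "b \<in> \<int>" by auto
qed

lemma half_not_Ints: "(1/2 :: real) \<notin> \<int>"
proof
  assume "(1/2 :: real) \<in> \<int>"
  then obtain n :: int where "1/2 = (of_int n :: real)" by (auto elim: Ints_cases)
  then have "of_int (2 * n) = (of_int 1 :: real)" by simp
  then have "2 * n = 1" by (simp only: of_int_eq_iff)
  then show False by presburger
qed

lemma omega_notin_lattice: "a \<in> {1..3} \<Longrightarrow> omega \<tau> a \<notin> lattice \<tau>"
  using lattice_coords[of "1/2" 0] lattice_coords[of 0 "1/2"] lattice_coords[of "1/2" "1/2"] half_not_Ints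
  unfolding index_123 by (auto simp: algebra_simps add_divide_distrib)

lemma two_omega_in_lattice: "a \<in> {1..3} \<Longrightarrow> 2 * omega \<tau> a \<in> lattice \<tau>"
  unfolding index_123 by (auto simp: add_divide_distrib lattice_add)

text \<open>Two different half periods add up to the third one modulo the lattice.\<close>

lemma omega_add_notin_lattice:
  assumes "a \<in> {1..3}" "b \<in> {1..3}" "a \<noteq> b"
  shows "omega \<tau> a + omega \<tau> b \<notin> lattice \<tau>"
proof -
  have eq: "omega \<tau> 1 + omega \<tau> 2 = 0 + omega \<tau> 3" "omega \<tau> 2 + omega \<tau> 3 = \<tau> + omega \<tau> 1"
    "omega \<tau> 1 + omega \<tau> 3 = 1 + omega \<tau> 2"
    by (simp_all add: field_simps)
  have "omega \<tau> 1 + omega \<tau> 2 \<notin> lattice \<tau>" "omega \<tau> 2 + omega \<tau> 3 \<notin> lattice \<tau>"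
    "omega \<tau> 1 + omega \<tau> 3 \<notin> lattice \<tau>"
    unfolding eq using omega_notin_lattice[of 1] omega_notin_lattice[of 2] omega_notin_lattice[of 3]
    by (simp_all only: lattice_add_left_iff lattice_0 lattice_1 lattice_tau) simp_all
  moreover have "a = 1 \<and> b = 2 \<or> a = 2 \<and> b = 1 \<or> a = 2 \<and> b = 3 \<or> a = 3 \<and> b = 2 \<or> a = 1 \<and> b = 3 \<or> a = 3 \<and> b = 1"
    using assms unfolding index_123 by auto
  ultimately show ?thesis
    by (elim disjE conjE) (simp_all only: add.commute not_False_eq_True)
qed

lemma theta_plus_tau': "theta \<tau> (z + \<tau>) = - xexp (- \<tau> / 2 - z) * theta \<tau> z"
proof -
  have "exp (- (of_real pi * \<i> * \<tau>)) = xexp (- \<tau> / 2)" by (simp add: xexp_def mult_ac)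
  then show ?thesis
    using theta_plus_tau[of z] xexp_add[of "- \<tau> / 2" "- z"] by simp
qed

lemma jtheta_holomorphic: "jtheta \<tau> a holomorphic_on UNIV"
  unfolding jtheta_def[abs_def]
  by (intro holomorphic_intros entire_compose[OF theta_holomorphic])

lemma jtheta_plus_1: "a \<in> {1..3} \<Longrightarrow> jtheta \<tau> a (z + 1) = - sign_1 a * jtheta \<tau> a z"
  using theta_plus_1[of "z + omega \<tau> a"] xexp_add[of "z / 2" "1 / 2"]
  unfolding index_123
  by (auto simp: jtheta_def sign_1_def xexp_half algebra_simps add_divide_distrib)

lemma jtheta_plus_tau:
  assumes "a \<in> {1..3}"
  shows "jtheta \<tau> a (z + \<tau>) = - sign_tau a * xexp (- \<tau> / 2 - z) * jtheta \<tau> a z"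
proof -
  have "jtheta \<tau> a (z + \<tau>) = xexp ((z + \<tau>) * domega a) * (- xexp (- \<tau> / 2 - (z + omega \<tau> a)) * theta \<tau> (z + omega \<tau> a))"
    using theta_plus_tau'[of "z + omega \<tau> a"] by (simp add: jtheta_def add_ac)
  also have "\<dots> = - xexp (\<tau> * domega a - omega \<tau> a) * xexp (- \<tau> / 2 - z) * jtheta \<tau> a z"
  proof -
    have "xexp ((z + \<tau>) * domega a) * xexp (- \<tau> / 2 - (z + omega \<tau> a)) =
        xexp (\<tau> * domega a - omega \<tau> a) * xexp (- \<tau> / 2 - z) * xexp (z * domega a)"
      unfolding xexp_add[symmetric] by (rule arg_cong[where f = xexp]) (simp add: algebra_simps)
    then show ?thesis by (simp add: jtheta_def)
  qed
  also have "xexp (\<tau> * domega a - omega \<tau> a) = sign_tau a"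
    using assms xexp_minus[of "1/2"] unfolding index_123
    by (auto simp: sign_tau_def xexp_half add_divide_distrib)
  finally show ?thesis .
qed

text \<open>The points \<omega> and -\<omega> differ by a period when \<omega> is a half period. The
  factor that \<open>theta\<close> acquires from this period, together with its oddness, is
  compensated by \<open>xexp (z * domega a)\<close>.\<close>

lemma jtheta_minus:
  assumes a: "a \<in> {1..3}"
  shows "jtheta \<tau> a (- z) = jtheta \<tau> a z"
proof -
  have t: "theta \<tau> (w - 1/2) = - theta \<tau> (w + 1/2)" for w
    using theta_plus_1[of "w - 1/2"] by (simp add: algebra_simps)
  have 1: "theta \<tau> (1/2 - z) = theta \<tau> (z + 1/2)"
    using theta_minus[of "z - 1/2"] t[of z] by (simp add: algebra_simps)
  have t2: "theta \<tau> (w + \<tau>/2) = - xexp (- w) * theta \<tau> (w - \<tau>/2)" for w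
    using theta_plus_tau'[of "w - \<tau>/2"] by (simp add: add.commute)
  have 2: "theta \<tau> (\<tau>/2 - z) = xexp z * theta \<tau> (z + \<tau>/2)"
    using theta_minus[of "z - \<tau>/2"] t2[of z] xexp_minus[of z] by (simp add: algebra_simps)
  have 3: "theta \<tau> ((1+\<tau>)/2 - z) = xexp z * theta \<tau> (z + (1+\<tau>)/2)"
  proof -
    have "theta \<tau> ((1+\<tau>)/2 - z) = - theta \<tau> ((z - 1/2) - \<tau>/2)"
      using theta_minus[of "z - 1/2 - \<tau>/2"] by (simp add: algebra_simps add_divide_distrib)
    also have "\<dots> = xexp (z - 1/2) * theta \<tau> ((z - 1/2) + \<tau>/2)"
      unfolding t2[of "z - 1/2"] using xexp_minus[of "z - 1/2"] by simp
    also have "xexp (z - 1/2) = - xexp z"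
      using xexp_add[of z "-1/2"] xexp_minus[of "1/2"] by (simp add: xexp_half)
    also have "theta \<tau> ((z - 1/2) + \<tau>/2) = - theta \<tau> (z + (1+\<tau>)/2)"
      using t[of "z + \<tau>/2"] by (simp add: algebra_simps add_divide_distrib)
    finally show ?thesis by simp
  qed
  have 4: "xexp (- (z / 2)) * xexp z = xexp (z / 2)"
    unfolding xexp_add[symmetric] by (rule arg_cong[where f = xexp]) simp
  show ?thesis
    using a 1 2 3 4 unfolding index_123
    by (auto simp: jtheta_def mult.assoc[symmetric])
qed

lemma jtheta_eq_0_iff: "jtheta \<tau> a z = 0 \<longleftrightarrow> z + omega \<tau> a \<in> lattice \<tau>"
  by (simp add: jtheta_def theta_eq_0_iff)

lemma jtheta_0_nonzero [simp]: "a \<in> {1..3} \<Longrightarrow> jtheta \<tau> a 0 \<noteq> 0"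
  using omega_notin_lattice by (simp add: jtheta_eq_0_iff)

lemma theta_deriv_0_nonzero [simp]: "deriv (theta \<tau>) 0 \<noteq> 0"
  by (rule theta_deriv_nonzero) simp

lemma ellf_minus: "a \<in> {1..3} \<Longrightarrow> ellf \<tau> a (- z) = - ellf \<tau> a z"
  by (simp add: ellf_def jtheta_minus theta_minus)

lemma ellf_eq_0_iff:
  "a \<in> {1..3} \<Longrightarrow> z \<notin> lattice \<tau> \<Longrightarrow> ellf \<tau> a z = 0 \<longleftrightarrow> z + omega \<tau> a \<in> lattice \<tau>"
  using theta_eq_0_iff omega_notin_lattice[of a] by (simp add: ellf_def jtheta_eq_0_iff del: One_nat_def)

lemma ellf_nonzero:
  assumes "a \<in> {1..3}" "2 * z \<notin> lattice \<tau>"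
  shows "ellf \<tau> a z \<noteq> 0"
proof -
  have z: "z \<notin> lattice \<tau>" using assms(2) lattice_add[of z \<tau> z] by auto
  have "z + omega \<tau> a \<notin> lattice \<tau>"
  proof
    assume "z + omega \<tau> a \<in> lattice \<tau>"
    then have "2 * (z + omega \<tau> a) - 2 * omega \<tau> a \<in> lattice \<tau>"
      using lattice_diff[OF _ two_omega_in_lattice[OF assms(1)]] lattice_add by (metis mult_2)
    then show False using assms(2) by (simp add: algebra_simps)
  qed
  then show ?thesis using ellf_eq_0_iff[OF assms(1) z] by simp
qed

lemma ellf_isCont: "a \<in> {1..3} \<Longrightarrow> z \<notin> lattice \<tau> \<Longrightarrow> isCont (ellf \<tau> a) z"
  unfolding ellf_def[abs_def]
  using theta_eq_0_iff[of z] entire_isCont[OF jtheta_holomorphic] entire_isCont[OF theta_holomorphic]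
  by (intro continuous_intros) auto

lemma ellf_pole:
  assumes a: "a \<in> {1..3}"
  shows "((\<lambda>z. z * ellf \<tau> a z) \<longlongrightarrow> 1) (at 0)"
proof -
  have "((\<lambda>z. (theta \<tau> z - theta \<tau> 0) / (z - 0)) \<longlongrightarrow> deriv (theta \<tau>) 0) (at 0)"
    using entire_has_deriv[OF theta_holomorphic, of 0]
    by (simp add: has_field_derivative_iff)
  then have t: "((\<lambda>z. theta \<tau> z / z) \<longlongrightarrow> deriv (theta \<tau>) 0) (at 0)"
    by (simp add: theta_0)
  have j: "(jtheta \<tau> a \<longlongrightarrow> jtheta \<tau> a 0) (at 0)"
    using entire_isCont[OF jtheta_holomorphic[of a], of 0] by (simp add: isCont_def)
  have "((\<lambda>z. deriv (theta \<tau>) 0 * jtheta \<tau> a z / (jtheta \<tau> a 0 * (theta \<tau> z / z))) \<longlongrightarrow>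
      deriv (theta \<tau>) 0 * jtheta \<tau> a 0 / (jtheta \<tau> a 0 * deriv (theta \<tau>) 0)) (at 0)"
    using a by (intro tendsto_intros t j) (simp_all del: One_nat_def)
  moreover have "deriv (theta \<tau>) 0 * jtheta \<tau> a 0 / (jtheta \<tau> a 0 * deriv (theta \<tau>) 0) = 1"
    using a by (simp del: One_nat_def)
  moreover have "(\<lambda>z. deriv (theta \<tau>) 0 * jtheta \<tau> a z / (jtheta \<tau> a 0 * (theta \<tau> z / z))) = (\<lambda>z. z * ellf \<tau> a z)"
    by (simp add: ellf_def fun_eq_iff)
  ultimately show ?thesis by simp
qed

text \<open>
  The numerator \<open>N\<close> of the difference of the two sides, as a function of \<open>u\<close>, vanishes at the zeros
  \<open>0\<close> and \<open>-v\<close> of the denominator \<open>P\<close>, and \<open>N/P\<close> is an entire function with multipliers that are signs,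
  not both \<open>1\<close>. Hence it is zero.
\<close>

lemma ellf_addition_bilinear:
  assumes t: "triple a b c"
    and u: "u \<notin> lattice \<tau>" and v: "v \<notin> lattice \<tau>" and uv: "u + v \<notin> lattice \<tau>"
  shows "ellf \<tau> c u * ellf \<tau> b v = ellf \<tau> b (u + v) * ellf \<tau> a u + ellf \<tau> c (u + v) * ellf \<tau> a v"
proof -
  note set = tripleD[OF t]
  \<comment> \<open>The signs of the third function are the products of those of the other two, so
    all three terms of \<open>N\<close> acquire the same multiplier.\<close>
  have s: "sign_1 a * sign_1 b = sign_1 c" "sign_tau a * sign_tau b = sign_tau c"
    "\<not> (sign_1 c = 1 \<and> sign_tau c = 1)" "norm (sign_1 c) = 1" "norm (sign_tau c) = 1"
    using t unfolding triple_cases by (auto simp: sign_1_def sign_tau_def)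
  define D where "D = deriv (theta \<tau>) 0"
  define P where "P = (\<lambda>u. theta \<tau> u * theta \<tau> (u + v))"
  \<comment> \<open>\<open>N\<close> is the difference of the two sides multiplied by
    \<open>theta \<tau> u * theta \<tau> (u + v)\<close>; these constants collect what does not
    depend on u.\<close>
  define k1 k2 k3 where "k1 = D * ellf \<tau> b v / jtheta \<tau> c 0"
    and "k2 = D * D / (jtheta \<tau> b 0 * jtheta \<tau> a 0)" and "k3 = D * ellf \<tau> a v / jtheta \<tau> c 0"
  define N where "N = (\<lambda>u. k1 * (jtheta \<tau> c u * theta \<tau> (u + v)) - k2 * (jtheta \<tau> b (u + v) * jtheta \<tau> a u)
    - k3 * (jtheta \<tau> c (u + v) * theta \<tau> u))"
  have th: "theta \<tau> v \<noteq> 0" using v by (simp add: theta_eq_0_iff)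
  note j0 = set[THEN jtheta_0_nonzero]
  note hol = theta_holomorphic jtheta_holomorphic
  have P: "P holomorphic_on UNIV" and N: "N holomorphic_on UNIV"
    unfolding P_def N_def by (intro holomorphic_intros hol entire_compose[OF hol(1)] entire_compose[OF hol(2)])+
  let ?m = "\<lambda>z. xexp (- \<tau> / 2 - z) * xexp (- \<tau> / 2 - (z + v))"
  have sh: "z + c' + v = (z + v) + c'" for z c' :: complex by simp
  have N1: "N (z + 1) = sign_1 c * 1 * N z" for z
    unfolding N_def sh jtheta_plus_1[OF set(1)] jtheta_plus_1[OF set(2)] jtheta_plus_1[OF set(3)] theta_plus_1
    by (simp add: algebra_simps flip: s(1))
  have N2: "N (z + \<tau>) = sign_tau c * ?m z * N z" for z
    unfolding N_def sh jtheta_plus_tau[OF set(1)] jtheta_plus_tau[OF set(2)] jtheta_plus_tau[OF set(3)] theta_plus_tau'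
    by (simp add: right_diff_distrib flip: s(2))
  have N_inv: "N (z + l) = 0 \<longleftrightarrow> N z = 0" if "l \<in> lattice \<tau>" for z l
    by (rule lattice_invariant[where R = "\<lambda>z. N z = 0", OF that]) (use s(4,5) in \<open>auto simp: N1 N2\<close>)
  have N0: "N 0 = 0"
    using j0 th unfolding N_def k1_def k2_def k3_def ellf_def D_def[symmetric]
    by (simp add: theta_0 field_simps)
  have Nv: "N (- v) = 0"
    using j0 th unfolding N_def k1_def k2_def k3_def ellf_def D_def[symmetric]
    by (simp add: theta_0 theta_minus jtheta_minus[OF set(1)] field_simps)
  obtain k where "\<And>z. N z = k * P z" "k = 0 \<or> sign_1 c = 1 \<and> sign_tau c = 1"
  proof (rule quasi_periodic_proportional[OF P N, where b = u and ?e1.0 = "sign_1 c" and ?e2.0 = "sign_tau c"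
      and ?m1.0 = "\<lambda>_. 1" and ?m2.0 = ?m])
    show "deriv P z \<noteq> 0" if "P z = 0" for z
    proof -
      have "(P has_field_derivative (deriv (theta \<tau>) z * theta \<tau> (z + v) + deriv (theta \<tau>) (z + v) * theta \<tau> z)) (at z)"
        unfolding P_def
        using DERIV_shift[of "theta \<tau>" "deriv (theta \<tau>) (z + v)" z v] entire_has_deriv[OF hol(1)]
        by (intro DERIV_mult) auto
      then have d: "deriv P z = deriv (theta \<tau>) z * theta \<tau> (z + v) + deriv (theta \<tau>) (z + v) * theta \<tau> z"
        by (rule DERIV_imp_deriv)
      have "\<not> (z \<in> lattice \<tau> \<and> z + v \<in> lattice \<tau>)"
        using v lattice_add_left_iff by blast
      moreover have "z \<in> lattice \<tau> \<or> z + v \<in> lattice \<tau>"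
        using that by (simp add: P_def theta_eq_0_iff)
      ultimately consider "z \<in> lattice \<tau>" "z + v \<notin> lattice \<tau>" | "z \<notin> lattice \<tau>" "z + v \<in> lattice \<tau>"
        by blast
      then show ?thesis
        unfolding d
        using theta_deriv_nonzero[of z] theta_deriv_nonzero[of "z + v"]
          theta_eq_0_iff[of z] theta_eq_0_iff[of "z + v"]
        by cases simp_all
    qed
    show "N z = 0" if "P z = 0" for z
    proof -
      have "z \<in> lattice \<tau> \<or> z + v \<in> lattice \<tau>"
        using that by (simp add: P_def theta_eq_0_iff)
      then show ?thesis
        using N_inv[of z 0] N_inv[of "z + v" "- v"] N0 Nv by auto
    qed
    show "P u \<noteq> 0" using u uv by (simp add: P_def theta_eq_0_iff)
    show "P (z + 1) = 1 * P z" for z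
      unfolding P_def sh theta_plus_1 by simp
    show "P (z + \<tau>) = ?m z * P z" for z
      unfolding P_def sh theta_plus_tau' by simp
    show "N (z + 1) = sign_1 c * 1 * N z" "N (z + \<tau>) = sign_tau c * ?m z * N z" for z
      by (rule N1 N2)+
    fix k assume "\<And>z. N z = k * P z" "k = 0 \<or> sign_1 c = 1 \<and> sign_tau c = 1"
    then show thesis by (rule that)
  qed (use s in simp_all)
  then have "N u = 0" using s(3) by auto
  moreover have "theta \<tau> u \<noteq> 0" "theta \<tau> (u + v) \<noteq> 0"
    using u uv by (simp_all add: theta_eq_0_iff)
  then have "ellf \<tau> c u * ellf \<tau> b v - ellf \<tau> b (u + v) * ellf \<tau> a u - ellf \<tau> c (u + v) * ellf \<tau> a v
      = N u / (theta \<tau> u * theta \<tau> (u + v))"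
    using j0 unfolding N_def k1_def k2_def k3_def
    by (simp add: ellf_def[of _ c u] ellf_def[of _ b "u + v"] ellf_def[of _ a u] ellf_def[of _ c "u + v"]
        D_def[symmetric] field_simps)
  ultimately show ?thesis by (simp add: algebra_simps)
qed

end

text \<open>\<open>ell_p\<close> is the Weierstrass function shifted by a constant so that \<open>e\<^sub>1 = 0\<close>.\<close>

definition ell_p :: "complex \<Rightarrow> complex \<Rightarrow> complex" where
  "ell_p \<tau> z = (ellf \<tau> 1 z)\<^sup>2"

definition ell_e :: "complex \<Rightarrow> nat \<Rightarrow> complex" where
  "ell_e \<tau> a = ell_p \<tau> (omega \<tau> a)"

lemma jtheta_Zero: "jtheta \<tau> 0 z = theta \<tau> z"
  by (simp add: jtheta_def)

lemma varphi_eq: "varphi \<tau> \<eta> a z = jtheta \<tau> a (z + \<eta>) * deriv (theta \<tau>) 0 / (jtheta \<tau> a \<eta> * theta \<tau> z)"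
proof -
  have "xexp ((z + \<eta>) * domega a) = xexp (z * domega a) * xexp (\<eta> * domega a)"
    by (simp add: xexp_add[symmetric] distrib_right)
  then show ?thesis
    by (simp add: varphi_def phi_def jtheta_def xexp_def[of "z * domega a"] field_simps)
qed

lemma xexp_has_field_derivative:
  "((\<lambda>z. xexp (z * d)) has_field_derivative 2 * of_real pi * \<i> * d * xexp (z * d)) (at z)"
  unfolding xexp_def by (auto intro!: derivative_eq_intros)

section \<open>Relations between the functions \<open>f\<^sub>a\<close>\<close>

context upper_half_plane
begin

lemma jtheta_has_field_derivative:
  "(jtheta \<tau> a has_field_derivative 2 * of_real pi * \<i> * domega a * jtheta \<tau> a z
     + xexp (z * domega a) * deriv (theta \<tau>) (z + omega \<tau> a)) (at z)"
proof -
  have "((\<lambda>z. theta \<tau> (z + omega \<tau> a)) has_field_derivative deriv (theta \<tau>) (z + omega \<tau> a)) (at z)"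
    using DERIV_shift[of "theta \<tau>" "deriv (theta \<tau>) (z + omega \<tau> a)" z "omega \<tau> a"]
      entire_has_deriv[OF theta_holomorphic] by simp
  from DERIV_mult[OF xexp_has_field_derivative[of "domega a"] this] show ?thesis
    unfolding jtheta_def[abs_def] by (simp add: mult_ac)
qed

text \<open>The zeros of the entire function \<open>theta\<close> are isolated, and they are the
  lattice points. Finitely many conditions of this form can thus be met at once by a small
  t.\<close>

lemma notin_lattice_nearby:
  assumes "a \<noteq> 0"
  shows "eventually (\<lambda>t. c + a * t \<notin> lattice \<tau>) (at (0::complex))"
proof -
  have "omega \<tau> 1 \<notin> lattice \<tau>" by (rule omega_notin_lattice) simp
  then have nz: "theta \<tau> (c + a * ((omega \<tau> 1 - c) / a)) \<noteq> 0"
    using assms by (simp add: theta_eq_0_iff)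
  have "eventually (\<lambda>t. theta \<tau> (c + a * t) \<noteq> 0) (at 0)"
    by (rule entire_nonzero_nearby[OF entire_compose[OF theta_holomorphic], where b = "(omega \<tau> 1 - c) / a"])
      (use nz in \<open>auto intro!: holomorphic_intros\<close>)
  then show ?thesis by (simp add: theta_eq_0_iff)
qed

lemma add_notin_lattice_nearby: "eventually (\<lambda>t. c + t \<notin> lattice \<tau>) (at 0)"
  using notin_lattice_nearby[of 1 c] by simp

lemma eventually_notin_lattice: "eventually (\<lambda>t. t \<notin> lattice \<tau>) (at 0)"
  using notin_lattice_nearby[of 1 0] by simp

text \<open>The bilinear identity is used for (u, v) and for (v, u), and
  \<open>f\<^sub>c(u + v)\<close> is eliminated.\<close>

lemma ellf_addition_aux:
  assumes t: "triple a b c"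
    and uv: "u \<notin> lattice \<tau>" "v \<notin> lattice \<tau>" "u + v \<notin> lattice \<tau>"
  shows "ellf \<tau> b (u + v) * ((ellf \<tau> a v)\<^sup>2 - (ellf \<tau> a u)\<^sup>2) =
    ellf \<tau> b u * ellf \<tau> c v * ellf \<tau> a v - ellf \<tau> b v * ellf \<tau> c u * ellf \<tau> a u"
proof -
  have "ellf \<tau> c u * ellf \<tau> b v = ellf \<tau> b (u + v) * ellf \<tau> a u + ellf \<tau> c (u + v) * ellf \<tau> a v"
    "ellf \<tau> c v * ellf \<tau> b u = ellf \<tau> b (v + u) * ellf \<tau> a v + ellf \<tau> c (v + u) * ellf \<tau> a u"
    using ellf_addition_bilinear[OF t] uv by (simp_all add: add.commute)
  then show ?thesis
    unfolding add.commute[of v u] power2_eq_square by algebra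
qed

text \<open>The right-hand side of \<open>ellf_addition_aux\<close> is symmetric in a and c.
  Cancelling \<open>f\<^sub>b(u + v)\<close> shows that
  \<open>f\<^sub>a\<^sup>2 - f\<^sub>c\<^sup>2\<close> has the same value at u and at v.\<close>

lemma ellf_sq_diff_const:
  assumes set: "a \<in> {1..3}" "c \<in> {1..3}" and u: "u \<notin> lattice \<tau>" and v: "v \<notin> lattice \<tau>"
  shows "(ellf \<tau> a u)\<^sup>2 - (ellf \<tau> c u)\<^sup>2 = (ellf \<tau> a v)\<^sup>2 - (ellf \<tau> c v)\<^sup>2"
proof (cases "a = c")
  case False
  then obtain b where t: "triple a b c" using triple_exists_middle[OF set] by blast
  have key: "(ellf \<tau> a u)\<^sup>2 - (ellf \<tau> c u)\<^sup>2 = (ellf \<tau> a w)\<^sup>2 - (ellf \<tau> c w)\<^sup>2"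
    if "u \<notin> lattice \<tau>" "w \<notin> lattice \<tau>" "u + w \<notin> lattice \<tau>" "u + w + omega \<tau> b \<notin> lattice \<tau>" for u w
  proof -
    have "ellf \<tau> b (u + w) \<noteq> 0"
      using ellf_eq_0_iff[OF tripleD(2)[OF t]] that by blast
    moreover have "ellf \<tau> b (u + w) * ((ellf \<tau> a w)\<^sup>2 - (ellf \<tau> a u)\<^sup>2) =
        ellf \<tau> b (u + w) * ((ellf \<tau> c w)\<^sup>2 - (ellf \<tau> c u)\<^sup>2)"
      using ellf_addition_aux[OF t that(1,2,3)] ellf_addition_aux[OF triple_perms(5)[OF t] that(1,2,3)]
      by algebra
    ultimately have "(ellf \<tau> a w)\<^sup>2 - (ellf \<tau> a u)\<^sup>2 = (ellf \<tau> c w)\<^sup>2 - (ellf \<tau> c u)\<^sup>2"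
      using mult_left_cancel by blast
    then show ?thesis by (simp add: algebra_simps)
  qed
  \<comment> \<open>A generic w serves as an intermediate point, since
    \<open>f\<^sub>b(u + v)\<close> may vanish or have a pole.\<close>
  have "eventually (\<lambda>w. 0 + 1 * w \<notin> lattice \<tau> \<and> u + 1 * w \<notin> lattice \<tau> \<and> v + 1 * w \<notin> lattice \<tau> \<and>
      (u + omega \<tau> b) + 1 * w \<notin> lattice \<tau> \<and> (v + omega \<tau> b) + 1 * w \<notin> lattice \<tau>) (at 0)"
    by (intro eventually_conj notin_lattice_nearby) simp_all
  then obtain w where "w \<notin> lattice \<tau>" "u + w \<notin> lattice \<tau>" "v + w \<notin> lattice \<tau>"
      "u + w + omega \<tau> b \<notin> lattice \<tau>" "v + w + omega \<tau> b \<notin> lattice \<tau>"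
    using eventually_happens'[OF at_neq_bot] by (auto simp: add_ac)
  then show ?thesis
    using key[of u w] key[of v w] u v by simp
qed simp

text \<open>The constant is evaluated at \<open>omega \<tau> a\<close>, where
  \<open>f\<^sub>a\<close> vanishes.\<close>

lemma ellf_sq:
  assumes a: "a \<in> {1..3}" and z: "z \<notin> lattice \<tau>"
  shows "(ellf \<tau> a z)\<^sup>2 = ell_p \<tau> z - ell_e \<tau> a"
proof -
  have "ellf \<tau> a (omega \<tau> a) = 0"
    using ellf_eq_0_iff[OF a omega_notin_lattice[OF a]] two_omega_in_lattice[OF a] by (simp only: mult_2)
  then show ?thesis
    using ellf_sq_diff_const[OF a _ z omega_notin_lattice[OF a], of 1]
    by (simp add: ell_p_def ell_e_def algebra_simps)
qed

lemma ell_e_distinct: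
  assumes "a \<in> {1..3}" "b \<in> {1..3}" "a \<noteq> b"
  shows "ell_e \<tau> a \<noteq> ell_e \<tau> b"
proof
  assume "ell_e \<tau> a = ell_e \<tau> b"
  then have "ellf \<tau> a (omega \<tau> b) = 0"
    using ellf_sq[OF assms(1) omega_notin_lattice[OF assms(2)]] by (simp add: ell_e_def)
  then show False
    using ellf_eq_0_iff[OF assms(1) omega_notin_lattice[OF assms(2)]]
      omega_add_notin_lattice[OF assms] by (simp add: add.commute)
qed

lemma ellf_addition:
  assumes t: "triple a b c"
    and uv: "u \<notin> lattice \<tau>" "v \<notin> lattice \<tau>" "u + v \<notin> lattice \<tau>"
  shows "ellf \<tau> a (u + v) * (ell_p \<tau> v - ell_p \<tau> u) =
    ellf \<tau> a u * ellf \<tau> b v * ellf \<tau> c v - ellf \<tau> a v * ellf \<tau> b u * ellf \<tau> c u"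
  using ellf_addition_aux[OF triple_swap[OF triple_rot[OF t]] uv]
    ellf_sq[OF tripleD(2)[OF t] uv(1)] ellf_sq[OF tripleD(2)[OF t] uv(2)]
  by (simp add: mult_ac)

text \<open>Let x, y, z be the values at u and A, B, C those at 2u. For equal arguments the bilinear
  identity reads \<open>yz = (B + C) x\<close>, and likewise for its permutations. Solving for A
  gives \<open>2xyzA = z\<^sup>2x\<^sup>2 + x\<^sup>2y\<^sup>2 - y\<^sup>2z\<^sup>2\<close>.\<close>

lemma ellf_double:
  assumes t: "triple a b c"
    and u: "2 * u \<notin> lattice \<tau>"
  shows "2 * ellf \<tau> a u * ellf \<tau> b u * ellf \<tau> c u * ellf \<tau> a (2 * u) =
    (ell_p \<tau> u - ell_e \<tau> a)\<^sup>2 - (ell_e \<tau> a - ell_e \<tau> b) * (ell_e \<tau> a - ell_e \<tau> c)"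
proof -
  note set = tripleD[OF t]
  have u1: "u \<notin> lattice \<tau>" using u lattice_add[of u \<tau> u] by auto
  note B = ellf_addition_bilinear[OF _ u1 u1, unfolded mult_2[symmetric], OF _ u]
  define x y z where "x = ellf \<tau> a u" and "y = ellf \<tau> b u" and "z = ellf \<tau> c u"
  have sq: "x * x = ell_p \<tau> u - ell_e \<tau> a" "y * y = ell_p \<tau> u - ell_e \<tau> b" "z * z = ell_p \<tau> u - ell_e \<tau> c"
    using ellf_sq[OF set(1) u1] ellf_sq[OF set(2) u1] ellf_sq[OF set(3) u1]
    by (simp_all add: x_def y_def z_def power2_eq_square)
  have 1: "z * y = ellf \<tau> b (2 * u) * x + ellf \<tau> c (2 * u) * x"
    "z * x = ellf \<tau> a (2 * u) * y + ellf \<tau> c (2 * u) * y"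
    "x * y = ellf \<tau> b (2 * u) * z + ellf \<tau> a (2 * u) * z"
    using B[OF t] B[OF triple_perms(5)[OF t]] B[OF triple_perms(4)[OF t]] by (auto simp: x_def y_def z_def)
  have "2 * x * y * z * ellf \<tau> a (2 * u) = (z * z) * (x * x) + (x * x) * (y * y) - (y * y) * (z * z)"
    using 1 by algebra
  also have "\<dots> = (ell_p \<tau> u - ell_e \<tau> a)\<^sup>2 - (ell_e \<tau> a - ell_e \<tau> b) * (ell_e \<tau> a - ell_e \<tau> c)"
    unfolding sq by algebra
  finally show ?thesis by (simp add: x_def y_def z_def)
qed

lemma ellf_at_infinity: "a \<in> {1..3} \<Longrightarrow> filterlim (ellf \<tau> a) at_infinity (at 0)"
proof -
  assume a: "a \<in> {1..3}"
  have "filterlim (\<lambda>z. (z * ellf \<tau> a z) / z) at_infinity (at 0)"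
    by (rule filterlim_divide_at_infinity[OF ellf_pole[OF a]])
      (auto simp: filterlim_at eventually_at_filter)
  then show ?thesis
    by (rule filterlim_cong[THEN iffD1, rotated -1])
      (auto simp: eventually_at_filter)
qed

text \<open>This is the limit of the bilinear identity for v tending to 0. The poles at v = 0 cancel
  because \<open>f\<^sub>b - f\<^sub>a\<close> tends to 0: its product with
  \<open>f\<^sub>b + f\<^sub>a\<close> is constant.\<close>

lemma ellf_has_field_derivative:
  assumes t: "triple a b c"
    and u: "u \<notin> lattice \<tau>"
  shows "(ellf \<tau> c has_field_derivative - (ellf \<tau> a u * ellf \<tau> b u)) (at u)"
proof -
  note set = tripleD[OF t]
  \<comment> \<open>By the bilinear identity this is the difference quotient of
    \<open>f\<^sub>c\<close>, written without \<open>f\<^sub>c(u + v)\<close>.\<close>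
  let ?g = "\<lambda>v. (ellf \<tau> c u * (ellf \<tau> b v - ellf \<tau> a v) - ellf \<tau> b (u + v) * ellf \<tau> a u) / (v * ellf \<tau> a v)"
  have pole: "((\<lambda>z. z * ellf \<tau> a z) \<longlongrightarrow> 1) (at 0)" "((\<lambda>z. z * ellf \<tau> b z) \<longlongrightarrow> 1) (at 0)"
    using ellf_pole set by blast+
  have id0: "((\<lambda>v. v) \<longlongrightarrow> (0::complex)) (at 0)" by (rule tendsto_ident_at)
  define k where "k = ell_e \<tau> a - ell_e \<tau> b"
  have diff: "((\<lambda>v. ellf \<tau> b v - ellf \<tau> a v) \<longlongrightarrow> 0) (at 0)"
  proof -
    have "((\<lambda>v. k * v / (v * ellf \<tau> b v + v * ellf \<tau> a v)) \<longlongrightarrow> k * 0 / (1 + 1)) (at 0)"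
      by (intro tendsto_intros pole id0) simp
    moreover have "eventually (\<lambda>v. v * ellf \<tau> b v + v * ellf \<tau> a v \<noteq> 0) (at 0)"
      using tendsto_imp_eventually_ne[OF tendsto_add[OF pole(2,1)], of 0] by simp
    then have "eventually (\<lambda>v. k * v / (v * ellf \<tau> b v + v * ellf \<tau> a v) = ellf \<tau> b v - ellf \<tau> a v) (at 0)"
      using eventually_notin_lattice
    proof eventually_elim
      case (elim v)
      have "k = (ellf \<tau> b v)\<^sup>2 - (ellf \<tau> a v)\<^sup>2"
        using ellf_sq[OF set(1) elim(2)] ellf_sq[OF set(2) elim(2)] by (simp add: k_def)
      also have "\<dots> = (ellf \<tau> b v - ellf \<tau> a v) * (ellf \<tau> b v + ellf \<tau> a v)" by algebra
      finally have "k * v = (ellf \<tau> b v - ellf \<tau> a v) * (v * ellf \<tau> b v + v * ellf \<tau> a v)" by algebra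
      then show ?case using elim(1) by simp
    qed
    ultimately have "((\<lambda>v. ellf \<tau> b v - ellf \<tau> a v) \<longlongrightarrow> k * 0 / (1 + 1)) (at 0)"
      by (rule Lim_transform_eventually)
    then show ?thesis by simp
  qed
  have "((\<lambda>v. ellf \<tau> b (u + v)) \<longlongrightarrow> ellf \<tau> b u) (at 0)"
    using ellf_isCont[OF set(2) u] by (simp add: isCont_iff)
  then have "(?g \<longlongrightarrow> (ellf \<tau> c u * 0 - ellf \<tau> b u * ellf \<tau> a u) / 1) (at 0)"
    by (intro tendsto_intros diff pole) simp_all
  moreover have "eventually (\<lambda>v. v * ellf \<tau> a v \<noteq> 0) (at 0)"
    using tendsto_imp_eventually_ne[OF pole(1), of 0] by simp
  then have "eventually (\<lambda>v. ?g v = (ellf \<tau> c (u + v) - ellf \<tau> c u) / v) (at 0)"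
    using eventually_notin_lattice add_notin_lattice_nearby[of u]
  proof eventually_elim
    case (elim v)
    have "ellf \<tau> c u * ellf \<tau> b v = ellf \<tau> b (u + v) * ellf \<tau> a u + ellf \<tau> c (u + v) * ellf \<tau> a v"
      by (rule ellf_addition_bilinear[OF t u elim(2,3)])
    then have "ellf \<tau> c u * (ellf \<tau> b v - ellf \<tau> a v) - ellf \<tau> b (u + v) * ellf \<tau> a u =
        (ellf \<tau> c (u + v) - ellf \<tau> c u) * ellf \<tau> a v" by algebra
    then show ?case using elim(1) by simp
  qed
  ultimately have "((\<lambda>v. (ellf \<tau> c (u + v) - ellf \<tau> c u) / v) \<longlongrightarrow> (ellf \<tau> c u * 0 - ellf \<tau> b u * ellf \<tau> a u) / 1) (at 0)"
    by (rule Lim_transform_eventually)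
  then show ?thesis by (simp add: DERIV_def mult.commute)
qed

text \<open>\<open>jtheta \<tau> a\<close> is even, so its derivative at 0 vanishes; that derivative
  is the sum of a contribution of \<open>theta\<close> and one of the exponential factor.\<close>

lemma E1_omega:
  assumes a: "a \<in> {1..3}"
  shows "E1 \<tau> (omega \<tau> a) = - (2 * of_real pi * \<i> * domega a)"
proof -
  let ?d = "2 * of_real pi * \<i> * domega a"
  have D: "(jtheta \<tau> a has_field_derivative ?d * theta \<tau> (omega \<tau> a) + deriv (theta \<tau>) (omega \<tau> a)) (at 0)"
    using jtheta_has_field_derivative[of a 0] by (simp add: jtheta_def)
  then have "((\<lambda>z. jtheta \<tau> a (- z)) has_field_derivative - (?d * theta \<tau> (omega \<tau> a) + deriv (theta \<tau>) (omega \<tau> a))) (at 0)"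
    using DERIV_chain2[of "jtheta \<tau> a" "?d * theta \<tau> (omega \<tau> a) + deriv (theta \<tau>) (omega \<tau> a)" uminus 0 "- 1" UNIV]
      DERIV_minus[OF DERIV_ident, of 0 UNIV] by simp
  then have "(jtheta \<tau> a has_field_derivative - (?d * theta \<tau> (omega \<tau> a) + deriv (theta \<tau>) (omega \<tau> a))) (at 0)"
    by (simp add: jtheta_minus[OF a])
  from DERIV_unique[OF D this]
  have "2 * (?d * theta \<tau> (omega \<tau> a) + deriv (theta \<tau>) (omega \<tau> a)) = 0"
    by (simp only: eq_neg_iff_add_eq_0 mult_2)
  then have "?d * theta \<tau> (omega \<tau> a) + deriv (theta \<tau>) (omega \<tau> a) = 0"
    by (simp only: mult_eq_0_iff) simp
  moreover have "theta \<tau> (omega \<tau> a) \<noteq> 0"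
    using omega_notin_lattice[OF a] by (simp add: theta_eq_0_iff)
  ultimately show ?thesis
    unfolding E1_def by (simp add: field_simps eq_neg_iff_add_eq_0)
qed

text \<open>K is the logarithmic derivative of \<open>f\<^sub>c\<close> at h: the exponential factor
  contributes \<open>2 * of_real pi * \<i> * domega c\<close>, which is
  \<open>- E1 \<tau> (omega \<tau> c)\<close> by \<open>E1_omega\<close>. The derivative of
  \<open>f\<^sub>c\<close> is known from \<open>ellf_has_field_derivative\<close>.\<close>

lemma K_eq:
  assumes t: "triple a b c"
    and h: "2 * h \<notin> lattice \<tau>"
  shows "K \<tau> h c = - (ellf \<tau> a h * ellf \<tau> b h) / ellf \<tau> c h"
proof -
  note set = tripleD[OF t]
  have h1: "h \<notin> lattice \<tau>" using h lattice_add[of h \<tau> h] by auto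
  have nz: "ellf \<tau> c h \<noteq> 0" using ellf_nonzero[OF set(3) h] .
  define D j t t' where "D = deriv (theta \<tau>) 0" and "j = jtheta \<tau> c h" and "t = theta \<tau> h" and "t' = theta \<tau> (h + omega \<tau> c)"
  have tnz: "t \<noteq> 0" using h1 by (simp add: t_def theta_eq_0_iff)
  have j: "j = xexp (h * domega c) * t'" by (simp add: j_def t'_def jtheta_def)
  have t'nz: "t' \<noteq> 0" and Dnz: "D \<noteq> 0" and j0: "jtheta \<tau> c 0 \<noteq> 0"
    using nz by (auto simp: ellf_def j_def[symmetric] j D_def)
  note hol = entire_has_deriv[OF theta_holomorphic]
  have dj: "(jtheta \<tau> c has_field_derivative
     2 * of_real pi * \<i> * domega c * j + xexp (h * domega c) * deriv (theta \<tau>) (h + omega \<tau> c)) (at h)"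
    unfolding j_def by (rule jtheta_has_field_derivative)
  have "(ellf \<tau> c has_field_derivative (ellf \<tau> c h * (2 * of_real pi * \<i> * domega c +
      deriv (theta \<tau>) (h + omega \<tau> c) / t' - deriv (theta \<tau>) h / t))) (at h)"
  proof -
    let ?j' = "2 * of_real pi * \<i> * domega c * j + xexp (h * domega c) * deriv (theta \<tau>) (h + omega \<tau> c)"
    have nz0: "jtheta \<tau> c 0 * theta \<tau> h \<noteq> 0" using tnz j0 by (simp add: t_def)
    have "ellf \<tau> c h * (2 * of_real pi * \<i> * domega c + deriv (theta \<tau>) (h + omega \<tau> c) / t' - deriv (theta \<tau>) h / t) =
      (D * ?j' * (jtheta \<tau> c 0 * theta \<tau> h) - D * jtheta \<tau> c h * (jtheta \<tau> c 0 * deriv (theta \<tau>) h)) /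
        ((jtheta \<tau> c 0 * theta \<tau> h) * (jtheta \<tau> c 0 * theta \<tau> h))"
      unfolding ellf_def j_def[symmetric] t_def[symmetric] D_def[symmetric] unfolding j
      using tnz j0 t'nz by (simp add: field_simps)
    then show ?thesis
      unfolding ellf_def[abs_def] D_def[symmetric]
      using DERIV_divide[OF DERIV_cmult[OF dj, of D] DERIV_cmult[OF hol, of "jtheta \<tau> c 0"] nz0] by simp
  qed
  from DERIV_unique[OF this ellf_has_field_derivative[OF t h1]]
  have "ellf \<tau> c h * K \<tau> h c = - (ellf \<tau> a h * ellf \<tau> b h)"
    unfolding K_def E1_omega[OF set(3)] by (simp add: E1_def t_def t'_def algebra_simps)
  then show ?thesis using nz by (simp add: field_simps)
qed

section \<open>The functions \<open>varphi\<close> in terms of the functions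
  \<open>f\<^sub>a\<close>\<close>

lemma varphi_isCont:
  assumes "z \<notin> lattice \<tau>"
  shows "isCont (varphi \<tau> \<eta> a) z"
proof -
  have "isCont (\<lambda>z. jtheta \<tau> a (z + \<eta>)) z"
    by (rule entire_isCont[OF entire_compose[OF jtheta_holomorphic]]) (intro holomorphic_intros)
  moreover have "isCont (theta \<tau>) z" by (rule entire_isCont[OF theta_holomorphic])
  moreover have "theta \<tau> z \<noteq> 0" using assms by (simp add: theta_eq_0_iff)
  ultimately show ?thesis
    unfolding varphi_eq[abs_def] divide_inverse inverse_mult_distrib by (intro continuous_intros) auto
qed

lemma varphi_0_nonzero:
  assumes "\<eta> \<notin> lattice \<tau>" "z \<notin> lattice \<tau>" "z + \<eta> \<notin> lattice \<tau>"
  shows "varphi \<tau> \<eta> 0 z \<noteq> 0"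
  using assms theta_deriv_0_nonzero by (simp add: varphi_eq jtheta_Zero theta_eq_0_iff)

lemma varphi_eq_ellf:
  assumes "a \<in> {1..3}" "\<eta> \<notin> lattice \<tau>" "z + \<eta> \<notin> lattice \<tau>"
  shows "varphi \<tau> \<eta> a z = varphi \<tau> \<eta> 0 z * (ellf \<tau> a (z + \<eta>) / ellf \<tau> a \<eta>)"
  using assms theta_deriv_0_nonzero jtheta_0_nonzero[OF assms(1)]
  by (simp add: varphi_eq jtheta_Zero ellf_def theta_eq_0_iff field_simps)

lemma theta_minus_omega:
  assumes "a \<in> {1..3}"
  shows "theta \<tau> (z - omega \<tau> a) = - (xexp (z * domega a))\<^sup>2 * theta \<tau> (z + omega \<tau> a)"
proof -
  have "xexp (z * domega a) * jtheta \<tau> a (- z) = theta \<tau> (omega \<tau> a - z)"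
    using xexp_minus[of "z * domega a"] by (simp add: jtheta_def)
  then have "theta \<tau> (omega \<tau> a - z) = (xexp (z * domega a))\<^sup>2 * theta \<tau> (z + omega \<tau> a)"
    unfolding jtheta_minus[OF assms] by (simp add: jtheta_def power2_eq_square mult.assoc)
  then show ?thesis
    using theta_minus[of "z - omega \<tau> a"] by simp
qed

lemma rho_nonzero:
  assumes "a \<in> {1..3}" "2 * h \<notin> lattice \<tau>"
  shows "rho \<tau> h a \<noteq> 0"
proof -
  have h: "h \<notin> lattice \<tau>" using assms(2) lattice_add[of h \<tau> h] by auto
  have "ellf \<tau> a h \<noteq> 0" by (rule ellf_nonzero[OF assms])
  then have "omega \<tau> a + h \<notin> lattice \<tau>" using ellf_eq_0_iff[OF assms(1) h] by (simp add: add.commute)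
  then show ?thesis
    using h omega_notin_lattice[OF assms(1)] theta_deriv_0_nonzero
    by (simp add: rho_def phi_def theta_eq_0_iff)
qed

text \<open>In \<open>phi\<close> the shift by \<open>- omega \<tau> a\<close> cancels
  \<open>omega \<tau> a\<close> in the numerator and enters a factor of the denominator, which by
  \<open>theta_minus_omega\<close> is, up to exponentials, the numerator of
  \<open>f\<^sub>a(z)\<close>. The remaining constants form \<open>rho\<close>.\<close>

lemma varphi_shift_eq_ellf:
  assumes a: "a \<in> {1..3}" and h: "2 * h \<notin> lattice \<tau>" and z: "2 * z \<notin> lattice \<tau>"
  shows "varphi \<tau> h a (z - omega \<tau> a) = varphi \<tau> h 0 z * (rho \<tau> h a / ellf \<tau> a z)"
proof -
  have h1: "h \<notin> lattice \<tau>" and z1: "z \<notin> lattice \<tau>"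
    using h z lattice_add[of h \<tau> h] lattice_add[of z \<tau> z] by auto
  have wz: "z + omega \<tau> a \<notin> lattice \<tau>" "h + omega \<tau> a \<notin> lattice \<tau>"
    using ellf_nonzero[OF a z] ellf_nonzero[OF a h] ellf_eq_0_iff[OF a h1] ellf_eq_0_iff[OF a z1] by auto
  have wz': "z - omega \<tau> a \<notin> lattice \<tau>"
    using wz(1) lattice_add[OF _ two_omega_in_lattice[OF a], of "z - omega \<tau> a"] by (auto simp: algebra_simps)
  define D x w where "D = deriv (theta \<tau>) 0" and "x = xexp (z * domega a)" and "w = xexp (- omega \<tau> a * domega a)"
  have nz: "theta \<tau> h \<noteq> 0" "theta \<tau> z \<noteq> 0" "theta \<tau> (z + omega \<tau> a) \<noteq> 0" "theta \<tau> (h + omega \<tau> a) \<noteq> 0"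
    "theta \<tau> (z - omega \<tau> a) \<noteq> 0" "theta \<tau> (omega \<tau> a) \<noteq> 0" "D \<noteq> 0" "x \<noteq> 0" "w \<noteq> 0"
    using h1 z1 wz wz' omega_notin_lattice[OF a] theta_deriv_0_nonzero
    by (simp_all add: theta_eq_0_iff D_def x_def w_def)
  have T: "theta \<tau> (z - omega \<tau> a) = - x\<^sup>2 * theta \<tau> (z + omega \<tau> a)"
    unfolding x_def by (rule theta_minus_omega[OF a])
  have e1: "exp (2 * of_real pi * \<i> * (z - omega \<tau> a) * domega a) = x * w"
    unfolding x_def w_def xexp_add[symmetric] by (simp add: xexp_def algebra_simps)
  have e2: "exp (- 2 * of_real pi * \<i> * omega \<tau> a * domega a) = w"
    unfolding w_def by (simp add: xexp_def algebra_simps)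
  have 1: "varphi \<tau> h a (z - omega \<tau> a) = x * w * (theta \<tau> (z + h) * D / (theta \<tau> (h + omega \<tau> a) * theta \<tau> (z - omega \<tau> a)))"
    unfolding varphi_def e1 phi_def D_def by (simp add: algebra_simps)
  have 2: "varphi \<tau> h 0 z = theta \<tau> (z + h) * D / (theta \<tau> h * theta \<tau> z)"
    by (simp add: varphi_eq jtheta_Zero D_def)
  have 3: "rho \<tau> h a = - w * (theta \<tau> h * D / (theta \<tau> (h + omega \<tau> a) * theta \<tau> (omega \<tau> a)))"
    unfolding rho_def e2 phi_def D_def by (simp add: theta_minus add.commute)
  have 4: "ellf \<tau> a z = D * (x * theta \<tau> (z + omega \<tau> a)) / (theta \<tau> (omega \<tau> a) * theta \<tau> z)"
    by (simp add: ellf_def jtheta_def D_def x_def)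
  show ?thesis
    unfolding 1 2 3 4 T using nz by (simp add: field_simps power2_eq_square)
qed

end

section \<open>Coefficients of the reflection equation\<close>

definition ell_F :: "complex \<Rightarrow> complex \<Rightarrow> complex" where
  "ell_F \<tau> z = ellf \<tau> 1 z * ellf \<tau> 2 z * ellf \<tau> 3 z"

text \<open>
  The function \<open>G\<close> is determined, independently of \<open>a\<close>, by
  \<open>f\<^sub>a(z) f\<^sub>a(z + 2\<eta>) = f\<^sub>a(2\<eta>) (G(z) + K\<^sub>a)\<close>, see \<open>ell_G_property\<close>.
\<close>

definition ell_G :: "complex \<Rightarrow> complex \<Rightarrow> complex \<Rightarrow> complex" where
  "ell_G \<tau> \<eta> z = 2 * ell_F \<tau> \<eta> / (ell_p \<tau> \<eta> - ell_p \<tau> (z + \<eta>))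
     - ((ell_p \<tau> \<eta> - ell_e \<tau> 1) * (ell_p \<tau> \<eta> - ell_e \<tau> 2) + (ell_p \<tau> \<eta> - ell_e \<tau> 1) * (ell_p \<tau> \<eta> - ell_e \<tau> 3)
        + (ell_p \<tau> \<eta> - ell_e \<tau> 2) * (ell_p \<tau> \<eta> - ell_e \<tau> 3)) / (2 * ell_F \<tau> \<eta>)"

text \<open>By \<open>varphi_eq_ellf\<close> this is \<open>varphi\<close> with index a divided by
  \<open>varphi\<close> with index 0, both at z + w: for \<eta> = h/2, a coefficient of
  \<open>R\<^sup>+\<close> divided by that of
  \<open>\<sigma>\<^sub>0 \<otimes> \<sigma>\<^sub>0\<close>. In the same way \<open>coeff_m\<close>
  belongs to \<open>R\<^sup>-\<close>.\<close>

definition coeff_p :: "complex \<Rightarrow> complex \<Rightarrow> complex \<Rightarrow> complex \<Rightarrow> nat \<Rightarrow> complex" where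
  "coeff_p \<tau> \<eta> z w a = ellf \<tau> a (z + w + \<eta>) / ellf \<tau> a \<eta>"

definition coeff_m :: "complex \<Rightarrow> complex \<Rightarrow> complex \<Rightarrow> complex \<Rightarrow> nat \<Rightarrow> complex" where
  "coeff_m \<tau> \<eta> z w a = ellf \<tau> a (z - w + \<eta>) / ellf \<tau> a \<eta>"

definition coeff_M :: "complex \<Rightarrow> complex \<Rightarrow> complex \<Rightarrow> complex \<Rightarrow> complex" where
  "coeff_M \<tau> \<eta> z w = 2 * (ell_p \<tau> \<eta> - ell_p \<tau> (z + \<eta>)) / ((ell_p \<tau> w - ell_p \<tau> (z + \<eta>)) * ell_F \<tau> \<eta>)"

text \<open>Admissible points at which also all divisors are nonzero: \<open>varphi\<close> with
  index 0, and the differences of values of \<open>ell_p\<close> in \<open>ell_G\<close>,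
  \<open>coeff_M\<close> and the addition formulas. The conditions on \<open>w + 2 * \<eta>\<close>
  and \<open>w - 2 * \<eta>\<close> separate \<open>ell_p \<tau> w\<close> from
  \<open>ell_p \<tau> (2 * \<eta>)\<close>.\<close>

definition generic :: "complex \<Rightarrow> complex \<Rightarrow> complex \<Rightarrow> complex \<Rightarrow> bool" where
  "generic \<tau> \<eta> z w \<longleftrightarrow> 2 * z \<notin> lattice \<tau> \<and> 2 * w \<notin> lattice \<tau> \<and> z + \<eta> \<notin> lattice \<tau> \<and> w + \<eta> \<notin> lattice \<tau> \<and>
    z + 2 * \<eta> \<notin> lattice \<tau> \<and> w + 2 * \<eta> \<notin> lattice \<tau> \<and> z + \<eta> + w \<notin> lattice \<tau> \<and> z + \<eta> - w \<notin> lattice \<tau> \<and>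
    z - w \<notin> lattice \<tau> \<and> z + w \<notin> lattice \<tau> \<and> w - 2 * \<eta> \<notin> lattice \<tau>"

lemma ell_F_eq:
  assumes "triple a b c"
  shows "ell_F \<tau> z = ellf \<tau> a z * ellf \<tau> b z * ellf \<tau> c z"
  using assms[unfolded triple_cases] unfolding ell_F_def by (auto simp: mult_ac)

lemma ell_G_eq:
  assumes "triple a b c"
  shows "ell_G \<tau> \<eta> z = 2 * ell_F \<tau> \<eta> / (ell_p \<tau> \<eta> - ell_p \<tau> (z + \<eta>))
     - ((ell_p \<tau> \<eta> - ell_e \<tau> a) * (ell_p \<tau> \<eta> - ell_e \<tau> b) + (ell_p \<tau> \<eta> - ell_e \<tau> a) * (ell_p \<tau> \<eta> - ell_e \<tau> c)
        + (ell_p \<tau> \<eta> - ell_e \<tau> b) * (ell_p \<tau> \<eta> - ell_e \<tau> c)) / (2 * ell_F \<tau> \<eta>)"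
  using assms[unfolded triple_cases] unfolding ell_G_def by (auto simp: add_ac mult_ac)

text \<open>The letters x, y, b stand for the values of the three functions at p = z + \<eta>, w and
  \<eta>, further \<open>d\<close> for \<wp>(w) - \<wp>(p), \<delta> for \<wp>(\<eta>) - \<wp>(p),
  and \<open>k\<close> for \<open>e\<^sub>3 - e\<^sub>2\<close>. The identities hold for independent
  variables, so clearing denominators suffices.\<close>

lemma off_diagonal_coefficient_identities:
  fixes d \<delta> b1 b2 b3 x1 x2 x3 y1 y2 y3 k :: complex
  assumes "d \<noteq> 0" "\<delta> \<noteq> 0" "b1 \<noteq> 0" "b2 \<noteq> 0" "b3 \<noteq> 0"
  shows "(x1 * y2 * y3 - y1 * x2 * x3) / (d * b1) + (x1 * y2 * y3 + y1 * x2 * x3) / (d * b1) +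
      ((x3 * x2 * y3 * y2 + - k * x1 * y1) / (d * b2 * b3) + (x2 * x3 * y2 * y3 + k * x1 * y1) / (d * b2 * b3)) =
      2 * \<delta> / (d * (b1 * b2 * b3)) * ((x1 * b2 * b3 + b1 * x2 * x3) / \<delta> * y2 * y3)"
    and "(x1 * y2 * y3 - y1 * x2 * x3) / (d * b1) + (x1 * y2 * y3 + y1 * x2 * x3) / (d * b1) -
      ((x3 * x2 * y3 * y2 + - k * x1 * y1) / (d * b2 * b3) + (x2 * x3 * y2 * y3 + k * x1 * y1) / (d * b2 * b3)) =
      2 * \<delta> / (d * (b1 * b2 * b3)) * ((x1 * b2 * b3 - b1 * x2 * x3) / \<delta> * y2 * y3)"
    and "(x1 * y2 * y3 - y1 * x2 * x3) / (d * b1) - (x1 * y2 * y3 + y1 * x2 * x3) / (d * b1) +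
      ((x3 * x2 * y3 * y2 + - k * x1 * y1) / (d * b2 * b3) - (x2 * x3 * y2 * y3 + k * x1 * y1) / (d * b2 * b3)) =
      - (2 * \<delta> / (d * (b1 * b2 * b3))) * (y1 * ((x2 * x3 * b2 * b3 + k * x1 * b1) / \<delta>))"
  using assms by (simp_all add: field_simps)

text \<open>Here \<open>P\<^sub>i\<close> is \<open>\<wp>(\<eta>) - e\<^sub>i\<close>, \<delta> is
  \<wp>(\<eta>) - \<wp>(z + \<eta>), \<epsilon> is \<wp>(w) - \<wp>(\<eta>), \<open>q\<close> is the
  square of \<open>ell_F \<tau> \<eta>\<close>, and \<open>R\<^sub>i\<close> is
  \<open>2 * ell_F \<tau> \<eta> * ellf \<tau> i (2 * \<eta>)\<close> by the duplication
  formula.\<close>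

lemma diagonal_coefficient_identity_1:
  fixes P1 P2 P3 \<delta> \<epsilon> :: complex
  assumes nz: "P1 \<noteq> 0" "P2 \<noteq> 0" "P3 \<noteq> 0"
    and q: "q = P1 * P2 * P3"
    and R: "R1 = P1\<^sup>2 - (P2 - P1) * (P3 - P1)" "R2 = P2\<^sup>2 - (P3 - P2) * (P1 - P2)" "R3 = P3\<^sup>2 - (P1 - P3) * (P2 - P3)"
  shows "(\<delta> + \<epsilon>) + ((P1 - \<delta>) * (P1 + \<epsilon>) - (P2 - P1) * (P3 - P1)) / P1
     + ((P2 - \<delta>) * (P2 + \<epsilon>) - (P3 - P2) * (P1 - P2)) / P2
     + ((P3 - \<delta>) * (P3 + \<epsilon>) - (P1 - P3) * (P2 - P3)) / P3
    = \<delta> * R1 * R2 * R3 / (4 * q\<^sup>2) + (4 - \<delta> * (P1 * P2 + P1 * P3 + P2 * P3) / q) * (\<epsilon> + P1 - R1\<^sup>2 / (4 * q))"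
proof -
  have q0: "q \<noteq> 0" using nz q by simp
  \<comment> \<open>Both sides are brought to the denominator \<open>4 * q\<^sup>2\<close> with
    variables in place of the large numerators; what remains is a polynomial identity.\<close>
  have 1: "(\<delta> + \<epsilon>) + A / P1 + B / P2 + C / P3 = (4 * q\<^sup>2 * (\<delta> + \<epsilon>) + 4 * q * (A * P2 * P3 + B * P1 * P3 + C * P1 * P2)) / (4 * q\<^sup>2)"
    for A B C using nz unfolding q by (simp add: field_simps power2_eq_square)
  have 2: "\<delta> * R1 * R2 * R3 / (4 * q\<^sup>2) + (4 - \<delta> * S / q) * (\<epsilon> + P1 - R1\<^sup>2 / (4 * q)) =
     (\<delta> * R1 * R2 * R3 + (4 * q - \<delta> * S) * (4 * q * (\<epsilon> + P1) - R1\<^sup>2)) / (4 * q\<^sup>2)" for S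
    using q0 by (simp add: field_simps power2_eq_square)
  show ?thesis unfolding 1 2 unfolding R q
    by (rule arg_cong[where f = "\<lambda>x. x / _"]) algebra
qed

lemma diagonal_coefficient_identity_2:
  fixes P1 P2 P3 \<delta> \<epsilon> :: complex
  assumes nz: "P1 \<noteq> 0" "P2 \<noteq> 0" "P3 \<noteq> 0" "R1 \<noteq> 0" "\<delta> \<noteq> 0"
    and q: "q = P1 * P2 * P3"
    and R: "R1 = P1\<^sup>2 - (P2 - P1) * (P3 - P1)" "R2 = P2\<^sup>2 - (P3 - P2) * (P1 - P2)" "R3 = P3\<^sup>2 - (P1 - P3) * (P2 - P3)"
  shows "(\<delta> + \<epsilon>) + ((P1 - \<delta>) * (P1 + \<epsilon>) - (P2 - P1) * (P3 - P1)) / P1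
     - ((P2 - \<delta>) * (P2 + \<epsilon>) - (P3 - P2) * (P1 - P2)) / P2
     - ((P3 - \<delta>) * (P3 + \<epsilon>) - (P1 - P3) * (P2 - P3)) / P3
    = \<delta> * R1 / q * (\<epsilon> + P2 + P3 + R1\<^sup>2 / (4 * q) - P1 - R2 * R3 / R1 * (1 / \<delta> - (P1 * P2 + P1 * P3 + P2 * P3) / (4 * q)))"
proof -
  have q0: "q \<noteq> 0" using nz q by simp
  have 1: "(\<delta> + \<epsilon>) + A / P1 - B / P2 - C / P3 = (4 * q\<^sup>2 * (\<delta> + \<epsilon>) + 4 * q * (A * P2 * P3 - B * P1 * P3 - C * P1 * P2)) / (4 * q\<^sup>2)"
    for A B C using nz unfolding q by (simp add: field_simps power2_eq_square)
  have 2: "\<delta> * R1 / q * (\<epsilon> + P2 + P3 + R1\<^sup>2 / (4 * q) - P1 - R2 * R3 / R1 * (1 / \<delta> - S / (4 * q))) =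
     (\<delta> * R1 * (4 * q * (\<epsilon> + P2 + P3 - P1) + R1\<^sup>2) - R2 * R3 * (4 * q - \<delta> * S)) / (4 * q\<^sup>2)" for S
    using q0 nz by (simp add: field_simps power2_eq_square)
  show ?thesis unfolding 1 2 unfolding R q
    by (rule arg_cong[where f = "\<lambda>x. x / _"]) algebra
qed

section \<open>Products of values at sums and differences\<close>

context upper_half_plane
begin

text \<open>If the values agree, the addition formulas for u + v and u - v say that the difference
  and the sum of the same two products vanish. Hence \<open>f\<^sub>a(u) = 0\<close> for every a,
  which contradicts \<open>ell_e_distinct\<close>.\<close>

lemma ell_p_neq:
  assumes "u \<notin> lattice \<tau>" "2 * v \<notin> lattice \<tau>" "u + v \<notin> lattice \<tau>" "u - v \<notin> lattice \<tau>"
  shows "ell_p \<tau> u \<noteq> ell_p \<tau> v"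
proof
  assume eq: "ell_p \<tau> u = ell_p \<tau> v"
  have v: "v \<notin> lattice \<tau>" using assms(2) lattice_add[of v \<tau> v] by auto
  have z: "ellf \<tau> a u = 0"
    if t: "triple a b c" for a b c
  proof -
    note set = tripleD[OF t]
    have "ellf \<tau> a u * ellf \<tau> b v * ellf \<tau> c v - ellf \<tau> a v * ellf \<tau> b u * ellf \<tau> c u = 0"
      using ellf_addition[OF t assms(1) v assms(3)] eq by simp
    moreover have "ellf \<tau> a u * ellf \<tau> b v * ellf \<tau> c v + ellf \<tau> a v * ellf \<tau> b u * ellf \<tau> c u = 0"
      using ellf_addition[OF t assms(1), of "- v"] assms(4) v eq
        ellf_minus[OF set(1)] ellf_minus[OF set(2)] ellf_minus[OF set(3)] ellf_minus[of 1]
      by (simp add: ell_p_def)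
    ultimately have "2 * (ellf \<tau> a u * (ellf \<tau> b v * ellf \<tau> c v)) = 0" by algebra
    then show ?thesis
      using ellf_nonzero[OF set(2) assms(2)] ellf_nonzero[OF set(3) assms(2)] by simp
  qed
  have "ellf \<tau> 1 u = 0" "ellf \<tau> 2 u = 0" using z[OF triple_123(1)] z[OF triple_123(2)] by simp_all
  then have "ell_e \<tau> 1 = ell_e \<tau> 2"
    using ellf_sq[OF _ assms(1), of 1] ellf_sq[OF _ assms(1), of 2] by simp
  then show False using ell_e_distinct[of 1 2] by simp
qed

lemma ell_p_minus: "ell_p \<tau> (- v) = ell_p \<tau> v"
  by (simp add: ell_p_def ellf_minus)

lemma ellf_subtraction:
  assumes t: "triple a b c"
    and uv: "u \<notin> lattice \<tau>" "v \<notin> lattice \<tau>" "u - v \<notin> lattice \<tau>"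
  shows "ellf \<tau> a (u - v) * (ell_p \<tau> v - ell_p \<tau> u) =
    ellf \<tau> a u * ellf \<tau> b v * ellf \<tau> c v + ellf \<tau> a v * ellf \<tau> b u * ellf \<tau> c u"
  using ellf_addition[OF t uv(1), of "- v"] uv ellf_minus[OF tripleD(1)[OF t]] ellf_minus[OF tripleD(2)[OF t]] ellf_minus[OF tripleD(3)[OF t]]
  by (simp add: ell_p_minus)

text \<open>The addition formulas for u + v and u - v are multiplied. Once squares are expressed by
  \<wp>, a factor \<wp>(v) - \<wp>(u) splits off, and \<open>ell_p_neq\<close> allows it to be
  cancelled.\<close>

lemma ellf_product:
  assumes t: "triple a b c"
    and uv: "u \<notin> lattice \<tau>" "2 * v \<notin> lattice \<tau>" "u + v \<notin> lattice \<tau>" "u - v \<notin> lattice \<tau>"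
  shows "ellf \<tau> b (u + v) * ellf \<tau> c (u - v) * (ell_p \<tau> v - ell_p \<tau> u) =
      ellf \<tau> b u * ellf \<tau> c u * ellf \<tau> b v * ellf \<tau> c v + (ell_e \<tau> c - ell_e \<tau> b) * ellf \<tau> a u * ellf \<tau> a v" (is ?A)
    and "ellf \<tau> a (u + v) * ellf \<tau> a (u - v) * (ell_p \<tau> v - ell_p \<tau> u) =
      (ell_p \<tau> u - ell_e \<tau> a) * (ell_p \<tau> v - ell_e \<tau> a) - (ell_e \<tau> a - ell_e \<tau> b) * (ell_e \<tau> a - ell_e \<tau> c)" (is ?B)
proof -
  note set = tripleD[OF t]
  have v: "v \<notin> lattice \<tau>" using uv(2) lattice_add[of v \<tau> v] by auto
  have D: "ell_p \<tau> v - ell_p \<tau> u \<noteq> 0" using ell_p_neq[OF uv] by simp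
  define D' where "D' = ell_p \<tau> v - ell_p \<tau> u"
  define u1 u2 u3 where "u1 = ellf \<tau> a u" and "u2 = ellf \<tau> b u" and "u3 = ellf \<tau> c u"
  define v1 v2 v3 where "v1 = ellf \<tau> a v" and "v2 = ellf \<tau> b v" and "v3 = ellf \<tau> c v"
  define U V e1 e2 e3 where "U = ell_p \<tau> u" and "V = ell_p \<tau> v" and "e1 = ell_e \<tau> a" and "e2 = ell_e \<tau> b" and "e3 = ell_e \<tau> c"
  note defs = u1_def u2_def u3_def v1_def v2_def v3_def U_def V_def e1_def e2_def e3_def D'_def
  have sq: "u1 * u1 = U - e1" "u2 * u2 = U - e2" "u3 * u3 = U - e3" "v1 * v1 = V - e1" "v2 * v2 = V - e2" "v3 * v3 = V - e3"
    using ellf_sq[OF set(1) uv(1)] ellf_sq[OF set(2) uv(1)] ellf_sq[OF set(3) uv(1)]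
      ellf_sq[OF set(1) v] ellf_sq[OF set(2) v] ellf_sq[OF set(3) v]
    by (simp_all add: defs power2_eq_square)
  have p: "ellf \<tau> b (u + v) * D' = u2 * v3 * v1 - v2 * u3 * u1" "ellf \<tau> a (u + v) * D' = u1 * v2 * v3 - v1 * u2 * u3"
    using ellf_addition[OF triple_rot[OF t] uv(1) v uv(3)]
      ellf_addition[OF t uv(1) v uv(3)] by (simp_all add: defs)
  have m: "ellf \<tau> c (u - v) * D' = u3 * v1 * v2 + v3 * u1 * u2" "ellf \<tau> a (u - v) * D' = u1 * v2 * v3 + v1 * u2 * u3"
    using ellf_subtraction[OF triple_rot[OF triple_rot[OF t]] uv(1) v uv(4)]
      ellf_subtraction[OF t uv(1) v uv(4)] by (simp_all add: defs)
  have "D' * (ellf \<tau> b (u + v) * ellf \<tau> c (u - v) * D') = (ellf \<tau> b (u + v) * D') * (ellf \<tau> c (u - v) * D')" by simp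
  also have "\<dots> = u2 * u3 * v2 * v3 * (v1 * v1 - u1 * u1) + u1 * v1 * ((u2 * u2) * (v3 * v3) - (v2 * v2) * (u3 * u3))"
    unfolding p m by algebra
  also have "\<dots> = D' * (u2 * u3 * v2 * v3 + (e3 - e2) * u1 * v1)"
    unfolding sq D'_def U_def[symmetric] V_def[symmetric] by algebra
  finally have "ellf \<tau> b (u + v) * ellf \<tau> c (u - v) * D' = u2 * u3 * v2 * v3 + (e3 - e2) * u1 * v1"
    using D mult_left_cancel unfolding D'_def by blast
  then show ?A by (simp only: defs)
  have "D' * (ellf \<tau> a (u + v) * ellf \<tau> a (u - v) * D') = (ellf \<tau> a (u + v) * D') * (ellf \<tau> a (u - v) * D')" by simp
  also have "\<dots> = (u1 * u1) * (v2 * v2) * (v3 * v3) - (v1 * v1) * (u2 * u2) * (u3 * u3)"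
    unfolding p m by algebra
  also have "\<dots> = D' * ((U - e1) * (V - e1) - (e1 - e2) * (e1 - e3))"
    unfolding sq D'_def U_def[symmetric] V_def[symmetric] by algebra
  finally have "ellf \<tau> a (u + v) * ellf \<tau> a (u - v) * D' = (U - e1) * (V - e1) - (e1 - e2) * (e1 - e3)"
    using D mult_left_cancel unfolding D'_def by blast
  then show ?B by (simp only: defs)
qed

end

text \<open>\<eta> stands for h/2, so the hypothesis on 2h becomes one on 4\<eta>. It makes all
  three \<open>f\<^sub>a\<close> finite and nonzero at \<eta> and at 2\<eta>.\<close>

locale spectral_parameter = upper_half_plane +
  fixes \<eta> :: complex
  assumes \<eta>: "4 * \<eta> \<notin> lattice \<tau>"
begin

lemma eta_notin: "\<eta> \<notin> lattice \<tau>" "2 * \<eta> \<notin> lattice \<tau>"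
proof -
  show "2 * \<eta> \<notin> lattice \<tau>" using \<eta> lattice_add[of "2 * \<eta>" \<tau> "2 * \<eta>"] by auto
  then show "\<eta> \<notin> lattice \<tau>" using lattice_add[of "\<eta>" \<tau> "\<eta>"] by auto
qed

lemma ellf_eta_nonzero: "a \<in> {1..3} \<Longrightarrow> ellf \<tau> a \<eta> \<noteq> 0" "a \<in> {1..3} \<Longrightarrow> ellf \<tau> a (2 * \<eta>) \<noteq> 0"
  using ellf_nonzero \<eta> eta_notin by auto

lemma ellf_double_eta:
  assumes t: "triple a b c"
  shows "ellf \<tau> a (2 * \<eta>) = ((ell_p \<tau> \<eta> - ell_e \<tau> a)\<^sup>2 - (ell_e \<tau> a - ell_e \<tau> b) * (ell_e \<tau> a - ell_e \<tau> c)) / (2 * ell_F \<tau> \<eta>)"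
  using ellf_double[OF t eta_notin(2)] ellf_eta_nonzero(1)[OF tripleD(1)[OF t]] ellf_eta_nonzero(1)[OF tripleD(2)[OF t]] ellf_eta_nonzero(1)[OF tripleD(3)[OF t]]
  unfolding ell_F_eq[OF t] by (simp add: field_simps)

lemma ell_F_sq:
  assumes t: "triple a b c"
    and z: "z \<notin> lattice \<tau>"
  shows "ell_F \<tau> z * ell_F \<tau> z = (ell_p \<tau> z - ell_e \<tau> a) * (ell_p \<tau> z - ell_e \<tau> b) * (ell_p \<tau> z - ell_e \<tau> c)"
  unfolding ell_F_eq[OF t] ellf_sq[OF tripleD(1)[OF t] z, symmetric] ellf_sq[OF tripleD(2)[OF t] z, symmetric] ellf_sq[OF tripleD(3)[OF t] z, symmetric]
  by (simp add: power2_eq_square)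

text \<open>The points z and z + 2\<eta> are z + \<eta> shifted by -\<eta> and \<eta>, so
  \<open>ellf_product\<close> expresses the left-hand side by \<wp>(z + \<eta>). After division by
  \<open>f\<^sub>a(2\<eta>)\<close> its polar part
  \<open>2F(\<eta>)/(\<wp>(\<eta>) - \<wp>(z + \<eta>))\<close> is the same for all a.\<close>

lemma ell_G_property:
  assumes t: "triple a b c"
    and z: "z \<notin> lattice \<tau>" "z + \<eta> \<notin> lattice \<tau>" "z + 2 * \<eta> \<notin> lattice \<tau>"
  shows "ellf \<tau> a z * ellf \<tau> a (z + 2 * \<eta>) = ellf \<tau> a (2 * \<eta>) * (ell_G \<tau> \<eta> z + K \<tau> (2 * \<eta>) a)"
proof -
  note set = tripleD[OF t]
  define u X e1 e2 e3 F where "u = ell_p \<tau> \<eta>" and "X = ell_p \<tau> (z + \<eta>)" and "e1 = ell_e \<tau> a"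
    and "e2 = ell_e \<tau> b" and "e3 = ell_e \<tau> c" and "F = ell_F \<tau> \<eta>"
  define h1 h2 h3 where "h1 = ellf \<tau> a (2 * \<eta>)" and "h2 = ellf \<tau> b (2 * \<eta>)" and "h3 = ellf \<tau> c (2 * \<eta>)"
  define R1 R2 R3 where "R1 = (u - e1)\<^sup>2 - (e1 - e2) * (e1 - e3)" and "R2 = (u - e2)\<^sup>2 - (e2 - e3) * (e2 - e1)"
    and "R3 = (u - e3)\<^sup>2 - (e3 - e1) * (e3 - e2)"
  define S where "S = (u - e1) * (u - e2) + (u - e1) * (u - e3) + (u - e2) * (u - e3)"
  have h: "h1 = R1 / (2 * F)" "h2 = R2 / (2 * F)" "h3 = R3 / (2 * F)"
    unfolding h1_def h2_def h3_def R1_def R2_def R3_def u_def e1_def e2_def e3_def F_def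
    using ellf_double_eta[OF t] ellf_double_eta[OF triple_rot[OF t]]
      ellf_double_eta[OF triple_rot[OF triple_rot[OF t]]] by simp_all
  have F0: "F \<noteq> 0" and h0: "h1 \<noteq> 0"
    using ellf_eta_nonzero set unfolding F_def ell_F_eq[OF t] h1_def by simp_all
  then have R0: "R1 \<noteq> 0" using h by auto
  have FF: "F * F = (u - e1) * (u - e2) * (u - e3)"
    unfolding F_def u_def e1_def e2_def e3_def by (rule ell_F_sq[OF t eta_notin(1)])
  have D: "u - X \<noteq> 0"
    using ell_p_neq[OF z(2) eta_notin(2)] z unfolding u_def X_def by (simp add: add.assoc mult_2[symmetric])
  have "ellf \<tau> a (z + 2 * \<eta>) * ellf \<tau> a z * (u - X) = (X - e1) * (u - e1) - (e1 - e2) * (e1 - e3)"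
    using ellf_product(2)[OF t z(2) eta_notin(2)] z
    by (simp add: u_def X_def e1_def e2_def e3_def add.assoc mult_2[symmetric])
  then have L: "ellf \<tau> a z * ellf \<tau> a (z + 2 * \<eta>) = (R1 - (u - X) * (u - e1)) / (u - X)"
    using D by (simp add: field_simps R1_def) algebra
  have K: "K \<tau> (2 * \<eta>) a = - (h2 * h3) / h1"
    using K_eq[OF triple_rot[OF t], of "2 * \<eta>"] \<eta> by (simp add: h1_def h2_def h3_def)
  have G: "ell_G \<tau> \<eta> z = 2 * F / (u - X) - S / (2 * F)"
    unfolding ell_G_eq[OF t] by (simp add: u_def X_def e1_def e2_def e3_def F_def S_def)
  \<comment> \<open>This compares the constants: \<open>S / (2 * F)\<close> from G and
    \<open>h2 * h3 / h1\<close> from K add up to \<open>2 * F * (u - e1) / R1\<close>.\<close>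
  have RRR: "R2 * R3 + R1 * S = 4 * (F * F) * (u - e1)"
    unfolding FF unfolding R1_def R2_def R3_def S_def by algebra
  have "h1 * (2 * F / (u - X) - S / (2 * F) + - (h2 * h3) / h1) = R1 / (u - X) - (R2 * R3 + R1 * S) / (4 * (F * F))"
    unfolding h using F0 R0 D by (simp add: field_simps)
  also have "\<dots> = (R1 - (u - X) * (u - e1)) / (u - X)"
    unfolding RRR using F0 D by (simp add: field_simps)
  finally show ?thesis unfolding L K G h1_def ..
qed

text \<open>Since \<open>ell_F\<close> is -\<wp>'/2, this is the chord formula for G. It results
  from eliminating \<open>f\<^sub>1(w + 2\<eta>)\<close> between \<open>ell_G_property\<close> and
  the addition theorem.\<close>

lemma ell_G_difference_quotient:
  assumes w: "2 * w \<notin> lattice \<tau>" "w + \<eta> \<notin> lattice \<tau>" "w + 2 * \<eta> \<notin> lattice \<tau>"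
  shows "ell_G \<tau> \<eta> w * (ell_p \<tau> w - ell_p \<tau> (2 * \<eta>)) = ell_F \<tau> w - ell_F \<tau> (2 * \<eta>)"
proof -
  have w1: "w \<notin> lattice \<tau>" using w(1) lattice_add[of w \<tau> w] by auto
  define y1 y2 y3 h1 h2 h3 where "y1 = ellf \<tau> 1 w" and "y2 = ellf \<tau> 2 w" and "y3 = ellf \<tau> 3 w"
    and "h1 = ellf \<tau> 1 (2 * \<eta>)" and "h2 = ellf \<tau> 2 (2 * \<eta>)" and "h3 = ellf \<tau> 3 (2 * \<eta>)"
  note defs = y1_def y2_def y3_def h1_def h2_def h3_def
  have nz: "y1 \<noteq> 0" "h1 \<noteq> 0"
    unfolding defs using ellf_nonzero[OF _ w(1)] ellf_eta_nonzero(2) by simp_all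
  have 1: "ellf \<tau> 1 (w + 2 * \<eta>) * (ell_p \<tau> (2 * \<eta>) - ell_p \<tau> w) = y1 * h2 * h3 - h1 * y2 * y3"
    using ellf_addition[OF triple_123(1) w1 eta_notin(2) w(3)] by (simp add: defs)
  have 2: "y1 * ellf \<tau> 1 (w + 2 * \<eta>) = h1 * (ell_G \<tau> \<eta> w - h2 * h3 / h1)"
    using ell_G_property[OF triple_123(1) w1 w(2,3)] K_eq[OF triple_123(2), of "2 * \<eta>"] \<eta>
    by (simp add: defs)
  have 3: "y1 * y1 = ell_p \<tau> w" "h1 * h1 = ell_p \<tau> (2 * \<eta>)"
    by (simp_all add: defs ell_p_def power2_eq_square)
  have "h1 * ell_G \<tau> \<eta> w = y1 * ellf \<tau> 1 (w + 2 * \<eta>) + h2 * h3"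
    unfolding 2 using nz by (simp add: field_simps)
  then have "h1 * (ell_G \<tau> \<eta> w * (ell_p \<tau> w - ell_p \<tau> (2 * \<eta>))) =
      - y1 * (ellf \<tau> 1 (w + 2 * \<eta>) * (ell_p \<tau> (2 * \<eta>) - ell_p \<tau> w)) + h2 * h3 * (y1 * y1 - h1 * h1)"
    unfolding 3 by algebra
  also have "\<dots> = h1 * (y1 * y2 * y3 - h1 * h2 * h3)"
    unfolding 1 by algebra
  finally show ?thesis
    using nz by (simp add: ell_F_def defs)
qed

context
  fixes z w :: complex
  assumes gen: "generic \<tau> \<eta> z w"
begin

abbreviation "cp \<equiv> coeff_p \<tau> \<eta> z w"
abbreviation "cm \<equiv> coeff_m \<tau> \<eta> z w"
abbreviation "cM \<equiv> coeff_M \<tau> \<eta> z w"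

text \<open>These combinations are the coefficients in the components of the reflection equation,
  after \<open>R\<^sup>-\<close> and \<open>R\<^sup>+\<close> are divided by their coefficients of
  \<open>\<sigma>\<^sub>0 \<otimes> \<sigma>\<^sub>0\<close>. The first three rest on products with
  different indices, the next two on products with equal indices.\<close>

lemma coefficients:
  assumes t: "triple a b c"
  shows "cp a + cm a + (cm b * cp c + cm c * cp b) =
       cM * (ellf \<tau> a z * ellf \<tau> b w * ellf \<tau> c w)" (is ?C1)
    and "cp a + cm a - (cm b * cp c + cm c * cp b) =
       cM * (ellf \<tau> a (z + 2 * \<eta>) * ellf \<tau> b w * ellf \<tau> c w)" (is ?C2)
    and "cp a - cm a + (cm b * cp c - cm c * cp b) =
       - cM * (ellf \<tau> a w * ellf \<tau> b (z + 2 * \<eta>) * ellf \<tau> c z)" (is ?C3)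
    and "1 + cm a * cp a - cm b * cp b - cm c * cp c =
       cM * (ellf \<tau> a (2 * \<eta>) * (ell_p \<tau> w + ell_p \<tau> (2 * \<eta>) - ell_e \<tau> b - ell_e \<tau> c
         + K \<tau> (2 * \<eta>) a * ell_G \<tau> \<eta> z))" (is ?C4)
    and "1 + cm a * cp a + cm b * cp b + cm c * cp c =
       cM * (ell_F \<tau> (2 * \<eta>) + ell_G \<tau> \<eta> z * (ell_p \<tau> w - ell_p \<tau> (2 * \<eta>)))" (is ?C5)
    and "cM \<noteq> 0"
proof -
  note set = tripleD[OF t]
  \<comment> \<open>With this centre all arguments become p \<plusminus> w or p \<plusminus> \<eta>;
    in particular z = p - \<eta> and z + 2\<eta> = p + \<eta>.\<close>
  define p where "p = z + \<eta>"
  have g: "2 * z \<notin> lattice \<tau>" "2 * w \<notin> lattice \<tau>" "p \<notin> lattice \<tau>" "w + \<eta> \<notin> lattice \<tau>"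
    "p + \<eta> \<notin> lattice \<tau>" "w + 2 * \<eta> \<notin> lattice \<tau>" "p + w \<notin> lattice \<tau>" "p - w \<notin> lattice \<tau>" "p - \<eta> \<notin> lattice \<tau>"
  proof -
    have z2: "2 * z \<notin> lattice \<tau>" using gen by (simp add: generic_def)
    then have z1: "z \<notin> lattice \<tau>" using lattice_add[of z \<tau> z] by auto
    have "p + \<eta> = z + 2 * \<eta>" "p - \<eta> = z" by (simp_all add: p_def)
    then show "2 * z \<notin> lattice \<tau>" "2 * w \<notin> lattice \<tau>" "p \<notin> lattice \<tau>" "w + \<eta> \<notin> lattice \<tau>"
      "p + \<eta> \<notin> lattice \<tau>" "w + 2 * \<eta> \<notin> lattice \<tau>" "p + w \<notin> lattice \<tau>" "p - w \<notin> lattice \<tau>" "p - \<eta> \<notin> lattice \<tau>"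
      using gen z1 by (simp_all add: generic_def p_def add_ac)
  qed
  have w: "w \<notin> lattice \<tau>" using g(2) lattice_add[of w \<tau> w] by auto
  have ar: "z + w + \<eta> = p + w" "z - w + \<eta> = p - w" "z + 2 * \<eta> = p + \<eta>" "z = p - \<eta>"
    by (simp_all add: p_def)
  define X Y u H e1 e2 e3 F where "X = ell_p \<tau> p" and "Y = ell_p \<tau> w" and "u = ell_p \<tau> \<eta>" and "H = ell_p \<tau> (2 * \<eta>)"
    and "e1 = ell_e \<tau> a" and "e2 = ell_e \<tau> b" and "e3 = ell_e \<tau> c" and "F = ell_F \<tau> \<eta>"
  define x1 x2 x3 where "x1 = ellf \<tau> a p" and "x2 = ellf \<tau> b p" and "x3 = ellf \<tau> c p"
  define y1 y2 y3 where "y1 = ellf \<tau> a w" and "y2 = ellf \<tau> b w" and "y3 = ellf \<tau> c w"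
  define b1 b2 b3 where "b1 = ellf \<tau> a \<eta>" and "b2 = ellf \<tau> b \<eta>" and "b3 = ellf \<tau> c \<eta>"
  note defs = X_def Y_def u_def e1_def e2_def e3_def x1_def x2_def x3_def y1_def y2_def y3_def b1_def b2_def b3_def
  have D0: "Y - X \<noteq> 0" and d0: "u - X \<noteq> 0"
    using ell_p_neq[OF g(3,2,7,8)] ell_p_neq[OF g(3) eta_notin(2) g(5,9)] by (simp_all add: defs)
  have b0: "b1 \<noteq> 0" "b2 \<noteq> 0" "b3 \<noteq> 0" unfolding defs using ellf_eta_nonzero(1) set by auto
  have F: "F = b1 * b2 * b3" unfolding F_def ell_F_eq[OF t] defs ..
  have F0: "F \<noteq> 0" using b0 F by simp
  have bsq: "b1 * b1 = u - e1" "b2 * b2 = u - e2" "b3 * b3 = u - e3"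
    using ellf_sq[OF _ eta_notin(1)] set by (simp_all add: defs power2_eq_square)
  have M: "cM = 2 * (u - X) / ((Y - X) * F)"
    unfolding coeff_M_def by (simp add: p_def[symmetric] defs F_def)
  show "cM \<noteq> 0" unfolding M using D0 d0 F0 by simp
  have pw: "ellf \<tau> a (p + w) = (x1 * y2 * y3 - y1 * x2 * x3) / (Y - X)"
    and mw: "ellf \<tau> a (p - w) = (x1 * y2 * y3 + y1 * x2 * x3) / (Y - X)"
    using ellf_addition[OF t g(3) w g(7)] ellf_subtraction[OF t g(3) w g(8)] D0
    by (simp_all add: defs nonzero_eq_divide_eq)
  have ph: "ellf \<tau> a (p + \<eta>) = (x1 * b2 * b3 - b1 * x2 * x3) / (u - X)"
    and mh: "ellf \<tau> a (p - \<eta>) = (x1 * b2 * b3 + b1 * x2 * x3) / (u - X)"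
    using ellf_addition[OF t g(3) eta_notin(1) g(5)] ellf_subtraction[OF t g(3) eta_notin(1) g(9)] d0
    by (simp_all add: defs nonzero_eq_divide_eq)
  have bc: "ellf \<tau> b (p + w) * ellf \<tau> c (p - w) = (x2 * x3 * y2 * y3 + (e3 - e2) * x1 * y1) / (Y - X)"
    using ellf_product(1)[OF t g(3,2,7,8)] D0 by (simp add: defs nonzero_eq_divide_eq)
  have cb: "ellf \<tau> c (p + w) * ellf \<tau> b (p - w) = (x3 * x2 * y3 * y2 + (e2 - e3) * x1 * y1) / (Y - X)"
    using ellf_product(1)[OF triple_swap[OF t] g(3,2,7,8)] D0 by (simp add: defs nonzero_eq_divide_eq)
  have hbc: "ellf \<tau> b (p + \<eta>) * ellf \<tau> c (p - \<eta>) = (x2 * x3 * b2 * b3 + (e3 - e2) * x1 * b1) / (u - X)"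
    using ellf_product(1)[OF t g(3) eta_notin(2) g(5,9)] d0 by (simp add: defs nonzero_eq_divide_eq)
  have m_p: "cm b * cp c = (x3 * x2 * y3 * y2 + (e2 - e3) * x1 * y1) / ((Y - X) * b2 * b3)"
    "cm c * cp b = (x2 * x3 * y2 * y3 + (e3 - e2) * x1 * y1) / ((Y - X) * b2 * b3)"
  proof -
    have "cm b * cp c = (ellf \<tau> c (p + w) * ellf \<tau> b (p - w)) / (b2 * b3)"
      unfolding coeff_m_def coeff_p_def ar(1,2) by (simp add: defs mult.commute)
    then show "cm b * cp c = (x3 * x2 * y3 * y2 + (e2 - e3) * x1 * y1) / ((Y - X) * b2 * b3)"
      unfolding cb by simp
    have "cm c * cp b = (ellf \<tau> b (p + w) * ellf \<tau> c (p - w)) / (b2 * b3)"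
      unfolding coeff_m_def coeff_p_def ar(1,2) by (simp add: defs mult.commute)
    then show "cm c * cp b = (x2 * x3 * y2 * y3 + (e3 - e2) * x1 * y1) / ((Y - X) * b2 * b3)"
      unfolding bc by simp
  qed
  have cp: "cp a = (x1 * y2 * y3 - y1 * x2 * x3) / ((Y - X) * b1)"
    and cm: "cm a = (x1 * y2 * y3 + y1 * x2 * x3) / ((Y - X) * b1)"
    unfolding coeff_p_def coeff_m_def ar(1,2) pw mw b1_def[symmetric] by simp_all
  have k: "e2 - e3 = - (e3 - e2)" by simp
  note odc = off_diagonal_coefficient_identities[OF D0 d0 b0, of x1 y2 y3 y1 x2 x3 "e3 - e2"]
  show ?C1
    unfolding m_p cp cm M unfolding ar(4) mh F y2_def[symmetric] y3_def[symmetric] k by (rule odc(1))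
  show ?C2
    unfolding m_p cp cm M unfolding ar(3) ph F y2_def[symmetric] y3_def[symmetric] k by (rule odc(2))
  have "ellf \<tau> a w * ellf \<tau> b (z + 2 * \<eta>) * ellf \<tau> c z = y1 * (ellf \<tau> b (p + \<eta>) * ellf \<tau> c (p - \<eta>))"
    unfolding ar(3) y1_def by (simp add: ar(4)[symmetric])
  then show ?C3
    unfolding m_p cp cm M hbc unfolding F k using odc(3) by simp
  \<comment> \<open>The products with equal indices depend on squares only, hence on these few
    quantities. The signs are chosen so that \<delta> + \<epsilon> is the common denominator
    \<open>Y - X\<close>.\<close>
  define P1 P2 P3 \<delta> \<epsilon> q where "P1 = u - e1" and "P2 = u - e2" and "P3 = u - e3" and "\<delta> = u - X" and "\<epsilon> = Y - u"
    and "q = P1 * P2 * P3"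
  define R1 R2 R3 where "R1 = P1\<^sup>2 - (P2 - P1) * (P3 - P1)" and "R2 = P2\<^sup>2 - (P3 - P2) * (P1 - P2)"
    and "R3 = P3\<^sup>2 - (P1 - P3) * (P2 - P3)"
  define S where "S = P1 * P2 + P1 * P3 + P2 * P3"
  have P0: "P1 \<noteq> 0" "P2 \<noteq> 0" "P3 \<noteq> 0" using b0 unfolding P1_def P2_def P3_def bsq[symmetric] by simp_all
  have q0: "q \<noteq> 0" using P0 by (simp add: q_def)
  have FF: "F * F = q" unfolding F q_def P1_def P2_def P3_def bsq[symmetric] by simp
  have h: "ellf \<tau> a (2 * \<eta>) = R1 / (2 * F)" "ellf \<tau> b (2 * \<eta>) = R2 / (2 * F)" "ellf \<tau> c (2 * \<eta>) = R3 / (2 * F)"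
    unfolding R1_def R2_def R3_def P1_def P2_def P3_def u_def e1_def e2_def e3_def F_def
    using ellf_double_eta[OF t] ellf_double_eta[OF triple_rot[OF t]] ellf_double_eta[OF triple_rot[OF triple_rot[OF t]]]
    by simp_all
  have R0: "R1 \<noteq> 0" using h(1) ellf_eta_nonzero(2)[OF set(1)] by auto
  have diag: "cm a * cp a = ((P1 - \<delta>) * (P1 + \<epsilon>) - (P2 - P1) * (P3 - P1)) / P1 / (Y - X)"
    "cm b * cp b = ((P2 - \<delta>) * (P2 + \<epsilon>) - (P3 - P2) * (P1 - P2)) / P2 / (Y - X)"
    "cm c * cp c = ((P3 - \<delta>) * (P3 + \<epsilon>) - (P1 - P3) * (P2 - P3)) / P3 / (Y - X)"
  proof -
    have 1: "cm i * cp i = ((X - ell_e \<tau> i) * (Y - ell_e \<tau> i) - (ell_e \<tau> i - ell_e \<tau> j) * (ell_e \<tau> i - ell_e \<tau> k)) / (u - ell_e \<tau> i) / (Y - X)"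
      if t: "triple i j k" for i j k
    proof -
      have "cm i * cp i = (ellf \<tau> i (p + w) * ellf \<tau> i (p - w)) / (ellf \<tau> i \<eta>)\<^sup>2"
        unfolding coeff_m_def coeff_p_def ar(1,2) by (simp add: power2_eq_square)
      moreover have "ellf \<tau> i (p + w) * ellf \<tau> i (p - w) = ((X - ell_e \<tau> i) * (Y - ell_e \<tau> i) - (ell_e \<tau> i - ell_e \<tau> j) * (ell_e \<tau> i - ell_e \<tau> k)) / (Y - X)"
        using ellf_product(2)[OF t g(3,2,7,8)] D0 by (simp add: X_def Y_def nonzero_eq_divide_eq)
      moreover have "(ellf \<tau> i \<eta>)\<^sup>2 = u - ell_e \<tau> i" using ellf_sq[OF tripleD(1)[OF t] eta_notin(1)] by (simp add: u_def)
      ultimately show ?thesis by (simp add: mult.commute)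
    qed
    show "cm a * cp a = ((P1 - \<delta>) * (P1 + \<epsilon>) - (P2 - P1) * (P3 - P1)) / P1 / (Y - X)"
      using 1[OF t] by (simp add: P1_def P2_def P3_def \<delta>_def \<epsilon>_def e1_def e2_def e3_def)
    show "cm b * cp b = ((P2 - \<delta>) * (P2 + \<epsilon>) - (P3 - P2) * (P1 - P2)) / P2 / (Y - X)"
      using 1[OF triple_rot[OF t]] by (simp add: P1_def P2_def P3_def \<delta>_def \<epsilon>_def e1_def e2_def e3_def)
    show "cm c * cp c = ((P3 - \<delta>) * (P3 + \<epsilon>) - (P1 - P3) * (P2 - P3)) / P3 / (Y - X)"
      using 1[OF triple_rot[OF triple_rot[OF t]]]
      by (simp add: P1_def P2_def P3_def \<delta>_def \<epsilon>_def e1_def e2_def e3_def)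
  qed
  have DX: "Y - X = \<delta> + \<epsilon>" by (simp add: \<delta>_def \<epsilon>_def)
  have H: "H = R1\<^sup>2 / (4 * q) + e1"
  proof -
    have "H - e1 = (R1 / (2 * F))\<^sup>2"
      using ellf_sq[OF set(1) eta_notin(2)] by (simp add: H_def e1_def h[symmetric])
    also have "\<dots> = R1\<^sup>2 / (4 * q)"
      unfolding FF[symmetric] by (simp add: power2_eq_square)
    finally show ?thesis by (simp add: algebra_simps)
  qed
  have G: "ell_G \<tau> \<eta> z = 2 * F / \<delta> - S / (2 * F)"
    unfolding ell_G_eq[OF t] S_def P1_def P2_def P3_def \<delta>_def
    by (simp add: u_def X_def e1_def e2_def e3_def F_def p_def)
  have \<delta>0: "\<delta> \<noteq> 0" using d0 by (simp add: \<delta>_def)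
  have FG: "2 * \<delta> / F * ell_G \<tau> \<eta> z = 4 - \<delta> * S / q"
    unfolding G FF[symmetric] using F0 \<delta>0 by (simp add: field_simps)
  have cancel: "A = 2 * \<delta> / ((Y - X) * F) * B" if "(Y - X) * A = 2 * \<delta> / F * B" for A B
  proof -
    have "A = ((Y - X) * A) / (Y - X)" using D0 by simp
    then show ?thesis unfolding that by (simp add: mult.commute)
  qed
  have "(Y - X) * (1 + cm a * cp a + cm b * cp b + cm c * cp c) =
      (\<delta> + \<epsilon>) + ((P1 - \<delta>) * (P1 + \<epsilon>) - (P2 - P1) * (P3 - P1)) / P1
     + ((P2 - \<delta>) * (P2 + \<epsilon>) - (P3 - P2) * (P1 - P2)) / P2
     + ((P3 - \<delta>) * (P3 + \<epsilon>) - (P1 - P3) * (P2 - P3)) / P3"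
    unfolding diag distrib_left using D0 by (simp add: DX)
  also have "\<dots> = \<delta> * R1 * R2 * R3 / (4 * q\<^sup>2) + (4 - \<delta> * S / q) * (\<epsilon> + P1 - R1\<^sup>2 / (4 * q))"
    unfolding S_def by (rule diagonal_coefficient_identity_1[OF P0 q_def R1_def R2_def R3_def])
  also have "\<dots> = 2 * \<delta> / F * (ell_F \<tau> (2 * \<eta>) + ell_G \<tau> \<eta> z * (Y - H))"
  proof -
    have "ell_F \<tau> (2 * \<eta>) = R1 * R2 * R3 / (8 * F * q)"
      unfolding ell_F_eq[OF t] h FF[symmetric] by simp
    then have "2 * \<delta> / F * ell_F \<tau> (2 * \<eta>) = \<delta> * R1 * R2 * R3 / (4 * q\<^sup>2)"
      unfolding power2_eq_square FF[symmetric] by (simp add: mult_ac)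
    moreover have "\<epsilon> + P1 - R1\<^sup>2 / (4 * q) = Y - H" unfolding H \<epsilon>_def P1_def by simp
    ultimately show ?thesis unfolding FG[symmetric] by (simp add: distrib_left mult.assoc)
  qed
  finally show ?C5
    unfolding M Y_def[symmetric] H_def[symmetric] \<delta>_def[symmetric] by (rule cancel)
  have K: "K \<tau> (2 * \<eta>) a = - (R2 * R3) / (2 * F * R1)"
    using K_eq[OF triple_rot[OF t], of "2 * \<eta>"] \<eta> F0 by (simp add: h)
  have "(Y - X) * (1 + cm a * cp a - cm b * cp b - cm c * cp c) =
      (\<delta> + \<epsilon>) + ((P1 - \<delta>) * (P1 + \<epsilon>) - (P2 - P1) * (P3 - P1)) / P1
     - ((P2 - \<delta>) * (P2 + \<epsilon>) - (P3 - P2) * (P1 - P2)) / P2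
     - ((P3 - \<delta>) * (P3 + \<epsilon>) - (P1 - P3) * (P2 - P3)) / P3"
    unfolding diag distrib_left right_diff_distrib using D0 by (simp add: DX)
  also have "\<dots> = \<delta> * R1 / q * (\<epsilon> + P2 + P3 + R1\<^sup>2 / (4 * q) - P1 - R2 * R3 / R1 * (1 / \<delta> - S / (4 * q)))"
    unfolding S_def by (rule diagonal_coefficient_identity_2[OF P0 R0 \<delta>0 q_def R1_def R2_def R3_def])
  also have "\<dots> = 2 * \<delta> / F * (ellf \<tau> a (2 * \<eta>) * (Y + H - e2 - e3 + K \<tau> (2 * \<eta>) a * ell_G \<tau> \<eta> z))"
  proof -
    have "K \<tau> (2 * \<eta>) a * ell_G \<tau> \<eta> z = - R2 * R3 / R1 * (1 / \<delta> - S / (4 * q))"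
      unfolding K G FF[symmetric] using F0 \<delta>0 R0 by (simp add: field_simps)
    moreover have "\<epsilon> + P2 + P3 + R1\<^sup>2 / (4 * q) - P1 = Y + H - e2 - e3" unfolding H \<epsilon>_def P1_def P2_def P3_def by simp
    moreover have "2 * \<delta> / F * ellf \<tau> a (2 * \<eta>) = \<delta> * R1 / q" unfolding h FF[symmetric] by simp
    ultimately show ?thesis unfolding mult.assoc[symmetric] by simp
  qed
  finally show ?C4
    unfolding M Y_def[symmetric] H_def[symmetric] e2_def[symmetric] e3_def[symmetric] \<delta>_def[symmetric] by (rule cancel)
qed

end

end

section \<open>Components of the reflection equation\<close>

context complex_algebra
begin

text \<open>Only linearity is required: the reflection equation is linear in the products of two
  L-coefficients, so the values of a functional on such products serve as scalar unknowns.\<close>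

definition functional :: "('a \<Rightarrow> complex) \<Rightarrow> bool" where
  "functional \<Phi> \<longleftrightarrow> (\<forall>x y. \<Phi> (x + y) = \<Phi> x + \<Phi> y) \<and> (\<forall>c x. \<Phi> (smul c x) = c * \<Phi> x)"

lemma functional_separates:
  assumes "\<And>\<Phi>. functional \<Phi> \<Longrightarrow> \<Phi> x = 0"
  shows "x = 0"
proof (rule ccontr)
  assume "x \<noteq> 0"
  interpret C: vector_space "(*) :: complex \<Rightarrow> complex \<Rightarrow> complex"
    by unfold_locales (simp_all add: algebra_simps)
  interpret P: vector_space_pair smul "(*) :: complex \<Rightarrow> complex \<Rightarrow> complex" ..
  have "independent {x}" using \<open>x \<noteq> 0\<close> by simp
  then obtain g where g: "Vector_Spaces.linear smul (*) g" "g x = 1"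
    using P.linear_independent_extend[of "{x}" "\<lambda>_. 1"] by auto
  then interpret g: Vector_Spaces.linear smul "(*)" g by simp
  have "functional g" unfolding functional_def by (simp add: g.add g.scale)
  then have "g x = 0" by (rule assms)
  then show False using g by simp
qed

end

locale algebra_functional = complex_algebra +
  fixes \<Phi> :: "'a \<Rightarrow> complex"
  assumes functional: "functional \<Phi>"
begin

lemma functional_add: "\<Phi> (x + y) = \<Phi> x + \<Phi> y"
  and functional_smul: "\<Phi> (smul c x) = c * \<Phi> x"
  using functional by (auto simp: functional_def)

lemma functional_0: "\<Phi> 0 = 0"
  using functional_smul[of 0 0] by simp

lemma functional_minus: "\<Phi> (- x) = - \<Phi> x"
  using functional_add[of x "- x"] by (simp add: functional_0 eq_neg_iff_add_eq_0 add.commute)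

lemma functional_diff: "\<Phi> (x - y) = \<Phi> x - \<Phi> y"
  using functional_add[of x "- y"] by (simp add: functional_minus)

lemma functional_smul_mult: "\<Phi> (smul c x * y) = c * \<Phi> (x * y)" "\<Phi> (x * smul c y) = c * \<Phi> (x * y)"
  by (simp_all add: smul_mult_left smul_mult_right functional_smul)

lemma functional_add_mult: "\<Phi> ((x + x') * y) = \<Phi> (x * y) + \<Phi> (x' * y)" "\<Phi> (x * (y + y')) = \<Phi> (x * y) + \<Phi> (x * y')"
  by (simp_all add: ring_distribs functional_add)

lemma functional_diff_mult: "\<Phi> ((x - x') * y) = \<Phi> (x * y) - \<Phi> (x' * y)" "\<Phi> (x * (y - y')) = \<Phi> (x * y) - \<Phi> (x * y')"
  by (simp_all add: algebra_simps functional_diff)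

lemmas functional_simps = functional_0 functional_add functional_diff functional_smul functional_smul_mult
  functional_add_mult functional_diff_mult

end

section \<open>Matrix entries and Pauli components\<close>

definition pauli_R :: "(nat \<Rightarrow> complex) \<Rightarrow> complex ^ (2 \<times> 2) ^ (2 \<times> 2)" where
  "pauli_R r = (\<Sum>a\<in>{0..3}. map_matrix ((*) (r a)) (sigma a \<otimes>\<otimes> sigma a))"

definition pauli_L :: "(complex \<Rightarrow> 'a::{ring, monoid_mult} \<Rightarrow> 'a) \<Rightarrow> (nat \<Rightarrow> 'a) \<Rightarrow> 'a ^ 2 ^ 2" where
  "pauli_L smul l = map_matrix (\<lambda>c. smul c (l 0)) (sigma 0) + (\<Sum>a\<in>{1..3}. map_matrix (\<lambda>c. smul c (l a)) (sigma a))"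

lemma sum_0_3: "(\<Sum>a\<in>{0..3::nat}. f a) = f 0 + f 1 + f 2 + (f 3 :: 'b::comm_monoid_add)"
  by (simp add: numeral_3_eq_3 numeral_2_eq_2 add.assoc)

lemma sum_1_3: "(\<Sum>a\<in>{1..3::nat}. f a) = f 1 + f 2 + (f 3 :: 'b::comm_monoid_add)"
  by (simp add: numeral_3_eq_3 numeral_2_eq_2 add.assoc)

lemma sigma_entries:
  "sigma 0 $ 1 $ 1 = 1" "sigma 0 $ 1 $ 2 = 0" "sigma 0 $ 2 $ 1 = 0" "sigma 0 $ 2 $ 2 = 1"
  "sigma 1 $ 1 $ 1 = 0" "sigma 1 $ 1 $ 2 = 1" "sigma 1 $ 2 $ 1 = 1" "sigma 1 $ 2 $ 2 = 0"
  "sigma 2 $ 1 $ 1 = 0" "sigma 2 $ 1 $ 2 = - \<i>" "sigma 2 $ 2 $ 1 = \<i>" "sigma 2 $ 2 $ 2 = 0"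
  "sigma 3 $ 1 $ 1 = 1" "sigma 3 $ 1 $ 2 = 0" "sigma 3 $ 2 $ 1 = 0" "sigma 3 $ 2 $ 2 = - 1"
  by (simp_all add: sigma_def mat_def numeral_2_eq_2 numeral_3_eq_3)

lemma pauli_R_entries:
  "pauli_R r $ (1,1) $ (1,1) = r 0 + r 3" "pauli_R r $ (1,2) $ (1,2) = r 0 - r 3"
  "pauli_R r $ (2,1) $ (2,1) = r 0 - r 3" "pauli_R r $ (2,2) $ (2,2) = r 0 + r 3"
  "pauli_R r $ (1,1) $ (2,2) = r 1 - r 2" "pauli_R r $ (2,2) $ (1,1) = r 1 - r 2"
  "pauli_R r $ (1,2) $ (2,1) = r 1 + r 2" "pauli_R r $ (2,1) $ (1,2) = r 1 + r 2"
  "pauli_R r $ (1,1) $ (1,2) = 0" "pauli_R r $ (1,1) $ (2,1) = 0"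
  "pauli_R r $ (1,2) $ (1,1) = 0" "pauli_R r $ (1,2) $ (2,2) = 0"
  "pauli_R r $ (2,1) $ (1,1) = 0" "pauli_R r $ (2,1) $ (2,2) = 0"
  "pauli_R r $ (2,2) $ (1,2) = 0" "pauli_R r $ (2,2) $ (2,1) = 0"
  unfolding pauli_R_def sum_0_3 by (simp_all add: kron_def sigma_entries del: One_nat_def)

lemma (in complex_algebra) pauli_L_entries:
  "pauli_L smul l $ 1 $ 1 = l 0 + l 3" "pauli_L smul l $ 2 $ 2 = l 0 - l 3"
  "pauli_L smul l $ 1 $ 2 = l 1 - smul \<i> (l 2)" "pauli_L smul l $ 2 $ 1 = l 1 + smul \<i> (l 2)"
  unfolding pauli_L_def sum_1_3 by (simp_all add: sigma_entries del: One_nat_def)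

lemma UNIV_2_2: "(UNIV :: (2 \<times> 2) set) = {(1,1), (1,2), (2,1), (2,2)}"
  using UNIV_2 by (auto simp: UNIV_Times_UNIV[symmetric] simp del: UNIV_Times_UNIV)

lemma sum_2_2: "(\<Sum>r\<in>(UNIV :: (2 \<times> 2) set). f r) = f (1,1) + f (1,2) + f (2,1) + (f (2,2) :: 'b::comm_monoid_add)"
  unfolding UNIV_2_2 by (simp add: add.assoc)

lemma all_2_2: "(\<forall>r :: 2 \<times> 2. P r) \<longleftrightarrow> P (1,1) \<and> P (1,2) \<and> P (2,1) \<and> P (2,2)"
  by (simp add: split_paired_All forall_2)

context algebra_functional
begin

text \<open>\<open>L \<otimes> 1\<close> keeps the second index and \<open>1 \<otimes> L'\<close>
  keeps the first. In the first product only the intermediate pair s is free in both components; the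
  next two are \<open>(fst t, snd s)\<close> and \<open>(fst c, snd t)\<close>, so t collects the
  two indices that remain. The second product is analogous.\<close>

lemma triple_product_entries:
  fixes R R' :: "complex ^ (2 \<times> 2) ^ (2 \<times> 2)" and L L' :: "'a ^ 2 ^ 2"
  shows "\<Phi> ((lift_mat smul R \<bullet>\<bullet> (L \<otimes>\<otimes> lift_mat smul (sigma 0)) \<bullet>\<bullet> lift_mat smul R' \<bullet>\<bullet> (lift_mat smul (sigma 0) \<otimes>\<otimes> L')) $ r $ c)
    = (\<Sum>s\<in>UNIV. \<Sum>t\<in>UNIV. R $ r $ s * R' $ (fst t, snd s) $ (fst c, snd t) * \<Phi> (L $ fst s $ fst t * L' $ snd t $ snd c))"
    and "\<Phi> (((lift_mat smul (sigma 0) \<otimes>\<otimes> L') \<bullet>\<bullet> lift_mat smul R' \<bullet>\<bullet> (L \<otimes>\<otimes> lift_mat smul (sigma 0)) \<bullet>\<bullet> lift_mat smul R) $ r $ c)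
    = (\<Sum>s\<in>UNIV. \<Sum>t\<in>UNIV. R $ s $ c * R' $ (fst r, snd t) $ (fst t, snd s) * \<Phi> (L' $ snd r $ snd t * L $ fst t $ fst s))"
proof -
  have "\<forall>r c. \<Phi> ((lift_mat smul R \<bullet>\<bullet> (L \<otimes>\<otimes> lift_mat smul (sigma 0)) \<bullet>\<bullet> lift_mat smul R' \<bullet>\<bullet> (lift_mat smul (sigma 0) \<otimes>\<otimes> L')) $ r $ c)
    = (\<Sum>s\<in>UNIV. \<Sum>t\<in>UNIV. R $ r $ s * R' $ (fst t, snd s) $ (fst c, snd t) * \<Phi> (L $ fst s $ fst t * L' $ snd t $ snd c))"
    unfolding all_2_2 mat_mult_def sum_2_2 kron_def
    by (simp add: sigma_entries functional_simps smul_mult_left smul_mult_right algebra_simps)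
  then show "\<Phi> ((lift_mat smul R \<bullet>\<bullet> (L \<otimes>\<otimes> lift_mat smul (sigma 0)) \<bullet>\<bullet> lift_mat smul R' \<bullet>\<bullet> (lift_mat smul (sigma 0) \<otimes>\<otimes> L')) $ r $ c)
    = (\<Sum>s\<in>UNIV. \<Sum>t\<in>UNIV. R $ r $ s * R' $ (fst t, snd s) $ (fst c, snd t) * \<Phi> (L $ fst s $ fst t * L' $ snd t $ snd c))" by blast
  have "\<forall>r c. \<Phi> (((lift_mat smul (sigma 0) \<otimes>\<otimes> L') \<bullet>\<bullet> lift_mat smul R' \<bullet>\<bullet> (L \<otimes>\<otimes> lift_mat smul (sigma 0)) \<bullet>\<bullet> lift_mat smul R) $ r $ c)
    = (\<Sum>s\<in>UNIV. \<Sum>t\<in>UNIV. R $ s $ c * R' $ (fst r, snd t) $ (fst t, snd s) * \<Phi> (L' $ snd r $ snd t * L $ fst t $ fst s))"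
    unfolding all_2_2 mat_mult_def sum_2_2 kron_def
    by (simp add: sigma_entries functional_simps smul_mult_left smul_mult_right algebra_simps)
  then show "\<Phi> (((lift_mat smul (sigma 0) \<otimes>\<otimes> L') \<bullet>\<bullet> lift_mat smul R' \<bullet>\<bullet> (L \<otimes>\<otimes> lift_mat smul (sigma 0)) \<bullet>\<bullet> lift_mat smul R) $ r $ c)
    = (\<Sum>s\<in>UNIV. \<Sum>t\<in>UNIV. R $ s $ c * R' $ (fst r, snd t) $ (fst t, snd s) * \<Phi> (L' $ snd r $ snd t * L $ fst t $ fst s))" by blast
qed

end

text \<open>
  The coefficients of \<open>\<sigma>\<^sub>a \<otimes> \<sigma>\<^sub>b\<close> in the difference of the two sides of the reflection equation, where
  \<open>X c d\<close> and \<open>Y c d\<close> stand for \<open>l\<^sub>c(z) l\<^sub>d(w)\<close> and \<open>l\<^sub>d(w) l\<^sub>c(z)\<close> with \<open>l\<^sub>c\<close> the coefficient of \<open>\<sigma>\<^sub>c\<close> in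
  \<open>Lhat\<close>, and \<open>m\<close>, \<open>p\<close> for the coefficients of \<open>R\<^sup>-\<close> and \<open>R\<^sup>+\<close>. In the components other than \<open>comp_00\<close>,
  \<open>(a, b, c)\<close> is a cyclic permutation of \<open>(1, 2, 3)\<close>.
\<close>

context
  fixes m p :: "nat \<Rightarrow> complex" and X Y :: "nat \<Rightarrow> nat \<Rightarrow> complex"
begin

definition comp_00 :: complex where
  "comp_00 = (m 0 * p 0 + m 1 * p 1 + m 2 * p 2 + m 3 * p 3) * (X 0 0 - Y 0 0)
     + (m 0 * p 1 + m 1 * p 0 + m 2 * p 3 + m 3 * p 2) * (X 1 1 - Y 1 1)
     + (m 0 * p 2 + m 2 * p 0 + m 3 * p 1 + m 1 * p 3) * (X 2 2 - Y 2 2)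
     + (m 0 * p 3 + m 3 * p 0 + m 1 * p 2 + m 2 * p 1) * (X 3 3 - Y 3 3)"

definition comp_aa :: "nat \<Rightarrow> nat \<Rightarrow> nat \<Rightarrow> complex" where
  "comp_aa a b c = (m 0 * p 0 + m a * p a - m b * p b - m c * p c) * (X a a - Y a a)
     + (m 0 * p a + m a * p 0 - m b * p c - m c * p b) * (X 0 0 - Y 0 0)
     + (m 0 * p b + m a * p c - m b * p 0 - m c * p a) * (X c c - Y c c)
     + (m 0 * p c + m a * p b - m b * p a - m c * p 0) * (X b b - Y b b)"

definition comp_0a :: "nat \<Rightarrow> nat \<Rightarrow> nat \<Rightarrow> complex" where
  "comp_0a a b c = (m 0 * p 0 + m a * p a + m b * p b + m c * p c) * (X 0 a - Y 0 a)
     + (m 0 * p a + m a * p 0 + m b * p c + m c * p b) * (X a 0 - Y a 0)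
     + \<i> * (m 0 * p b + m b * p 0 + m a * p c + m c * p a) * (X b c + Y b c)
     - \<i> * (m 0 * p c + m c * p 0 + m a * p b + m b * p a) * (X c b + Y c b)"

definition comp_a0 :: "nat \<Rightarrow> nat \<Rightarrow> nat \<Rightarrow> complex" where
  "comp_a0 a b c = (m 0 * p 0 + m a * p a - m b * p b - m c * p c) * (X a 0 - Y a 0)
     + (m 0 * p a + m a * p 0 - m b * p c - m c * p b) * (X 0 a - Y 0 a)
     - \<i> * (m 0 * p b + m a * p c - m b * p 0 - m c * p a) * (X c b + Y c b)
     + \<i> * (m 0 * p c + m a * p b - m b * p a - m c * p 0) * (X b c + Y b c)"

definition comp_bc :: "nat \<Rightarrow> nat \<Rightarrow> nat \<Rightarrow> complex" where
  "comp_bc a b c = (m 0 * p 0 - m a * p a + m b * p b - m c * p c) * (X b c - Y b c)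
     - (m 0 * p a - m a * p 0 + m b * p c - m c * p b) * (X c b - Y c b)
     - \<i> * (m 0 * p b - m a * p c + m b * p 0 - m c * p a) * (X 0 a + Y 0 a)
     - \<i> * (m 0 * p c - m a * p b + m b * p a - m c * p 0) * (X a 0 + Y a 0)"

definition comp_cb :: "nat \<Rightarrow> nat \<Rightarrow> nat \<Rightarrow> complex" where
  "comp_cb a b c = (m 0 * p 0 - m a * p a - m b * p b + m c * p c) * (X c b - Y c b)
     - (m 0 * p a - m a * p 0 - m b * p c + m c * p b) * (X b c - Y b c)
     + \<i> * (m 0 * p b - m a * p c - m b * p 0 + m c * p a) * (X a 0 + Y a 0)
     + \<i> * (m 0 * p c - m a * p b - m b * p a + m c * p 0) * (X 0 a + Y 0 a)"

definition all_components_vanish :: bool where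
  "all_components_vanish \<longleftrightarrow> comp_00 = 0 \<and>
    (\<forall>(a, b, c) \<in> {(1, 2, 3), (2, 3, 1), (3, 1, 2)}.
       comp_aa a b c = 0 \<and> comp_0a a b c = 0 \<and> comp_a0 a b c = 0 \<and> comp_bc a b c = 0 \<and> comp_cb a b c = 0)"

end

text \<open>In each case the signs form an invertible 4 by 4 Hadamard matrix once the factors \<i>
  and some signs are absorbed into the unknowns.\<close>

lemma pauli_combinations_eq_0_iff:
  fixes x1 x2 x3 x4 :: complex
  shows "x1 + x2 + x3 + x4 = 0 \<and> x1 - x2 + x3 - x4 = 0 \<and> x1 + x2 - x3 - x4 = 0 \<and> x1 - x2 - x3 + x4 = 0 \<longleftrightarrow>
      x1 = 0 \<and> x2 = 0 \<and> x3 = 0 \<and> x4 = 0" (is "?A \<longleftrightarrow> ?B")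
    and "x1 - \<i> * x2 + x3 - \<i> * x4 = 0 \<and> x1 + \<i> * x2 + x3 + \<i> * x4 = 0 \<and> x1 - \<i> * x2 - x3 + \<i> * x4 = 0 \<and> x1 + \<i> * x2 - x3 - \<i> * x4 = 0 \<longleftrightarrow>
      x1 = 0 \<and> x2 = 0 \<and> x3 = 0 \<and> x4 = 0" (is "?C \<longleftrightarrow> ?B")
    and "x1 - \<i> * x2 - \<i> * x3 - x4 = 0 \<and> x1 + \<i> * x2 - \<i> * x3 + x4 = 0 \<and> x1 - \<i> * x2 + \<i> * x3 + x4 = 0 \<and> x1 + \<i> * x2 + \<i> * x3 - x4 = 0 \<longleftrightarrow>
      x1 = 0 \<and> x2 = 0 \<and> x3 = 0 \<and> x4 = 0" (is "?D \<longleftrightarrow> ?B")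
proof -
  have main: "x1 = 0 \<and> x2 = 0 \<and> x3 = 0 \<and> x4 = 0"
    if "x1 + x2 + x3 + x4 = 0" "x1 - x2 + x3 - x4 = 0" "x1 + x2 - x3 - x4 = 0" "x1 - x2 - x3 + x4 = 0"
    for x1 x2 x3 x4 :: complex
  proof -
    have "4 * x1 = 0" "4 * x2 = 0" "4 * x3 = 0" "4 * x4 = 0" using that by algebra+
    then show ?thesis by simp
  qed
  show "?A \<longleftrightarrow> ?B" using main[of x1 x2 x3 x4] by auto
  show "?C \<longleftrightarrow> ?B" using main[of x1 "- \<i> * x2" x3 "- \<i> * x4"] by auto
  show "?D \<longleftrightarrow> ?B" using main[of x1 "- \<i> * x2" "- \<i> * x3" "- x4"] by auto
qed

lemma all_components_vanish_iff:
  "all_components_vanish m p X Y \<longleftrightarrow> comp_00 m p X Y = 0 \<and>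
    (comp_aa m p X Y 1 2 3 = 0 \<and> comp_0a m p X Y 1 2 3 = 0 \<and> comp_a0 m p X Y 1 2 3 = 0 \<and> comp_bc m p X Y 1 2 3 = 0 \<and> comp_cb m p X Y 1 2 3 = 0) \<and>
    (comp_aa m p X Y 2 3 1 = 0 \<and> comp_0a m p X Y 2 3 1 = 0 \<and> comp_a0 m p X Y 2 3 1 = 0 \<and> comp_bc m p X Y 2 3 1 = 0 \<and> comp_cb m p X Y 2 3 1 = 0) \<and>
    (comp_aa m p X Y 3 1 2 = 0 \<and> comp_0a m p X Y 3 1 2 = 0 \<and> comp_a0 m p X Y 3 1 2 = 0 \<and> comp_bc m p X Y 3 1 2 = 0 \<and> comp_cb m p X Y 3 1 2 = 0)"
  unfolding all_components_vanish_def by simp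

context algebra_functional
begin

context
  fixes m p :: "nat \<Rightarrow> complex" and l l' :: "nat \<Rightarrow> 'a" and X Y :: "nat \<Rightarrow> nat \<Rightarrow> complex" and D
  assumes X: "\<And>c d. X c d = \<Phi> (l c * l' d)" and Y: "\<And>c d. Y c d = \<Phi> (l' d * l c)"
    and D: "\<And>r c. D r c =
      \<Phi> ((lift_mat smul (pauli_R m) \<bullet>\<bullet> (pauli_L smul l \<otimes>\<otimes> lift_mat smul (sigma 0)) \<bullet>\<bullet> lift_mat smul (pauli_R p)
          \<bullet>\<bullet> (lift_mat smul (sigma 0) \<otimes>\<otimes> pauli_L smul l')) $ r $ c)
      - \<Phi> (((lift_mat smul (sigma 0) \<otimes>\<otimes> pauli_L smul l') \<bullet>\<bullet> lift_mat smul (pauli_R p)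
          \<bullet>\<bullet> (pauli_L smul l \<otimes>\<otimes> lift_mat smul (sigma 0)) \<bullet>\<bullet> lift_mat smul (pauli_R m)) $ r $ c)"
begin

text \<open>The sixteen entries fall into four blocks, according to which of the two indices is
  flipped. In this block only tensor products of the identity and \<open>\<sigma>\<^sub>3\<close>
  contribute, and the signs are products of eigenvalues of \<open>\<sigma>\<^sub>3\<close>.\<close>

lemma entries_diagonal:
  "D (1,1) (1,1) = comp_00 m p X Y + comp_0a m p X Y 3 1 2 + comp_a0 m p X Y 3 1 2 + comp_aa m p X Y 3 1 2"
  "D (1,2) (1,2) = comp_00 m p X Y - comp_0a m p X Y 3 1 2 + comp_a0 m p X Y 3 1 2 - comp_aa m p X Y 3 1 2"
  "D (2,1) (2,1) = comp_00 m p X Y + comp_0a m p X Y 3 1 2 - comp_a0 m p X Y 3 1 2 - comp_aa m p X Y 3 1 2"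
  "D (2,2) (2,2) = comp_00 m p X Y - comp_0a m p X Y 3 1 2 - comp_a0 m p X Y 3 1 2 + comp_aa m p X Y 3 1 2"
  unfolding D triple_product_entries sum_2_2
  by (simp_all add: pauli_R_entries pauli_L_entries functional_simps comp_00_def comp_aa_def comp_0a_def comp_a0_def
      comp_bc_def comp_cb_def X Y algebra_simps del: One_nat_def)

lemma entries_antidiagonal:
  "D (1,1) (2,2) = comp_aa m p X Y 1 2 3 - \<i> * comp_bc m p X Y 3 1 2 - \<i> * comp_cb m p X Y 3 1 2 - comp_aa m p X Y 2 3 1"
  "D (1,2) (2,1) = comp_aa m p X Y 1 2 3 + \<i> * comp_bc m p X Y 3 1 2 - \<i> * comp_cb m p X Y 3 1 2 + comp_aa m p X Y 2 3 1"
  "D (2,1) (1,2) = comp_aa m p X Y 1 2 3 - \<i> * comp_bc m p X Y 3 1 2 + \<i> * comp_cb m p X Y 3 1 2 + comp_aa m p X Y 2 3 1"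
  "D (2,2) (1,1) = comp_aa m p X Y 1 2 3 + \<i> * comp_bc m p X Y 3 1 2 + \<i> * comp_cb m p X Y 3 1 2 - comp_aa m p X Y 2 3 1"
  unfolding D triple_product_entries sum_2_2
  by (simp_all add: pauli_R_entries pauli_L_entries functional_simps comp_00_def comp_aa_def comp_0a_def comp_a0_def
      comp_bc_def comp_cb_def X Y algebra_simps del: One_nat_def)

lemma entries_second_factor:
  "D (1,1) (1,2) = comp_0a m p X Y 1 2 3 - \<i> * comp_0a m p X Y 2 3 1 + comp_bc m p X Y 2 3 1 - \<i> * comp_cb m p X Y 1 2 3"
  "D (1,2) (1,1) = comp_0a m p X Y 1 2 3 + \<i> * comp_0a m p X Y 2 3 1 + comp_bc m p X Y 2 3 1 + \<i> * comp_cb m p X Y 1 2 3"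
  "D (2,1) (2,2) = comp_0a m p X Y 1 2 3 - \<i> * comp_0a m p X Y 2 3 1 - comp_bc m p X Y 2 3 1 + \<i> * comp_cb m p X Y 1 2 3"
  "D (2,2) (2,1) = comp_0a m p X Y 1 2 3 + \<i> * comp_0a m p X Y 2 3 1 - comp_bc m p X Y 2 3 1 - \<i> * comp_cb m p X Y 1 2 3"
  unfolding D triple_product_entries sum_2_2
  by (simp_all add: pauli_R_entries pauli_L_entries functional_simps comp_00_def comp_aa_def comp_0a_def comp_a0_def
      comp_bc_def comp_cb_def X Y algebra_simps del: One_nat_def)

lemma entries_first_factor:
  "D (1,1) (2,1) = comp_a0 m p X Y 1 2 3 - \<i> * comp_a0 m p X Y 2 3 1 + comp_cb m p X Y 2 3 1 - \<i> * comp_bc m p X Y 1 2 3"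
  "D (2,1) (1,1) = comp_a0 m p X Y 1 2 3 + \<i> * comp_a0 m p X Y 2 3 1 + comp_cb m p X Y 2 3 1 + \<i> * comp_bc m p X Y 1 2 3"
  "D (1,2) (2,2) = comp_a0 m p X Y 1 2 3 - \<i> * comp_a0 m p X Y 2 3 1 - comp_cb m p X Y 2 3 1 + \<i> * comp_bc m p X Y 1 2 3"
  "D (2,2) (1,2) = comp_a0 m p X Y 1 2 3 + \<i> * comp_a0 m p X Y 2 3 1 - comp_cb m p X Y 2 3 1 - \<i> * comp_bc m p X Y 1 2 3"
  unfolding D triple_product_entries sum_2_2
  by (simp_all add: pauli_R_entries pauli_L_entries functional_simps comp_00_def comp_aa_def comp_0a_def comp_a0_def
      comp_bc_def comp_cb_def X Y algebra_simps del: One_nat_def)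

lemma entries_vanish_iff: "(\<forall>r c. D r c = 0) \<longleftrightarrow> all_components_vanish m p X Y"
proof -
  have "(\<forall>r c. D r c = 0) \<longleftrightarrow>
    (D (1,1) (1,1) = 0 \<and> D (1,2) (1,2) = 0 \<and> D (2,1) (2,1) = 0 \<and> D (2,2) (2,2) = 0) \<and>
    (D (1,1) (2,2) = 0 \<and> D (1,2) (2,1) = 0 \<and> D (2,1) (1,2) = 0 \<and> D (2,2) (1,1) = 0) \<and>
    (D (1,1) (1,2) = 0 \<and> D (1,2) (1,1) = 0 \<and> D (2,1) (2,2) = 0 \<and> D (2,2) (2,1) = 0) \<and>
    (D (1,1) (2,1) = 0 \<and> D (2,1) (1,1) = 0 \<and> D (1,2) (2,2) = 0 \<and> D (2,2) (1,2) = 0)"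
    unfolding all_2_2 by blast
  also have "\<dots> \<longleftrightarrow> all_components_vanish m p X Y"
    unfolding entries_diagonal entries_antidiagonal entries_second_factor entries_first_factor
      pauli_combinations_eq_0_iff all_components_vanish_iff by blast
  finally show ?thesis .
qed

end

end

text \<open>
  With a variable \<open>j\<close> in place of \<open>\<i>\<close>, \<open>comp_bc\<close> and \<open>comp_cb\<close> become the same expression up to
  exchanging \<open>b\<close> and \<open>c\<close>, so one computation covers both.
\<close>

definition comp_bc_sign :: "complex \<Rightarrow> (nat \<Rightarrow> complex) \<Rightarrow> (nat \<Rightarrow> complex) \<Rightarrow> (nat \<Rightarrow> nat \<Rightarrow> complex) \<Rightarrow>
    (nat \<Rightarrow> nat \<Rightarrow> complex) \<Rightarrow> nat \<Rightarrow> nat \<Rightarrow> nat \<Rightarrow> complex" where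
  "comp_bc_sign j m p X Y a b c = (m 0 * p 0 - m a * p a + m b * p b - m c * p c) * (X b c - Y b c)
     - (m 0 * p a - m a * p 0 + m b * p c - m c * p b) * (X c b - Y c b)
     - j * (m 0 * p b - m a * p c + m b * p 0 - m c * p a) * (X 0 a + Y 0 a)
     - j * (m 0 * p c - m a * p b + m b * p a - m c * p 0) * (X a 0 + Y a 0)"

lemma comp_bc_eq: "comp_bc m p X Y a b c = comp_bc_sign \<i> m p X Y a b c"
  and comp_cb_eq: "comp_cb m p X Y a b c = comp_bc_sign (- \<i>) m p X Y a c b"
  by (simp_all add: comp_bc_def comp_cb_def comp_bc_sign_def algebra_simps)

text \<open>The relations under a functional, the second one multiplied by
  \<open>K\<^sub>\<gamma>\<close> and with \<open>\<rho>\<^sub>\<alpha> \<nu>\<^sub>\<alpha>\<close>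
  as one element. There (a, b, c) takes the place of (\<gamma>, \<alpha>, \<beta>), so that
  \<open>S\<^sub>a\<close> is paired with \<open>S\<^sub>0\<close> in both.\<close>

definition scalar_relations :: "(nat \<Rightarrow> complex) \<Rightarrow> (nat \<Rightarrow> nat \<Rightarrow> complex) \<Rightarrow> (nat \<Rightarrow> nat \<Rightarrow> complex) \<Rightarrow>
    (nat \<Rightarrow> nat \<Rightarrow> complex) \<Rightarrow> (nat \<Rightarrow> nat \<Rightarrow> complex) \<Rightarrow> bool" where
  "scalar_relations k SS SN NS NN \<longleftrightarrow>
    (\<forall>a\<in>{1..3}. \<forall>b\<in>{1..3}. NN a b = NN b a) \<and> (\<forall>a\<in>{1..3}. \<forall>b\<in>{0..3}. SN b a = NS a b) \<and>
    (\<forall>(a, b, c) \<in> {(1, 2, 3), (2, 3, 1), (3, 1, 2)}. \<i> * (SS 0 a + SS a 0) = SS b c - SS c b \<and>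
      k a * (SS a 0 - SS 0 a) = \<i> * (k c - k b) * (SS b c + SS c b) - 2 * \<i> * (NS b c - NS c b))"

text \<open>
  In the application \<open>x\<close>, \<open>xh\<close>, \<open>y\<close>, \<open>h\<close> are the values of \<open>f\<^sub>a\<close> at \<open>z\<close>, \<open>z + h\<close>, \<open>w\<close>, \<open>h\<close>, further
  \<open>P = \<wp>(w)\<close>, \<open>H = \<wp>(h)\<close>, \<open>G = G(z)\<close>, \<open>Gw = G(w)\<close>, and \<open>N a = \<rho>\<^sub>a \<nu>\<^sub>a\<close> in the values
  \<open>SN a b\<close>, \<open>NS a b\<close>, \<open>NN a b\<close> of a linear functional on the products of \<open>S a\<close>, \<open>N a\<close> with \<open>S b\<close>, \<open>N b\<close>.
\<close>

locale reflection_scalars =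
  fixes x xh y h K e g gw :: "nat \<Rightarrow> complex" and G Gw P H M :: complex
    and m p :: "nat \<Rightarrow> complex" and X Y SS SN NS NN :: "nat \<Rightarrow> nat \<Rightarrow> complex"
  assumes x_nz: "a \<in> {1..3} \<Longrightarrow> x a \<noteq> 0" and y_nz: "a \<in> {1..3} \<Longrightarrow> y a \<noteq> 0" and h_nz: "a \<in> {1..3} \<Longrightarrow> h a \<noteq> 0"
    and M_nz: "M \<noteq> 0" and PH: "P \<noteq> H"
    and y_sq: "a \<in> {1..3} \<Longrightarrow> y a * y a = P - e a" and h_sq: "a \<in> {1..3} \<Longrightarrow> h a * h a = H - e a"
    and K_eq': "triple a b c \<Longrightarrow> K a = - (h b * h c) / h a"
    and g_eq: "\<And>a. g a = G + K a" and gw_eq: "\<And>a. gw a = Gw + K a"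
    and xh_eq: "a \<in> {1..3} \<Longrightarrow> x a * xh a = h a * g a"
    and Gw_eq: "Gw * (P - H) = y 1 * y 2 * y 3 - h 1 * h 2 * h 3"
    and m0: "m 0 = 1" and p0: "p 0 = 1"
    and coeff_sum: "triple a b c \<Longrightarrow> p a + m a + (m b * p c + m c * p b) = M * (x a * y b * y c)"
    and coeff_diff: "triple a b c \<Longrightarrow> p a + m a - (m b * p c + m c * p b) = M * (xh a * y b * y c)"
    and coeff_skew: "triple a b c \<Longrightarrow> p a - m a + (m b * p c - m c * p b) = - M * (y a * xh b * x c)"
    and coeff_diag: "triple a b c \<Longrightarrow> 1 + m a * p a - m b * p b - m c * p c = M * (h a * (P + H - e b - e c + K a * G))"
    and coeff_trace: "1 + m 1 * p 1 + m 2 * p 2 + m 3 * p 3 = M * (h 1 * h 2 * h 3 + G * (P - H))"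
    and X00: "X 0 0 = SS 0 0" and Y00: "Y 0 0 = SS 0 0"
    and X0a: "a \<in> {1..3} \<Longrightarrow> X 0 a = (gw a * SS 0 a + SN 0 a) / y a"
    and Y0a: "a \<in> {1..3} \<Longrightarrow> Y 0 a = (gw a * SS a 0 + NS a 0) / y a"
    and Xa0: "a \<in> {1..3} \<Longrightarrow> X a 0 = (g a * SS a 0 + NS a 0) / x a"
    and Ya0: "a \<in> {1..3} \<Longrightarrow> Y a 0 = (g a * SS 0 a + SN 0 a) / x a"
    and Xab: "a \<in> {1..3} \<Longrightarrow> b \<in> {1..3} \<Longrightarrow>
        X a b = (g a * gw b * SS a b + g a * SN a b + gw b * NS a b + NN a b) / (x a * y b)"
    and Yab: "a \<in> {1..3} \<Longrightarrow> b \<in> {1..3} \<Longrightarrow>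
        Y a b = (g a * gw b * SS b a + g a * NS b a + gw b * SN b a + NN b a) / (x a * y b)"
begin

context
  fixes a b c :: nat
  assumes t: "triple a b c"
begin

lemma prod_123: "f 1 * f 2 * f 3 = f a * f b * (f c :: complex)"
  using t unfolding triple_cases by (elim insertE emptyE) (simp_all add: mult_ac)

lemma trace_abc: "1 + m a * p a + m b * p b + m c * p c = M * (h a * h b * h c + G * (P - H))"
proof -
  have "m a * p a + m b * p b + m c * p c = m 1 * p 1 + m 2 * p 2 + m 3 * p 3"
    using t unfolding triple_cases by (elim insertE emptyE) (simp_all add: add_ac)
  then show ?thesis
    using coeff_trace unfolding prod_123[of h] by (simp only: add.assoc)
qed

lemma Gw_abc: "Gw * (P - H) = y a * y b * y c - h a * h b * h c"
  using Gw_eq unfolding prod_123[of y] prod_123[of h] .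

lemma K_h: "K a * (h a * h a) = - (h a * h b * h c)" "K b * K c = h a * h a"
proof -
  note set = tripleD[OF t]
  show "K a * (h a * h a) = - (h a * h b * h c)"
    unfolding K_eq'[OF t] using h_nz[OF set(1)] by (simp add: field_simps)
  have Kbc: "K b = - (h c * h a) / h b" "K c = - (h a * h b) / h c"
    using K_eq'[OF triple_perms(1)[OF t]] K_eq'[OF triple_perms(2)[OF t]] by auto
  show "K b * K c = h a * h a"
    unfolding Kbc using h_nz[OF set(2)] h_nz[OF set(3)] by (simp add: field_simps)
qed

text \<open>The last factor is the bracket of \<open>coeff_diag\<close> with Gw in place of G. The
  two therefore cancel in the components up to a multiple of \<open>G - Gw\<close>.\<close>

lemma y_prod_gw: "y a * y b * y c * gw a = (P - e a) * (P + H - e b - e c + K a * Gw)"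
proof -
  note set = tripleD[OF t]
  have 1: "K a * (h a * h b * h c) = - ((H - e b) * (H - e c))"
  proof -
    have "K a * (h a * h b * h c) = - ((h b * h b) * (h c * h c))"
      unfolding K_eq'[OF t] using h_nz[OF set(1)] by (simp add: field_simps)
    then show ?thesis unfolding h_sq[OF set(2)] h_sq[OF set(3)] .
  qed
  have 2: "K a * (H - e a) = - (h a * h b * h c)" using K_h(1) unfolding h_sq[OF set(1)] .
  have 3: "(y a * y b * y c) * (y a * y b * y c) = (P - e a) * (P - e b) * (P - e c)"
    unfolding y_sq[OF set(1), symmetric] y_sq[OF set(2), symmetric] y_sq[OF set(3), symmetric] by simp
  \<comment> \<open>\<open>Gw_abc\<close> describes Gw after multiplication by \<open>P - H\<close>,
    so this factor is put in and cancelled afterwards.\<close>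
  have "(P - H) * (y a * y b * y c * gw a) = (P - H) * ((P - e a) * (P + H - e b - e c + K a * Gw))"
    using 1 2 3 Gw_abc unfolding gw_eq by algebra
  then show ?thesis using PH by simp
qed

text \<open>The factor \<open>G - Gw\<close> comes out of all terms:
  \<open>g b * gw c - g c * gw b\<close> is \<open>(G - Gw) * (K c - K b)\<close>,
  \<open>Gw_abc\<close> handles the product of the y, and the \<open>NN\<close> terms cancel. What
  remains is the second relation with weight \<open>P - e a\<close> and the commutator of
  \<open>S\<^sub>0\<close> and \<open>N\<^sub>a\<close> with weight \<open>P - H\<close>.\<close>

lemma comp_0a_eq:
  "y a * comp_0a m p X Y a b c = M * (G - Gw) *
    ((P - e a) * (K a * (SS 0 a - SS a 0) + \<i> * ((K c - K b) * (SS b c + SS c b) + (SN b c + NS c b) - (SN c b + NS b c)))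
     + (P - H) * (SN 0 a - NS a 0))"
proof -
  note set = tripleD[OF t]
  have c1: "m 0 * p 0 + m a * p a + m b * p b + m c * p c = M * (h a * h b * h c + G * (P - H))"
    "m 0 * p a + m a * p 0 + m b * p c + m c * p b = M * (x a * y b * y c)"
    "m 0 * p b + m b * p 0 + m a * p c + m c * p a = M * (x b * y c * y a)"
    "m 0 * p c + m c * p 0 + m a * p b + m b * p a = M * (x c * y a * y b)"
    using trace_abc coeff_sum[OF t] coeff_sum[OF triple_perms(1)[OF t]] coeff_sum[OF triple_perms(2)[OF t]]
    by (simp_all add: m0 p0 algebra_simps)
  note nz = x_nz[OF set(1)] x_nz[OF set(2)] x_nz[OF set(3)] y_nz[OF set(1)] y_nz[OF set(2)] y_nz[OF set(3)]
  define c0 n0 s u v nn where "c0 = SS 0 a - SS a 0" and "n0 = SN 0 a - NS a 0" and "s = SS b c + SS c b"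
    and "u = SN b c + NS c b" and "v = SN c b + NS b c" and "nn = NN b c + NN c b"
  note defs = c0_def n0_def s_def u_def v_def nn_def
  have t1: "y a * (X 0 a - Y 0 a) = gw a * c0 + n0"
    unfolding X0a[OF set(1)] Y0a[OF set(1)] using nz by (simp add: defs field_simps)
  have t2: "x a * (X a 0 - Y a 0) = - (g a * c0 + n0)"
    unfolding Xa0[OF set(1)] Ya0[OF set(1)] using nz by (simp add: defs field_simps)
  have t3: "x b * y c * (X b c + Y b c) = g b * gw c * s + g b * u + gw c * v + nn"
    unfolding Xab[OF set(2,3)] Yab[OF set(2,3)] using nz by (simp add: defs field_simps)
  have t4: "x c * y b * (X c b + Y c b) = g c * gw b * s + g c * v + gw b * u + nn"
    unfolding Xab[OF set(3,2)] Yab[OF set(3,2)] using nz by (simp add: defs field_simps)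
  have "y a * comp_0a m p X Y a b c = M * ((h a * h b * h c + G * (P - H)) * (y a * (X 0 a - Y 0 a))
     + y a * y b * y c * (x a * (X a 0 - Y a 0))
     + \<i> * (y a * y a) * (x b * y c * (X b c + Y b c)) - \<i> * (y a * y a) * (x c * y b * (X c b + Y c b)))"
    unfolding comp_0a_def c1 by (simp add: algebra_simps)
  also have "\<dots> = M * ((h a * h b * h c + G * (P - H)) * (gw a * c0 + n0) - y a * y b * y c * (g a * c0 + n0)
     + \<i> * (P - e a) * ((g b * gw c * s + g b * u + gw c * v + nn) - (g c * gw b * s + g c * v + gw b * u + nn)))"
    unfolding t1 t2 t3 t4 y_sq[OF set(1)] by (simp add: algebra_simps)
  also have "\<dots> = M * (G - Gw) * ((P - e a) * (K a * c0 + \<i> * ((K c - K b) * s + u - v)) + (P - H) * n0)"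
  proof -
    have y3: "y a * y b * y c = Gw * (P - H) + h a * h b * h c" using Gw_abc by simp
    have h3: "h a * h b * h c = - (K a * (H - e a))" using K_h(1) unfolding h_sq[OF set(1)] by simp
    show ?thesis unfolding y3 h3 g_eq gw_eq by (simp add: algebra_simps)
  qed
  finally show ?thesis unfolding defs by (simp add: algebra_simps)
qed

text \<open>Once \<open>S\<^sub>0\<close> and \<open>N\<^sub>a\<close> commute, this component is a
  multiple of the combination found in \<open>comp_0a_eq\<close>.\<close>

lemma comp_a0_eq_0:
  assumes n0: "SN 0 a = NS a 0"
    and rel: "K a * (SS 0 a - SS a 0) + \<i> * ((K c - K b) * (SS b c + SS c b) + (SN b c + NS c b) - (SN c b + NS b c)) = 0"
  shows "comp_a0 m p X Y a b c = 0"
proof -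
  note set = tripleD[OF t]
  have c1: "m 0 * p 0 + m a * p a - m b * p b - m c * p c = M * (h a * (P + H - e b - e c + K a * G))"
    "m 0 * p a + m a * p 0 - m b * p c - m c * p b = M * (xh a * y b * y c)"
    "m 0 * p b + m a * p c - m b * p 0 - m c * p a = - M * (y b * xh a * x c)"
    "m 0 * p c + m a * p b - m b * p a - m c * p 0 = - M * (y c * xh a * x b)"
    using coeff_diag[OF t] coeff_diff[OF t] coeff_skew[OF triple_perms(4)[OF t]] coeff_skew[OF triple_perms(2)[OF t]]
    by (simp_all add: m0 p0 algebra_simps)
  note nz = x_nz[OF set(1)] x_nz[OF set(2)] x_nz[OF set(3)] y_nz[OF set(1)] y_nz[OF set(2)] y_nz[OF set(3)]
  define c0 s u v nn where "c0 = SS 0 a - SS a 0" and "s = SS b c + SS c b"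
    and "u = SN b c + NS c b" and "v = SN c b + NS b c" and "nn = NN b c + NN c b"
  note defs = c0_def s_def u_def v_def nn_def
  have rel': "K a * c0 + \<i> * ((K c - K b) * s + u - v) = 0" using rel by (simp add: defs algebra_simps)
  have t1: "y a * (X 0 a - Y 0 a) = gw a * c0"
    unfolding X0a[OF set(1)] Y0a[OF set(1)] n0 using nz by (simp add: defs field_simps)
  have t2: "x a * (X a 0 - Y a 0) = - (g a * c0)"
    unfolding Xa0[OF set(1)] Ya0[OF set(1)] n0 using nz by (simp add: defs field_simps)
  have t3: "x b * y c * (X b c + Y b c) = g b * gw c * s + g b * u + gw c * v + nn"
    unfolding Xab[OF set(2,3)] Yab[OF set(2,3)] using nz by (simp add: defs field_simps)
  have t4: "x c * y b * (X c b + Y c b) = g c * gw b * s + g c * v + gw b * u + nn"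
    unfolding Xab[OF set(3,2)] Yab[OF set(3,2)] using nz by (simp add: defs field_simps)
  have "x a * (y a * y a) * comp_a0 m p X Y a b c = M * (h a * (P + H - e b - e c + K a * G) * (y a * y a) * (x a * (X a 0 - Y a 0))
     + (x a * xh a) * (y a * y b * y c) * (y a * (X 0 a - Y 0 a))
     + \<i> * (x a * xh a) * (y a * y a) * (x c * y b * (X c b + Y c b)) - \<i> * (x a * xh a) * (y a * y a) * (x b * y c * (X b c + Y b c)))"
    unfolding comp_a0_def c1 by (simp add: algebra_simps)
  also have "\<dots> = M * h a * g a * ((y a * y b * y c * gw a - (P - e a) * (P + H - e b - e c + K a * G)) * c0
     - \<i> * (P - e a) * (G - Gw) * ((K c - K b) * s + u - v))"
    unfolding t1 t2 t3 t4 y_sq[OF set(1)] xh_eq[OF set(1)]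
    unfolding g_eq[of b] g_eq[of c] gw_eq[of b] gw_eq[of c] by (simp add: algebra_simps)
  also have "\<dots> = - M * h a * g a * (P - e a) * (G - Gw) * (K a * c0 + \<i> * ((K c - K b) * s + u - v))"
    unfolding y_prod_gw by (simp add: algebra_simps)
  also have "\<dots> = 0" unfolding rel' by simp
  finally show ?thesis using nz by simp
qed

end

context
  fixes a b c :: nat
  assumes t: "triple a b c"
begin

text \<open>All commutators are kept, because the identity serves twice: for sufficiency those with
  N are set to 0, for necessity it is read as a polynomial in G.\<close>

lemma comp_bc_sign_eq:
  "x b * y c * (P - e b) * comp_bc_sign j m p X Y a b c = M * h b *
    ((y a * y b * y c * gw b + K b * (P - e b) * (G - Gw)) *
        (g b * gw c * (SS b c - SS c b) + g b * (SN b c - NS c b) + gw c * (NS b c - SN c b) + (NN b c - NN c b))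
     - y a * y b * y c * g b *
        (g c * gw b * (SS b c - SS c b) + g c * (NS b c - SN c b) + gw b * (SN b c - NS c b) + (NN b c - NN c b))
     + j * g b * (P - e b) * (P - e c) * (G - Gw) * (SS 0 a + SS a 0))"
proof -
  note set = tripleD[OF t]
  have c1: "m 0 * p 0 - m a * p a + m b * p b - m c * p c = M * (h b * (P + H - e c - e a + K b * G))"
    "m 0 * p a - m a * p 0 + m b * p c - m c * p b = - M * (y a * xh b * x c)"
    "m 0 * p b - m a * p c + m b * p 0 - m c * p a = M * (xh b * y c * y a)"
    "m 0 * p c - m a * p b + m b * p a - m c * p 0 = - M * (y c * xh b * x a)"
    using coeff_diag[OF triple_perms(1)[OF t]] coeff_diff[OF triple_perms(1)[OF t]] coeff_skew[OF t] coeff_skew[OF triple_perms(5)[OF t]]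
    by (simp_all add: m0 p0 algebra_simps)
  note nz = x_nz[OF set(1)] x_nz[OF set(2)] x_nz[OF set(3)] y_nz[OF set(1)] y_nz[OF set(2)] y_nz[OF set(3)]
  define k p1 p2 nn s0 w0 where "k = SS b c - SS c b" and "p1 = SN b c - NS c b" and "p2 = NS b c - SN c b"
    and "nn = NN b c - NN c b" and "s0 = SS 0 a + SS a 0" and "w0 = SN 0 a + NS a 0"
  note defs = k_def p1_def p2_def nn_def s0_def w0_def
  define Z1 Z2 where "Z1 = g b * gw c * k + g b * p1 + gw c * p2 + nn" and "Z2 = g c * gw b * k + g c * p2 + gw b * p1 + nn"
  have t1: "y a * (X 0 a + Y 0 a) = gw a * s0 + w0"
    unfolding X0a[OF set(1)] Y0a[OF set(1)] using nz by (simp add: defs field_simps)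
  have t2: "x a * (X a 0 + Y a 0) = g a * s0 + w0"
    unfolding Xa0[OF set(1)] Ya0[OF set(1)] using nz by (simp add: defs field_simps)
  have t3: "x b * y c * (X b c - Y b c) = Z1"
    unfolding Xab[OF set(2,3)] Yab[OF set(2,3)] Z1_def using nz by (simp add: defs field_simps)
  have t4: "x c * y b * (X c b - Y c b) = - Z2"
    unfolding Xab[OF set(3,2)] Yab[OF set(3,2)] Z2_def using nz by (simp add: defs field_simps)
  have gw: "y a * y b * y c * gw b = (P - e b) * (P + H - e c - e a + K b * Gw)"
    using y_prod_gw[OF triple_rot[OF t]] by (simp add: mult_ac)
  have "x b * y c * (P - e b) * comp_bc_sign j m p X Y a b c = x b * y c * (y b * y b) * comp_bc_sign j m p X Y a b c"
    unfolding y_sq[OF set(2)] ..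
  also have "\<dots> = M * ((h b * (P + H - e c - e a + K b * G)) * (y b * y b) * (x b * y c * (X b c - Y b c))
     + (x b * xh b) * (y a * y b * y c) * (x c * y b * (X c b - Y c b))
     - j * (x b * xh b) * (y b * y b) * (y c * y c) * (y a * (X 0 a + Y 0 a))
     + j * (x b * xh b) * (y b * y b) * (y c * y c) * (x a * (X a 0 + Y a 0)))"
    unfolding comp_bc_sign_def c1 by (simp add: algebra_simps)
  also have "\<dots> = M * h b * (((P - e b) * (P + H - e c - e a + K b * Gw) + K b * (P - e b) * (G - Gw)) * Z1
     - y a * y b * y c * g b * Z2 + j * g b * (P - e b) * (P - e c) * (G - Gw) * s0)"
    unfolding t1 t2 t3 t4 y_sq[OF set(2)] y_sq[OF set(3)] xh_eq[OF set(2)]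
    unfolding g_eq[of a] gw_eq[of a] by (simp add: algebra_simps)
  finally show ?thesis unfolding gw[symmetric] Z1_def Z2_def defs .
qed

text \<open>A form of \<open>y_prod_gw\<close> in which \<open>K b * K c = h a * h a\<close> brings
  in \<open>gw c\<close>, to match the terms of \<open>comp_bc_sign_eq\<close>.\<close>

lemma y_prod_gw_bc: "y a * y b * y c * gw b = (P - e b) * (K b * gw c + (P - e c))"
proof -
  note set = tripleD[OF t]
  have "y a * y b * y c * gw b = (P - e b) * (P + H - e c - e a + K b * Gw)"
    using y_prod_gw[OF triple_rot[OF t]] by (simp add: mult_ac)
  moreover have "K b * K c = H - e a" using K_h(2)[OF t] unfolding h_sq[OF set(1)] .
  ultimately show ?thesis unfolding gw_eq by algebra
qed

lemma comp_bc_sign_eq_0: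
  assumes "SN b c = NS c b" "SN c b = NS b c" "NN b c = NN c b"
    and rel: "SS b c - SS c b = j * (SS 0 a + SS a 0)"
  shows "comp_bc_sign j m p X Y a b c = 0"
proof -
  note set = tripleD[OF t]
  have "x b * y c * (P - e b) * comp_bc_sign j m p X Y a b c = M * h b * g b * (SS b c - SS c b) *
     ((y a * y b * y c * gw b + K b * (P - e b) * (G - Gw)) * gw c - y a * y b * y c * gw b * g c
       + (P - e b) * (P - e c) * (G - Gw))"
    unfolding comp_bc_sign_eq rel assms(1-3) by (simp add: algebra_simps)
  also have "\<dots> = 0"
    unfolding y_prod_gw_bc g_eq[of c] gw_eq[of c] by (simp add: algebra_simps)
  finally show ?thesis
    using x_nz[OF set(2)] y_nz[OF set(3)] y_nz[OF set(2)] y_sq[OF set(2)] by auto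
qed

lemma comp_aa_eq_0:
  assumes "\<And>i. i \<in> {1..3} \<Longrightarrow> SN i i = NS i i"
  shows "comp_aa m p X Y a b c = 0"
proof -
  note set = tripleD[OF t]
  have "X i i - Y i i = 0" if "i \<in> {1..3}" for i
    unfolding Xab[OF that that] Yab[OF that that] assms[OF that] by simp
  then show ?thesis
    using set by (simp add: comp_aa_def X00 Y00)
qed

end

text \<open>In \<open>X i i - Y i i\<close> the \<open>SS\<close> and \<open>NN\<close> terms cancel
  and leave \<open>G - Gw\<close> times the commutator of \<open>S\<^sub>i\<close> and
  \<open>N\<^sub>i\<close>. The three quadratic weights in P are chosen by the y-products and
  isolate one commutator each at P = \<open>e\<^sub>i\<close>.\<close>

lemma comp_00_eq:
  "(y 1 * y 2 * y 3) * comp_00 m p X Y = M * (G - Gw) *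
     ((P - e 2) * (P - e 3) * (SN 1 1 - NS 1 1) + (P - e 3) * (P - e 1) * (SN 2 2 - NS 2 2)
       + (P - e 1) * (P - e 2) * (SN 3 3 - NS 3 3))"
proof -
  have c1: "m 0 * p a + m a * p 0 + m b * p c + m c * p b = M * (x a * y b * y c)"
    if "triple a b c" for a b c
    using coeff_sum[OF that] by (simp add: m0 p0 algebra_simps)
  have t: "x i * y i * (X i i - Y i i) = (G - Gw) * (SN i i - NS i i)" if "i \<in> {1..3}" for i
    unfolding Xab[OF that that] Yab[OF that that] using x_nz[OF that] y_nz[OF that]
    by (simp add: g_eq gw_eq field_simps)
  have c123: "m 0 * p 1 + m 1 * p 0 + m 2 * p 3 + m 3 * p 2 = M * (x 1 * y 2 * y 3)"
    "m 0 * p 2 + m 2 * p 0 + m 3 * p 1 + m 1 * p 3 = M * (x 2 * y 3 * y 1)"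
    "m 0 * p 3 + m 3 * p 0 + m 1 * p 2 + m 2 * p 1 = M * (x 3 * y 1 * y 2)"
    using c1[OF triple_123(1)] c1[OF triple_123(2)] c1[OF triple_123(3)] by simp_all
  have "(y 1 * y 2 * y 3) * comp_00 m p X Y = M * ((y 2 * y 2) * (y 3 * y 3) * (x 1 * y 1 * (X 1 1 - Y 1 1))
      + (y 3 * y 3) * (y 1 * y 1) * (x 2 * y 2 * (X 2 2 - Y 2 2)) + (y 1 * y 1) * (y 2 * y 2) * (x 3 * y 3 * (X 3 3 - Y 3 3)))"
    unfolding comp_00_def c123 X00 Y00 by (simp add: algebra_simps)
  also have "\<dots> = M * ((P - e 2) * (P - e 3) * ((G - Gw) * (SN 1 1 - NS 1 1)) + (P - e 3) * (P - e 1) * ((G - Gw) * (SN 2 2 - NS 2 2))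
      + (P - e 1) * (P - e 2) * ((G - Gw) * (SN 3 3 - NS 3 3)))"
  proof -
    have i: "1 \<in> {1..3::nat}" "2 \<in> {1..3::nat}" "3 \<in> {1..3::nat}" by auto
    show ?thesis unfolding t[OF i(1)] t[OF i(2)] t[OF i(3)] y_sq[OF i(1)] y_sq[OF i(2)] y_sq[OF i(3)] ..
  qed
  finally show ?thesis by (simp add: algebra_simps)
qed

lemma all_components_vanish_if_relations:
  assumes rels: "scalar_relations K SS SN NS NN"
  shows "all_components_vanish m p X Y"
proof -
  have NN: "NN a b = NN b a" if "a \<in> {1..3}" "b \<in> {1..3}" for a b using rels that by (auto simp: scalar_relations_def)
  have SN: "SN b a = NS a b" if "a \<in> {1..3}" "b \<in> {0..3}" for a b using rels that by (auto simp: scalar_relations_def)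
  have "SN 1 1 = NS 1 1" "SN 2 2 = NS 2 2" "SN 3 3 = NS 3 3" using SN by simp_all
  then have "(y 1 * y 2 * y 3) * comp_00 m p X Y = 0" unfolding comp_00_eq by simp
  then have 0: "comp_00 m p X Y = 0" using y_nz[of 1] y_nz[of 2] y_nz[of 3] by simp
  have "comp_aa m p X Y a b c = 0 \<and> comp_0a m p X Y a b c = 0 \<and> comp_a0 m p X Y a b c = 0 \<and>
      comp_bc m p X Y a b c = 0 \<and> comp_cb m p X Y a b c = 0"
    if abc: "(a, b, c) \<in> {(1, 2, 3), (2, 3, 1), (3, 1, 2)}" for a b c
  proof -
    have t: "triple a b c"
      using abc triple_123 by blast
    note set = tripleD[OF t]
    have set0: "a \<in> {0..3}" "b \<in> {0..3}" "c \<in> {0..3}" using set by auto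
    have rel: "\<i> * (SS 0 a + SS a 0) = SS b c - SS c b"
      "K a * (SS a 0 - SS 0 a) = \<i> * (K c - K b) * (SS b c + SS c b) - 2 * \<i> * (NS b c - NS c b)"
      using rels abc unfolding scalar_relations_def by auto
    have n0: "SN 0 a = NS a 0" using SN[OF set(1), of 0] by simp
    have rel': "K a * (SS 0 a - SS a 0) + \<i> * ((K c - K b) * (SS b c + SS c b) + (SN b c + NS c b) - (SN c b + NS b c)) = 0"
      using rel(2) unfolding SN[OF set(3) set0(2)] SN[OF set(2) set0(3)] by (simp add: algebra_simps)
    have "y a * comp_0a m p X Y a b c = 0"
      unfolding comp_0a_eq[OF t] rel' n0 by simp
    then have "comp_0a m p X Y a b c = 0" using y_nz[OF set(1)] by simp
    moreover have "comp_a0 m p X Y a b c = 0" by (rule comp_a0_eq_0[OF t n0 rel'])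
    moreover have "comp_aa m p X Y a b c = 0"
      by (rule comp_aa_eq_0[OF t]) (use SN in simp)
    moreover have "comp_bc m p X Y a b c = 0"
      unfolding comp_bc_eq
      by (rule comp_bc_sign_eq_0[OF t]) (use SN set set0 NN rel(1) in simp_all)
    moreover have "comp_cb m p X Y a b c = 0"
      unfolding comp_cb_eq
    proof (rule comp_bc_sign_eq_0[OF triple_swap[OF t]])
      show "SS c b - SS b c = - \<i> * (SS 0 a + SS a 0)"
        using rel(1) by (metis minus_diff_eq minus_mult_left)
    qed (use SN set set0 NN in simp_all)
    ultimately show ?thesis by blast
  qed
  then show ?thesis
    using 0 unfolding all_components_vanish_def by blast
qed

end

section \<open>Sufficiency and necessity of the relations\<close>

lemma quadratic_vanishing_at_infinity:
  fixes a b c :: complex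
  assumes f: "filterlim f at_infinity F" and F: "F \<noteq> bot"
    and ev: "eventually (\<lambda>x. a + b * f x + c * (f x * f x) = 0) F"
  shows "a = 0" "b = 0" "c = 0"
proof -
  have nz: "eventually (\<lambda>x. f x \<noteq> 0) F"
    by (rule filterlim_at_infinity_imp_eventually_ne[OF f])
  have inv: "((\<lambda>x. inverse (f x)) \<longlongrightarrow> 0) F"
    using filterlim_compose[OF tendsto_inverse_0 f] .
  have limit_0: "l = 0" if "(g \<longlongrightarrow> l) F" "eventually (\<lambda>x. g x = 0) F" for g :: "_ \<Rightarrow> complex" and l
    using tendsto_unique[OF F that(1) tendsto_eventually[OF that(2)]] .
  have "((\<lambda>x. a * inverse (f x) * inverse (f x) + b * inverse (f x) + c) \<longlongrightarrow> a * 0 * 0 + b * 0 + c) F"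
    by (intro tendsto_intros inv)
  moreover have "eventually (\<lambda>x. a * inverse (f x) * inverse (f x) + b * inverse (f x) + c = 0) F"
    using ev nz by eventually_elim (simp add: field_simps)
  ultimately have "a * 0 * 0 + b * 0 + c = 0" by (rule limit_0)
  then show c: "c = 0" by simp
  have "((\<lambda>x. a * inverse (f x) + b) \<longlongrightarrow> a * 0 + b) F"
    by (intro tendsto_intros inv)
  moreover have "eventually (\<lambda>x. a * inverse (f x) + b = 0) F"
    using ev nz by eventually_elim (simp add: c field_simps)
  ultimately have "a * 0 + b = 0" by (rule limit_0)
  then show b: "b = 0" by simp
  show "a = 0"
    using eventually_happens'[OF F ev] by (simp add: b c)
qed

lemma all_components_vanish_scale:
  assumes "\<And>a. a \<le> 3 \<Longrightarrow> m a = k * m' a" "\<And>a. a \<le> 3 \<Longrightarrow> p a = k' * p' a"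
    and "\<And>a b. a \<le> 3 \<Longrightarrow> b \<le> 3 \<Longrightarrow> X a b = s * X' a b" "\<And>a b. a \<le> 3 \<Longrightarrow> b \<le> 3 \<Longrightarrow> Y a b = s * Y' a b"
    and nz: "k \<noteq> 0" "k' \<noteq> 0" "s \<noteq> 0"
  shows "all_components_vanish m p X Y \<longleftrightarrow> all_components_vanish m' p' X' Y'"
proof -
  have "comp_00 m p X Y = (k * k' * s) * comp_00 m' p' X' Y'"
    unfolding comp_00_def by (simp add: assms algebra_simps)
  moreover have "comp_aa m p X Y a b c = (k * k' * s) * comp_aa m' p' X' Y' a b c"
    "comp_0a m p X Y a b c = (k * k' * s) * comp_0a m' p' X' Y' a b c"
    "comp_a0 m p X Y a b c = (k * k' * s) * comp_a0 m' p' X' Y' a b c"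
    "comp_bc m p X Y a b c = (k * k' * s) * comp_bc m' p' X' Y' a b c"
    "comp_cb m p X Y a b c = (k * k' * s) * comp_cb m' p' X' Y' a b c" if "a \<le> 3" "b \<le> 3" "c \<le> 3" for a b c
    unfolding comp_aa_def comp_0a_def comp_a0_def comp_bc_def comp_cb_def by (simp_all add: assms that algebra_simps)
  ultimately show ?thesis
    unfolding all_components_vanish_iff using nz by simp
qed

lemma all_components_vanish_continuous:
  fixes m p :: "complex \<Rightarrow> nat \<Rightarrow> complex" and X Y :: "complex \<Rightarrow> nat \<Rightarrow> nat \<Rightarrow> complex"
  assumes cont: "\<And>a. isCont (\<lambda>t. m t a) 0" "\<And>a. isCont (\<lambda>t. p t a) 0"
      "\<And>a b. a \<le> 3 \<Longrightarrow> b \<le> 3 \<Longrightarrow> isCont (\<lambda>t. X t a b) 0" "\<And>a b. a \<le> 3 \<Longrightarrow> b \<le> 3 \<Longrightarrow> isCont (\<lambda>t. Y t a b) 0"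
    and ev: "eventually (\<lambda>t. all_components_vanish (m t) (p t) (X t) (Y t)) (at 0)"
  shows "all_components_vanish (m 0) (p 0) (X 0) (Y 0)"
proof -
  have limit_0: "f 0 = 0" if "isCont f 0" "eventually (\<lambda>t. f t = 0) (at 0)" for f :: "complex \<Rightarrow> complex"
    using tendsto_unique[OF at_neq_bot that(1)[unfolded isCont_def] tendsto_eventually[OF that(2)]] .
  have "comp_00 (m 0) (p 0) (X 0) (Y 0) = 0"
    by (rule limit_0[of "\<lambda>t. comp_00 (m t) (p t) (X t) (Y t)"])
      (use ev in \<open>auto simp: comp_00_def all_components_vanish_iff elim!: eventually_mono intro!: continuous_intros cont\<close>)
  moreover have "C (m 0) (p 0) (X 0) (Y 0) a b c = 0"
    if abc: "(a, b, c) \<in> {(1, 2, 3), (2, 3, 1), (3, 1, 2)}" and C: "C \<in> {comp_aa, comp_0a, comp_a0, comp_bc, comp_cb}" for a b c C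
  proof (rule limit_0[of "\<lambda>t. C (m t) (p t) (X t) (Y t) a b c"])
    have le: "a \<le> 3" "b \<le> 3" "c \<le> 3" using abc by auto
    show "isCont (\<lambda>t. C (m t) (p t) (X t) (Y t) a b c) 0"
      using C unfolding insert_iff empty_iff
      by (elim disjE) (simp_all add: comp_aa_def comp_0a_def comp_a0_def comp_bc_def comp_cb_def continuous_intros cont le)
    show "eventually (\<lambda>t. C (m t) (p t) (X t) (Y t) a b c = 0) (at 0)"
      using ev by (rule eventually_mono) (use abc C in \<open>auto simp: all_components_vanish_def\<close>)
  qed
  ultimately show ?thesis
    unfolding all_components_vanish_def by blast
qed

context spectral_parameter
begin

text \<open>The quantifiers follow the order of the later limits: w is fixed first, and how close z
  has to be to 0 depends on w.\<close>

lemma eventually_generic: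
  "eventually (\<lambda>w. eventually (\<lambda>z. generic \<tau> \<eta> z w) (at 0)) (at 0)"
proof -
  have "eventually (\<lambda>w. 2 * w \<notin> lattice \<tau> \<and> w + \<eta> \<notin> lattice \<tau> \<and> w + 2 * \<eta> \<notin> lattice \<tau> \<and> w - 2 * \<eta> \<notin> lattice \<tau>) (at 0)"
    using notin_lattice_nearby[of 2 0] notin_lattice_nearby[of 1 \<eta>]
      notin_lattice_nearby[of 1 "2 * \<eta>"] notin_lattice_nearby[of 1 "- 2 * \<eta>"]
    by (auto simp: add.commute elim: eventually_elim2 intro!: eventually_conj)
  then show ?thesis
  proof eventually_elim
    case (elim w)
    have "eventually (\<lambda>z. (0 + 2 * z \<notin> lattice \<tau> \<and> \<eta> + 1 * z \<notin> lattice \<tau> \<and> 2 * \<eta> + 1 * z \<notin> lattice \<tau>) \<and>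
        ((\<eta> + w) + 1 * z \<notin> lattice \<tau> \<and> (\<eta> - w) + 1 * z \<notin> lattice \<tau> \<and> - w + 1 * z \<notin> lattice \<tau> \<and> w + 1 * z \<notin> lattice \<tau>)) (at 0)"
      by (intro eventually_conj notin_lattice_nearby) simp_all
    then show ?case
      by (rule eventually_mono) (use elim in \<open>simp add: generic_def algebra_simps\<close>)
  qed
qed

text \<open>The speeds \<open>1\<close> and \<open>2\<close> differ, so that also \<open>z - w\<close> and \<open>z + w\<close> move.\<close>

lemma eventually_generic_perturbation:
  "eventually (\<lambda>t. generic \<tau> \<eta> (z + t) (w + 2 * t)) (at 0)"
proof -
  have "eventually (\<lambda>t. 2 * z + 2 * t \<notin> lattice \<tau> \<and> 2 * w + 4 * t \<notin> lattice \<tau> \<and> (z + \<eta>) + 1 * t \<notin> lattice \<tau> \<and>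
      (w + \<eta>) + 2 * t \<notin> lattice \<tau> \<and> (z + 2 * \<eta>) + 1 * t \<notin> lattice \<tau> \<and> (w + 2 * \<eta>) + 2 * t \<notin> lattice \<tau> \<and>
      (z + \<eta> + w) + 3 * t \<notin> lattice \<tau> \<and> (z + \<eta> - w) + (- 1) * t \<notin> lattice \<tau> \<and> (z - w) + (- 1) * t \<notin> lattice \<tau> \<and>
      (z + w) + 3 * t \<notin> lattice \<tau> \<and> (w - 2 * \<eta>) + 2 * t \<notin> lattice \<tau>) (at 0)"
    by (intro eventually_conj notin_lattice_nearby) simp_all
  then show ?thesis
    by (rule eventually_mono) (simp add: generic_def algebra_simps)
qed

lemma ell_p_at_infinity: "filterlim (ell_p \<tau>) at_infinity (at 0)"
proof -
  have f: "filterlim (ellf \<tau> 1) at_infinity (at 0)" by (rule ellf_at_infinity) simp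
  have "((\<lambda>z. inverse (ellf \<tau> 1 z) * inverse (ellf \<tau> 1 z)) \<longlongrightarrow> 0 * 0) (at 0)"
    using filterlim_compose[OF tendsto_inverse_0 f] by (intro tendsto_intros)
  moreover have "eventually (\<lambda>z. inverse (ellf \<tau> 1 z) * inverse (ellf \<tau> 1 z) \<noteq> 0) (at 0)"
    using filterlim_at_infinity_imp_eventually_ne[OF f, of 0] by (rule eventually_mono) simp
  ultimately have "filterlim (\<lambda>z. inverse (ell_p \<tau> z)) (at 0) (at 0)"
    unfolding filterlim_at by (simp add: ell_p_def power2_eq_square)
  then show ?thesis by (simp only: filterlim_inverse_at_iff)
qed

text \<open>By \<open>ell_G_property\<close>, G is \<open>f\<^sub>1(z) f\<^sub>1(z + 2\<eta>) /
  f\<^sub>1(2\<eta>) - K\<^sub>1\<close> near 0, where \<open>f\<^sub>1(z)\<close> has a pole and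
  the quotient next to it tends to 1.\<close>

lemma ell_G_at_infinity: "filterlim (ell_G \<tau> \<eta>) at_infinity (at 0)"
proof -
  have h: "2 * \<eta> \<notin> lattice \<tau>" "ellf \<tau> 1 (2 * \<eta>) \<noteq> 0"
    using eta_notin ellf_eta_nonzero(2)[of 1] by simp_all
  have "((\<lambda>z. ellf \<tau> 1 (2 * \<eta> + z)) \<longlongrightarrow> ellf \<tau> 1 (2 * \<eta>)) (at 0)"
    using ellf_isCont[OF _ h(1), of 1] by (simp add: isCont_iff)
  then have "((\<lambda>z. ellf \<tau> 1 (2 * \<eta> + z) / ellf \<tau> 1 (2 * \<eta>)) \<longlongrightarrow> ellf \<tau> 1 (2 * \<eta>) / ellf \<tau> 1 (2 * \<eta>)) (at 0)"
    using h by (intro tendsto_intros) auto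
  moreover have "ellf \<tau> 1 (2 * \<eta>) / ellf \<tau> 1 (2 * \<eta>) \<noteq> 0" using h by simp
  ultimately have "filterlim (\<lambda>z. ellf \<tau> 1 (2 * \<eta> + z) / ellf \<tau> 1 (2 * \<eta>) * ellf \<tau> 1 z) at_infinity (at 0)"
    by (rule tendsto_mult_filterlim_at_infinity) (simp add: ellf_at_infinity)
  then have "filterlim (\<lambda>z. - K \<tau> (2 * \<eta>) 1 + ellf \<tau> 1 (2 * \<eta> + z) / ellf \<tau> 1 (2 * \<eta>) * ellf \<tau> 1 z) at_infinity (at 0)"
    by (rule tendsto_add_filterlim_at_infinity[OF tendsto_const])
  moreover have "eventually (\<lambda>z. - K \<tau> (2 * \<eta>) 1 + ellf \<tau> 1 (2 * \<eta> + z) / ellf \<tau> 1 (2 * \<eta>) * ellf \<tau> 1 z = ell_G \<tau> \<eta> z) (at 0)"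
    using eventually_notin_lattice add_notin_lattice_nearby[of \<eta>] add_notin_lattice_nearby[of "2 * \<eta>"]
  proof eventually_elim
    case (elim z)
    then show ?case
      using ell_G_property[OF triple_123(1), of z] h(2) by (simp add: add.commute field_simps)
  qed
  ultimately show ?thesis
    by (rule filterlim_cong[OF refl refl, THEN iffD1, rotated])
qed

end

section \<open>The L-operator under a linear functional\<close>

locale reflection_data = algebra_functional smul \<Phi> + spectral_parameter \<tau> "h/2"
  for smul :: "complex \<Rightarrow> 'a::{ring, monoid_mult} \<Rightarrow> 'a" and \<Phi> \<tau> h +
  fixes S \<nu> :: "nat \<Rightarrow> 'a"
begin

text \<open>Absorbing \<open>rho\<close> removes it from the scaled L-operator and from the second
  relation; \<open>rho_nonzero\<close> allows the return to \<nu>.\<close>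

definition N :: "nat \<Rightarrow> 'a" where "N a = smul (rho \<tau> h a) (\<nu> a)"

abbreviation "SS \<equiv> \<lambda>a b. \<Phi> (S a * S b)"
abbreviation "SN \<equiv> \<lambda>a b. \<Phi> (S a * N b)"
abbreviation "NS \<equiv> \<lambda>a b. \<Phi> (N a * S b)"
abbreviation "NN \<equiv> \<lambda>a b. \<Phi> (N a * N b)"

abbreviation "rels \<equiv> scalar_relations (K \<tau> h) SS SN NS NN"

definition L_coord :: "complex \<Rightarrow> nat \<Rightarrow> 'a" where
  "L_coord z a = (if a = 0 then smul (varphi \<tau> h 0 z) (S 0)
     else smul (varphi \<tau> h a z) (S a) + smul (varphi \<tau> h a (z - omega \<tau> a)) (\<nu> a))"

definition L_scaled :: "complex \<Rightarrow> nat \<Rightarrow> 'a" where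
  "L_scaled z a = (if a = 0 then S 0 else
     smul ((ell_G \<tau> (h/2) z + K \<tau> h a) / ellf \<tau> a z) (S a) + smul (1 / ellf \<tau> a z) (N a))"

definition vanish_at :: "complex \<Rightarrow> complex \<Rightarrow> bool" where
  "vanish_at z w \<longleftrightarrow> all_components_vanish (\<lambda>a. varphi \<tau> (h/2) a (z - w)) (\<lambda>a. varphi \<tau> (h/2) a (z + w))
     (\<lambda>a b. \<Phi> (L_coord z a * L_coord w b)) (\<lambda>a b. \<Phi> (L_coord w b * L_coord z a))"

definition scaled_m :: "complex \<Rightarrow> complex \<Rightarrow> nat \<Rightarrow> complex" where
  "scaled_m z w a = (if a = 0 then 1 else coeff_m \<tau> (h/2) z w a)"

definition scaled_p :: "complex \<Rightarrow> complex \<Rightarrow> nat \<Rightarrow> complex" where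
  "scaled_p z w a = (if a = 0 then 1 else coeff_p \<tau> (h/2) z w a)"

definition scaled_X :: "complex \<Rightarrow> complex \<Rightarrow> nat \<Rightarrow> nat \<Rightarrow> complex" where
  "scaled_X z w a b = \<Phi> (L_scaled z a * L_scaled w b)"

definition scaled_Y :: "complex \<Rightarrow> complex \<Rightarrow> nat \<Rightarrow> nat \<Rightarrow> complex" where
  "scaled_Y z w a b = \<Phi> (L_scaled w b * L_scaled z a)"

lemma h: "2 * h \<notin> lattice \<tau>" "h/2 \<notin> lattice \<tau>" "h \<notin> lattice \<tau>"
  using \<eta> eta_notin by simp_all

lemma generic_notin:
  assumes "generic \<tau> (h/2) z w"
  shows "z \<notin> lattice \<tau>" "w \<notin> lattice \<tau>" "z + h \<notin> lattice \<tau>" "w + h \<notin> lattice \<tau>" "w - h \<notin> lattice \<tau>"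
    "2 * z \<notin> lattice \<tau>" "2 * w \<notin> lattice \<tau>" "z - w \<notin> lattice \<tau>" "z + w \<notin> lattice \<tau>"
    "(z - w) + h/2 \<notin> lattice \<tau>" "(z + w) + h/2 \<notin> lattice \<tau>" "z + h/2 \<notin> lattice \<tau>" "w + h/2 \<notin> lattice \<tau>"
proof -
  note g = assms[unfolded generic_def]
  show "z \<notin> lattice \<tau>" "w \<notin> lattice \<tau>"
    using g lattice_add[of z \<tau> z] lattice_add[of w \<tau> w] by auto
  show "z + h \<notin> lattice \<tau>" "w + h \<notin> lattice \<tau>" "w - h \<notin> lattice \<tau>" "2 * z \<notin> lattice \<tau>" "2 * w \<notin> lattice \<tau>"
    "z - w \<notin> lattice \<tau>" "z + w \<notin> lattice \<tau>" "z + h/2 \<notin> lattice \<tau>" "w + h/2 \<notin> lattice \<tau>"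
    "(z - w) + h/2 \<notin> lattice \<tau>" "(z + w) + h/2 \<notin> lattice \<tau>"
    using g by (simp_all add: algebra_simps)
qed

lemma L_coord_eq_scaled:
  assumes z: "2 * z \<notin> lattice \<tau>" "z + h \<notin> lattice \<tau>" "z + h/2 \<notin> lattice \<tau>" and a: "a \<le> 3"
  shows "L_coord z a = smul (varphi \<tau> h 0 z) (L_scaled z a)"
proof (cases "a = 0")
  case False
  then have set: "a \<in> {1..3}" using a by auto
  have z1: "z \<notin> lattice \<tau>" using z lattice_add[of z \<tau> z] by auto
  have nz: "ellf \<tau> a z \<noteq> 0" "ellf \<tau> a h \<noteq> 0"
    using ellf_nonzero[OF set z(1)] ellf_nonzero[OF set h(1)] by auto
  obtain b c where t: "triple a b c" using triple_exists[OF set] by blast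
  have "ellf \<tau> a z * ellf \<tau> a (z + h) = ellf \<tau> a h * (ell_G \<tau> (h/2) z + K \<tau> h a)"
    using ell_G_property[OF t z1] z by simp
  then have "ellf \<tau> a (z + h) / ellf \<tau> a h = (ell_G \<tau> (h/2) z + K \<tau> h a) / ellf \<tau> a z"
    using nz by (simp add: field_simps)
  then have "varphi \<tau> h a z = varphi \<tau> h 0 z * ((ell_G \<tau> (h/2) z + K \<tau> h a) / ellf \<tau> a z)"
    using varphi_eq_ellf[OF set h(3) z(2)] by simp
  moreover have "varphi \<tau> h a (z - omega \<tau> a) = varphi \<tau> h 0 z * (rho \<tau> h a / ellf \<tau> a z)"
    by (rule varphi_shift_eq_ellf[OF set h(1) z(1)])
  ultimately show ?thesis
    using False by (simp add: L_coord_def L_scaled_def N_def scale_right_distrib)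
qed (simp add: L_coord_def L_scaled_def)

lemma vanish_at_scaled:
  assumes g: "generic \<tau> (h/2) z w"
  shows "vanish_at z w \<longleftrightarrow> all_components_vanish (scaled_m z w) (scaled_p z w) (scaled_X z w) (scaled_Y z w)"
  unfolding vanish_at_def
proof (rule all_components_vanish_scale)
  note g' = generic_notin[OF g]
  show "varphi \<tau> (h/2) a (z - w) = varphi \<tau> (h/2) 0 (z - w) * scaled_m z w a" if "a \<le> 3" for a
    using varphi_eq_ellf[OF _ h(2) g'(10), of a] that
    by (cases "a = 0") (simp_all add: scaled_m_def coeff_m_def)
  show "varphi \<tau> (h/2) a (z + w) = varphi \<tau> (h/2) 0 (z + w) * scaled_p z w a" if "a \<le> 3" for a
    using varphi_eq_ellf[OF _ h(2) g'(11), of a] that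
    by (cases "a = 0") (simp_all add: scaled_p_def coeff_p_def)
  show "varphi \<tau> (h/2) 0 (z - w) \<noteq> 0" "varphi \<tau> (h/2) 0 (z + w) \<noteq> 0"
    using varphi_0_nonzero[OF h(2)] g' by auto
  show "varphi \<tau> h 0 z * varphi \<tau> h 0 w \<noteq> 0"
    using varphi_0_nonzero[OF h(3)] g' by auto
  show "\<Phi> (L_coord z a * L_coord w b) = varphi \<tau> h 0 z * varphi \<tau> h 0 w * scaled_X z w a b" if "a \<le> 3" "b \<le> 3" for a b
    unfolding scaled_X_def L_coord_eq_scaled[OF g'(6,3,12) that(1)] L_coord_eq_scaled[OF g'(7,4,13) that(2)]
    by (simp add: functional_simps)
  show "\<Phi> (L_coord w b * L_coord z a) = varphi \<tau> h 0 z * varphi \<tau> h 0 w * scaled_Y z w a b" if "a \<le> 3" "b \<le> 3" for a b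
    unfolding scaled_Y_def L_coord_eq_scaled[OF g'(6,3,12) that(1)] L_coord_eq_scaled[OF g'(7,4,13) that(2)]
    by (simp add: functional_simps)
qed

lemma reflection_scalars_generic:
  assumes g: "generic \<tau> (h/2) z w"
  shows "reflection_scalars (\<lambda>a. ellf \<tau> a z) (\<lambda>a. ellf \<tau> a (z + h)) (\<lambda>a. ellf \<tau> a w) (\<lambda>a. ellf \<tau> a h) (K \<tau> h) (ell_e \<tau>)
     (\<lambda>a. ell_G \<tau> (h/2) z + K \<tau> h a) (\<lambda>a. ell_G \<tau> (h/2) w + K \<tau> h a) (ell_G \<tau> (h/2) z) (ell_G \<tau> (h/2) w)
     (ell_p \<tau> w) (ell_p \<tau> h) (coeff_M \<tau> (h/2) z w) (scaled_m z w) (scaled_p z w) (scaled_X z w) (scaled_Y z w) SS SN NS NN"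
proof -
  note g' = generic_notin[OF g]
  note C = coefficients[OF g]
  have 2: "2 * (h / 2) = h" by simp
  show ?thesis
  proof
    fix a :: nat assume a: "a \<in> {1..3}"
    show "ellf \<tau> a z \<noteq> 0" "ellf \<tau> a w \<noteq> 0" "ellf \<tau> a h \<noteq> 0"
      using ellf_nonzero[OF a] g' h by auto
    show "ellf \<tau> a w * ellf \<tau> a w = ell_p \<tau> w - ell_e \<tau> a" "ellf \<tau> a h * ellf \<tau> a h = ell_p \<tau> h - ell_e \<tau> a"
      using ellf_sq[OF a] g' h by (simp_all add: power2_eq_square)
  next
    fix a b c :: nat assume t: "triple a b c"
    show "K \<tau> h a = - (ellf \<tau> b h * ellf \<tau> c h) / ellf \<tau> a h"
      by (rule K_eq[OF triple_rot[OF t] h(1)])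
    have nz: "a \<noteq> 0" "b \<noteq> 0" "c \<noteq> 0" using tripleD[OF t] by auto
    note C' = C(1-4)[OF t, unfolded 2]
    show "scaled_p z w a + scaled_m z w a + (scaled_m z w b * scaled_p z w c + scaled_m z w c * scaled_p z w b)
       = coeff_M \<tau> (h/2) z w * (ellf \<tau> a z * ellf \<tau> b w * ellf \<tau> c w)"
      "scaled_p z w a + scaled_m z w a - (scaled_m z w b * scaled_p z w c + scaled_m z w c * scaled_p z w b)
       = coeff_M \<tau> (h/2) z w * (ellf \<tau> a (z + h) * ellf \<tau> b w * ellf \<tau> c w)"
      "scaled_p z w a - scaled_m z w a + (scaled_m z w b * scaled_p z w c - scaled_m z w c * scaled_p z w b)
       = - coeff_M \<tau> (h/2) z w * (ellf \<tau> a w * ellf \<tau> b (z + h) * ellf \<tau> c z)"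
      "1 + scaled_m z w a * scaled_p z w a - scaled_m z w b * scaled_p z w b - scaled_m z w c * scaled_p z w c
       = coeff_M \<tau> (h/2) z w * (ellf \<tau> a h * (ell_p \<tau> w + ell_p \<tau> h - ell_e \<tau> b - ell_e \<tau> c + K \<tau> h a * ell_G \<tau> (h/2) z))"
      using C' nz by (simp_all add: scaled_m_def scaled_p_def)
  next
    show "coeff_M \<tau> (h/2) z w \<noteq> 0" by (rule C(6)[OF triple_123(1)])
    show "ell_p \<tau> w \<noteq> ell_p \<tau> h"
      by (rule ell_p_neq) (use g' h in auto)
    show "ell_G \<tau> (h/2) w * (ell_p \<tau> w - ell_p \<tau> h) = ellf \<tau> 1 w * ellf \<tau> 2 w * ellf \<tau> 3 w - ellf \<tau> 1 h * ellf \<tau> 2 h * ellf \<tau> 3 h"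
      using ell_G_difference_quotient[of w] g' by (simp add: ell_F_def)
    show "1 + scaled_m z w 1 * scaled_p z w 1 + scaled_m z w 2 * scaled_p z w 2 + scaled_m z w 3 * scaled_p z w 3 =
       coeff_M \<tau> (h/2) z w * (ellf \<tau> 1 h * ellf \<tau> 2 h * ellf \<tau> 3 h + ell_G \<tau> (h/2) z * (ell_p \<tau> w - ell_p \<tau> h))"
      using C(5)[OF triple_123(1)] by (simp add: scaled_m_def scaled_p_def ell_F_def)
    fix a :: nat assume a: "a \<in> {1..3}"
    obtain b c where t: "triple a b c" using triple_exists[OF a] by blast
    show "ellf \<tau> a z * ellf \<tau> a (z + h) = ellf \<tau> a h * (ell_G \<tau> (h/2) z + K \<tau> h a)"
      using ell_G_property[OF t, of z] g' by simp
  next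
    show "scaled_X z w 0 0 = SS 0 0" "scaled_Y z w 0 0 = SS 0 0"
      by (simp_all add: scaled_X_def scaled_Y_def L_scaled_def)
    fix a :: nat assume a: "a \<in> {1..3}"
    show "scaled_X z w 0 a = ((ell_G \<tau> (h/2) w + K \<tau> h a) * SS 0 a + SN 0 a) / ellf \<tau> a w"
      "scaled_Y z w 0 a = ((ell_G \<tau> (h/2) w + K \<tau> h a) * SS a 0 + NS a 0) / ellf \<tau> a w"
      "scaled_X z w a 0 = ((ell_G \<tau> (h/2) z + K \<tau> h a) * SS a 0 + NS a 0) / ellf \<tau> a z"
      "scaled_Y z w a 0 = ((ell_G \<tau> (h/2) z + K \<tau> h a) * SS 0 a + SN 0 a) / ellf \<tau> a z"
      using a by (simp_all add: scaled_X_def scaled_Y_def L_scaled_def functional_simps add_divide_distrib distrib_left distrib_right)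
    fix b :: nat assume b: "b \<in> {1..3}"
    have "ellf \<tau> a z \<noteq> 0" "ellf \<tau> b w \<noteq> 0"
      using ellf_nonzero a b g' by auto
    then show "scaled_X z w a b = ((ell_G \<tau> (h/2) z + K \<tau> h a) * (ell_G \<tau> (h/2) w + K \<tau> h b) * SS a b
        + (ell_G \<tau> (h/2) z + K \<tau> h a) * SN a b + (ell_G \<tau> (h/2) w + K \<tau> h b) * NS a b + NN a b) / (ellf \<tau> a z * ellf \<tau> b w)"
      "scaled_Y z w a b = ((ell_G \<tau> (h/2) z + K \<tau> h a) * (ell_G \<tau> (h/2) w + K \<tau> h b) * SS b a
        + (ell_G \<tau> (h/2) z + K \<tau> h a) * NS b a + (ell_G \<tau> (h/2) w + K \<tau> h b) * SN b a + NN b a) / (ellf \<tau> a z * ellf \<tau> b w)"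
      using a b by (simp_all add: scaled_X_def scaled_Y_def L_scaled_def functional_simps add_divide_distrib distrib_left distrib_right mult_ac)
  qed (simp_all add: scaled_m_def scaled_p_def)
qed

end

text \<open>A single generic point as a locale, so that the scalar identities become available by
  interpretation inside the limit arguments.\<close>

locale reflection_point = reflection_data +
  fixes z w :: complex
  assumes generic: "generic \<tau> (h/2) z w"

sublocale reflection_point \<subseteq> reflection_scalars "\<lambda>a. ellf \<tau> a z" "\<lambda>a. ellf \<tau> a (z + h)" "\<lambda>a. ellf \<tau> a w"
  "\<lambda>a. ellf \<tau> a h" "K \<tau> h" "ell_e \<tau>" "\<lambda>a. ell_G \<tau> (h/2) z + K \<tau> h a" "\<lambda>a. ell_G \<tau> (h/2) w + K \<tau> h a"
  "ell_G \<tau> (h/2) z" "ell_G \<tau> (h/2) w" "ell_p \<tau> w" "ell_p \<tau> h" "coeff_M \<tau> (h/2) z w" "scaled_m z w" "scaled_p z w"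
  "scaled_X z w" "scaled_Y z w" SS SN NS NN
  by (rule reflection_scalars_generic[OF generic])

context reflection_data
begin

lemma vanish_at_if_relations_generic:
  assumes "generic \<tau> (h/2) z w" rels
  shows "vanish_at z w"
  using vanish_at_scaled[OF assms(1)]
    reflection_scalars.all_components_vanish_if_relations[OF reflection_scalars_generic[OF assms(1)] assms(2)]
  by blast

lemma vanish_at_if_relations:
  assumes adm: "2 * z \<notin> lattice \<tau>" "2 * w \<notin> lattice \<tau>" "z - w \<notin> lattice \<tau>" "z + w \<notin> lattice \<tau>" and rels
  shows "vanish_at z w"
proof -
  have v: "isCont (\<lambda>t. varphi \<tau> \<zeta> a (c + d * t)) 0" if "c \<notin> lattice \<tau>" for \<zeta> a c d
    by (rule isCont_o2[where g = "varphi \<tau> \<zeta> a"]) (use varphi_isCont that in \<open>auto intro!: continuous_intros\<close>)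
  have shifted: "c - omega \<tau> a \<notin> lattice \<tau>" if "2 * c \<notin> lattice \<tau>" "a \<in> {1..3}" for a c
  proof
    assume "c - omega \<tau> a \<in> lattice \<tau>"
    then have "(c - omega \<tau> a) + (c - omega \<tau> a) + 2 * omega \<tau> a \<in> lattice \<tau>"
      using lattice_add two_omega_in_lattice[OF that(2)] by blast
    then show False using that(1) by (simp add: algebra_simps)
  qed
  have one: "c \<notin> lattice \<tau>" if "2 * c \<notin> lattice \<tau>" for c
    using that lattice_add[of c \<tau> c] by auto
  \<comment> \<open>A formula uniform in a: as L contains no term with \<open>\<nu> 0\<close>, the
    second coefficient is 0 for a = 0.\<close>
  have Lexp: "L_coord c a = smul (varphi \<tau> h a c) (S a) + smul (if a = 0 then 0 else varphi \<tau> h a (c - omega \<tau> a)) (\<nu> a)" for c a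
    by (simp add: L_coord_def)
  have cont_shift: "isCont (\<lambda>t. if a = 0 then 0 else varphi \<tau> h a (c + d * t - omega \<tau> a)) 0" if "2 * c \<notin> lattice \<tau>" "a \<le> 3" for a c d
    using v[OF shifted[OF that(1)], of a h a d] that by (cases "a = 0") (auto simp: algebra_simps)
  have "all_components_vanish (\<lambda>a. varphi \<tau> (h/2) a (z - w + (-1) * 0)) (\<lambda>a. varphi \<tau> (h/2) a (z + w + 3 * 0))
     (\<lambda>a b. \<Phi> (L_coord (z + 1 * 0) a * L_coord (w + 2 * 0) b)) (\<lambda>a b. \<Phi> (L_coord (w + 2 * 0) b * L_coord (z + 1 * 0) a))"
  proof (rule all_components_vanish_continuous[where m = "\<lambda>t a. varphi \<tau> (h/2) a (z - w + (-1) * t)" and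
        p = "\<lambda>t a. varphi \<tau> (h/2) a (z + w + 3 * t)" and X = "\<lambda>t a b. \<Phi> (L_coord (z + 1 * t) a * L_coord (w + 2 * t) b)"
        and Y = "\<lambda>t a b. \<Phi> (L_coord (w + 2 * t) b * L_coord (z + 1 * t) a)"])
    show "isCont (\<lambda>t. varphi \<tau> (h/2) a (z - w + (-1) * t)) 0" "isCont (\<lambda>t. varphi \<tau> (h/2) a (z + w + 3 * t)) 0" for a
      using adm by (intro v; simp)+
    fix a b :: nat assume ab: "a \<le> 3" "b \<le> 3"
    note c = v[OF one[OF adm(1)], of h a 1] v[OF one[OF adm(2)], of h b 2] cont_shift[OF adm(1) ab(1), of 1] cont_shift[OF adm(2) ab(2), of 2]
    show "isCont (\<lambda>t. \<Phi> (L_coord (z + 1 * t) a * L_coord (w + 2 * t) b)) 0"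
      "isCont (\<lambda>t. \<Phi> (L_coord (w + 2 * t) b * L_coord (z + 1 * t) a)) 0"
      unfolding Lexp functional_add_mult functional_smul_mult by (intro continuous_intros c)+
  next
    have "eventually (\<lambda>t. generic \<tau> (h/2) (z + t) (w + 2 * t)) (at 0)"
      by (rule eventually_generic_perturbation)
    then show "eventually (\<lambda>t. all_components_vanish (\<lambda>a. varphi \<tau> (h/2) a (z - w + (-1) * t)) (\<lambda>a. varphi \<tau> (h/2) a (z + w + 3 * t))
     (\<lambda>a b. \<Phi> (L_coord (z + 1 * t) a * L_coord (w + 2 * t) b)) (\<lambda>a b. \<Phi> (L_coord (w + 2 * t) b * L_coord (z + 1 * t) a))) (at 0)"
    proof (rule eventually_mono)
      fix t assume "generic \<tau> (h/2) (z + t) (w + 2 * t)"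
      then have "vanish_at (z + t) (w + 2 * t)" using \<open>rels\<close> by (rule vanish_at_if_relations_generic)
      moreover have "z + t - (w + 2 * t) = z - w + (-1) * t" "z + t + (w + 2 * t) = z + w + 3 * t" "z + 1 * t = z + t"
        by (simp_all add: algebra_simps)
      ultimately show "all_components_vanish (\<lambda>a. varphi \<tau> (h/2) a (z - w + (-1) * t)) (\<lambda>a. varphi \<tau> (h/2) a (z + w + 3 * t))
     (\<lambda>a b. \<Phi> (L_coord (z + 1 * t) a * L_coord (w + 2 * t) b)) (\<lambda>a b. \<Phi> (L_coord (w + 2 * t) b * L_coord (z + 1 * t) a))"
        by (simp only: vanish_at_def)
    qed
  qed
  then show ?thesis by (simp add: vanish_at_def)
qed

section \<open>Necessity of the relations\<close>

lemma relations_if_vanish: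
  assumes van: "\<And>z w. generic \<tau> (h/2) z w \<Longrightarrow> vanish_at z w"
  shows rels
proof -
  let ?G = "ell_G \<tau> (h/2)" and ?P = "ell_p \<tau>" and ?H = "ell_p \<tau> h" and ?e = "ell_e \<tau>" and ?K = "K \<tau> h"
  have Pinf: "filterlim ?P at_infinity (at 0)" by (rule ell_p_at_infinity)
  have Ginf: "filterlim ?G at_infinity (at 0)" by (rule ell_G_at_infinity)
  \<comment> \<open>The condition on \<open>?G\<close> makes the factor \<open>G - Gw\<close> of the
    components cancellable; it holds for z near 0 because G blows up there.\<close>
  have ev: "eventually (\<lambda>w. eventually (\<lambda>z. generic \<tau> (h/2) z w \<and> ?G z \<noteq> ?G w) (at 0)) (at 0)"
    using eventually_generic
    by (rule eventually_mono) (intro eventually_conj filterlim_at_infinity_imp_eventually_ne[OF Ginf])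
  have scaled: "all_components_vanish (scaled_m z w) (scaled_p z w) (scaled_X z w) (scaled_Y z w)" if "generic \<tau> (h/2) z w" for z w
    using van[OF that] vanish_at_scaled[OF that] by blast
  have comp: "comp_0a (scaled_m z w) (scaled_p z w) (scaled_X z w) (scaled_Y z w) a b c = 0 \<and>
      comp_bc_sign \<i> (scaled_m z w) (scaled_p z w) (scaled_X z w) (scaled_Y z w) a b c = 0 \<and>
      comp_bc_sign (- \<i>) (scaled_m z w) (scaled_p z w) (scaled_X z w) (scaled_Y z w) a c b = 0"
    if "generic \<tau> (h/2) z w" "(a, b, c) \<in> {(1, 2, 3), (2, 3, 1), (3, 1, 2)}" for z w a b c
    using scaled[OF that(1)] that(2) unfolding all_components_vanish_def comp_bc_eq comp_cb_eq by blast
  have diag: "SN a a = NS a a" if "a \<in> {1..3}" for a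
  proof -
    define r where "r a = SN a a - NS a a" for a
    have "eventually (\<lambda>w. (?e 2 * ?e 3 * r 1 + ?e 3 * ?e 1 * r 2 + ?e 1 * ?e 2 * r 3)
       + (- (?e 2 + ?e 3) * r 1 - (?e 3 + ?e 1) * r 2 - (?e 1 + ?e 2) * r 3) * ?P w + (r 1 + r 2 + r 3) * (?P w * ?P w) = 0) (at 0)"
      using ev
    proof (rule eventually_mono)
      fix w assume "eventually (\<lambda>z. generic \<tau> (h/2) z w \<and> ?G z \<noteq> ?G w) (at 0)"
      then obtain z where z: "generic \<tau> (h/2) z w" "?G z \<noteq> ?G w"
        using eventually_happens'[OF at_neq_bot] by blast
      interpret reflection_point smul \<Phi> \<tau> h S \<nu> z w
        by unfold_locales (rule z(1))
      have "comp_00 (scaled_m z w) (scaled_p z w) (scaled_X z w) (scaled_Y z w) = 0"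
        using scaled[OF z(1)] by (simp add: all_components_vanish_def)
      then have "(?P w - ?e 2) * (?P w - ?e 3) * r 1 + (?P w - ?e 3) * (?P w - ?e 1) * r 2 + (?P w - ?e 1) * (?P w - ?e 2) * r 3 = 0"
        using comp_00_eq M_nz z(2) by (simp add: r_def)
      then show "(?e 2 * ?e 3 * r 1 + ?e 3 * ?e 1 * r 2 + ?e 1 * ?e 2 * r 3)
       + (- (?e 2 + ?e 3) * r 1 - (?e 3 + ?e 1) * r 2 - (?e 1 + ?e 2) * r 3) * ?P w + (r 1 + r 2 + r 3) * (?P w * ?P w) = 0"
        by (simp add: algebra_simps)
    qed
    note q = quadratic_vanishing_at_infinity[OF Pinf at_neq_bot this]
    \<comment> \<open>These are the values of the vanishing quadratic polynomial at
      \<open>?e 1\<close>, \<open>?e 2\<close>, \<open>?e 3\<close>, where two of its three terms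
      are 0.\<close>
    have "(?e 1 - ?e 2) * (?e 1 - ?e 3) * r 1 = 0" "(?e 2 - ?e 3) * (?e 2 - ?e 1) * r 2 = 0" "(?e 3 - ?e 1) * (?e 3 - ?e 2) * r 3 = 0"
      using q by algebra+
    moreover have "?e 1 \<noteq> ?e 2" "?e 2 \<noteq> ?e 3" "?e 1 \<noteq> ?e 3"
      using ell_e_distinct by simp_all
    ultimately have "r 1 = 0" "r 2 = 0" "r 3 = 0" by auto
    then show ?thesis using that unfolding index_123 r_def by auto
  qed
  have zero: "SN 0 a = NS a 0 \<and> ?K a * (SS 0 a - SS a 0) + \<i> * ((?K c - ?K b) * (SS b c + SS c b) + (SN b c + NS c b) - (SN c b + NS b c)) = 0"
    if abc: "(a, b, c) \<in> {(1, 2, 3), (2, 3, 1), (3, 1, 2)}" for a b c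
  proof -
    have t: "triple a b c" using abc triple_123 by blast
    note set = tripleD[OF t]
    define A n where "A = ?K a * (SS 0 a - SS a 0) + \<i> * ((?K c - ?K b) * (SS b c + SS c b) + (SN b c + NS c b) - (SN c b + NS b c))"
      and "n = SN 0 a - NS a 0"
    have "eventually (\<lambda>w. (- ?e a * A - ?H * n) + (A + n) * ?P w + 0 * (?P w * ?P w) = 0) (at 0)"
      using ev
    proof (rule eventually_mono)
      fix w assume "eventually (\<lambda>z. generic \<tau> (h/2) z w \<and> ?G z \<noteq> ?G w) (at 0)"
      then obtain z where z: "generic \<tau> (h/2) z w" "?G z \<noteq> ?G w"
        using eventually_happens'[OF at_neq_bot] by blast
      interpret reflection_point smul \<Phi> \<tau> h S \<nu> z w
        by unfold_locales (rule z(1))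
      have "(?P w - ?e a) * A + (?P w - ?H) * n = 0"
        using comp_0a_eq[OF t] comp[OF z(1) abc] M_nz z(2) by (simp add: A_def n_def)
      then show "(- ?e a * A - ?H * n) + (A + n) * ?P w + 0 * (?P w * ?P w) = 0" by (simp add: algebra_simps)
    qed
    note q = quadratic_vanishing_at_infinity[OF Pinf at_neq_bot this]
    \<comment> \<open>Both coefficients of the linear polynomial in \<wp>(w) vanish. The determinant
      of this system for \<open>A\<close> and \<open>n\<close> is, up to sign,
      \<open>?H - ?e a\<close>, that is, \<open>f\<^sub>a(h)\<^sup>2\<close>.\<close>
    have "(?H - ?e a) * n = 0" using q(1,2) by algebra
    moreover have "?H - ?e a \<noteq> 0"
      using ellf_sq[OF set(1) h(3)] ellf_nonzero[OF set(1) h(1)] by auto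
    ultimately have "n = 0" by simp
    then show ?thesis using q(2) by (simp add: A_def n_def)
  qed
  \<comment> \<open>\<open>comp_bc\<close> is the case j = \<i>, and \<open>comp_cb\<close> is the
    case j = -\<i> with b and c exchanged. The last part is an implication because its premise,
    \<open>p1 = 0\<close>, is supplied by the exchanged case, where \<open>p2\<close> is the
    negative of this \<open>p1\<close>.\<close>
  have skew: "NS b c = SN c b \<and> NN b c = NN c b \<and> (SN b c = NS c b \<longrightarrow> SS b c - SS c b = j * (SS 0 a + SS a 0))"
    if t: "triple a b c"
      and van_j: "\<And>z w. generic \<tau> (h/2) z w \<Longrightarrow> comp_bc_sign j (scaled_m z w) (scaled_p z w) (scaled_X z w) (scaled_Y z w) a b c = 0"
    for a b c j
  proof -
    note set = tripleD[OF t]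
    define k p1 p2 n s \<kappa> where "k = SS b c - SS c b" and "p1 = SN b c - NS c b" and "p2 = NS b c - SN c b"
      and "n = NN b c - NN c b" and "s = SS 0 a + SS a 0" and "\<kappa> = ?K c - ?K b"
    have each: "((?P w - ?e c) + ?K b * \<kappa>) * ((?G w + ?K c) * p2 + n) = 0 \<and>
        (p1 = 0 \<and> p2 = 0 \<longrightarrow> k = j * s)"
      if w: "eventually (\<lambda>z. generic \<tau> (h/2) z w \<and> ?G z \<noteq> ?G w) (at 0)" for w
    proof -
      define V F t t' where "V = ?G w + ?K b" and "F = ellf \<tau> a w * ellf \<tau> b w * ellf \<tau> c w" and "t = ?P w - ?e b" and "t' = ?P w - ?e c"
      \<comment> \<open>The coefficients of the component as a polynomial in
        \<open>U = ?K b + ?G z\<close> at fixed w. In this variable, which is \<open>g b\<close>,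
        the constant term is short.\<close>
      define c0 c1 c2 where "c0 = (F * V - ?K b * t * V) * ((V + \<kappa>) * p2 + n)"
        and "c1 = (F * V - ?K b * t * V) * ((V + \<kappa>) * k * V + p1 * V - (V + \<kappa>) * k * V - p1 * V)
           + (F * V - ?K b * t * V) * ((V + \<kappa>) * k + p1) + ?K b * t * ((V + \<kappa>) * p2 + n)
           - F * (\<kappa> * V * k + \<kappa> * p2 + V * p1 + n) - j * t * t' * V * s"
        and "c2 = ?K b * t * ((V + \<kappa>) * k + p1) - F * (V * k + p2) + j * t * t' * s"
      have ex: "\<exists>z. generic \<tau> (h/2) z w" using eventually_happens'[OF at_neq_bot w] by blast
      have facts: "t \<noteq> 0" "t' \<noteq> 0" "F * V = t * (?K b * (V + \<kappa>) + t')"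
      proof -
        obtain z where z: "generic \<tau> (h/2) z w" using ex ..
        interpret reflection_point smul \<Phi> \<tau> h S \<nu> z w
          by unfold_locales (rule z)
        show "t \<noteq> 0" "t' \<noteq> 0"
          using y_sq[OF set(2)] y_nz[OF set(2)] y_sq[OF set(3)] y_nz[OF set(3)] by (auto simp: t_def t'_def)
        show "F * V = t * (?K b * (V + \<kappa>) + t')"
          using y_prod_gw_bc[OF t] by (simp add: F_def V_def t_def t'_def \<kappa>_def)
      qed
      have "eventually (\<lambda>z. c0 + (c1) * (?K b + ?G z) + c2 * ((?K b + ?G z) * (?K b + ?G z)) = 0) (at 0)"
        using w
      proof (rule eventually_mono)
        fix z assume z: "generic \<tau> (h/2) z w \<and> ?G z \<noteq> ?G w"
        interpret reflection_point smul \<Phi> \<tau> h S \<nu> z w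
          by unfold_locales (use z in blast)
        define U where "U = ?K b + ?G z"
        have UV: "?G z + ?K b = U" "?G w + ?K b = V" "?G z + ?K c = U + \<kappa>" "?G w + ?K c = V + \<kappa>" "?G z - ?G w = U - V"
          by (simp_all add: U_def V_def \<kappa>_def)
        have "coeff_M \<tau> (h/2) z w * ellf \<tau> b h * ((F * V + ?K b * t * (U - V)) * (U * (V + \<kappa>) * k + U * p1 + (V + \<kappa>) * p2 + n)
          - F * U * ((U + \<kappa>) * V * k + (U + \<kappa>) * p2 + V * p1 + n) + j * U * t * t' * (U - V) * s) = 0"
          using comp_bc_sign_eq[OF t, of j] van_j[of z w] z
          unfolding UV F_def[symmetric] t_def[symmetric] t'_def[symmetric] k_def[symmetric] p1_def[symmetric] p2_def[symmetric]
            n_def[symmetric] s_def[symmetric] by simp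
        then have "(F * V + ?K b * t * (U - V)) * (U * (V + \<kappa>) * k + U * p1 + (V + \<kappa>) * p2 + n)
          - F * U * ((U + \<kappa>) * V * k + (U + \<kappa>) * p2 + V * p1 + n) + j * U * t * t' * (U - V) * s = 0"
          using M_nz h_nz[OF set(2)] by simp
        then show "c0 + (c1) * (?K b + ?G z) + c2 * ((?K b + ?G z) * (?K b + ?G z)) = 0"
          unfolding U_def[symmetric] c0_def c1_def c2_def by (simp add: algebra_simps)
      qed
      note q = quadratic_vanishing_at_infinity[OF tendsto_add_filterlim_at_infinity[OF tendsto_const Ginf] at_neq_bot this]
      \<comment> \<open>By \<open>facts(3)\<close> the first factor of \<open>c0\<close> is
        \<open>t * (t' + ?K b * \<kappa>)\<close>.\<close>
      have "t * ((t' + ?K b * \<kappa>) * ((V + \<kappa>) * p2 + n)) = 0"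
        using q(1) facts(3) unfolding c0_def by algebra
      then have 1: "(t' + ?K b * \<kappa>) * ((V + \<kappa>) * p2 + n) = 0" using facts(1) by simp
      have "k = j * s" if "p1 = 0" "p2 = 0"
      proof -
        \<comment> \<open>For vanishing \<open>p1\<close> and \<open>p2\<close>,
          \<open>facts(3)\<close> turns \<open>c2\<close> into
          \<open>- t * t' * (k - j * s)\<close>.\<close>
        have "t * t' * (k - j * s) = 0"
          using q(3) facts(3) unfolding c2_def that by algebra
        then show ?thesis using facts by simp
      qed
      with 1 show ?thesis by (simp add: t'_def V_def \<kappa>_def)
    qed
    \<comment> \<open>Now w tends to 0 as well: the first factor in \<open>each\<close> is nonzero
      because \<wp> blows up, and the second is a linear polynomial in G(w).\<close>
    have "eventually (\<lambda>w. ?P w \<noteq> ?e c - ?K b * \<kappa>) (at 0)"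
      by (rule filterlim_at_infinity_imp_eventually_ne[OF Pinf])
    then have "eventually (\<lambda>w. (?K c * p2 + n) + p2 * ?G w + 0 * (?G w * ?G w) = 0) (at 0)"
      using ev
    proof eventually_elim
      case (elim w)
      have "(?P w - ?e c) + ?K b * \<kappa> \<noteq> 0" using elim(1) by (auto simp: algebra_simps)
      then have "(?G w + ?K c) * p2 + n = 0" using each[OF elim(2)] by simp
      then show ?case by (simp add: algebra_simps)
    qed
    note q = quadratic_vanishing_at_infinity[OF Ginf at_neq_bot this]
    have p2: "p2 = 0" and n: "n = 0" using q by simp_all
    obtain w where "eventually (\<lambda>z. generic \<tau> (h/2) z w \<and> ?G z \<noteq> ?G w) (at 0)"
      using eventually_happens'[OF at_neq_bot ev] by blast
    from each[OF this] p2 n show ?thesis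
      by (auto simp: p1_def p2_def n_def k_def s_def)
  qed
  have cyc: "NS b c = SN c b \<and> NS c b = SN b c \<and> NN b c = NN c b \<and> SS b c - SS c b = \<i> * (SS 0 a + SS a 0)"
    if abc: "(a, b, c) \<in> {(1, 2, 3), (2, 3, 1), (3, 1, 2)}" for a b c
  proof -
    have t: "triple a b c" using abc triple_123 by blast
    note set = tripleD[OF t]
    show ?thesis
      using skew[OF t, of \<i>] skew[OF triple_swap[OF t], of "- \<i>"] comp[OF _ abc] by auto
  qed
  note cyc' = cyc[of 1 2 3, simplified] cyc[of 2 3 1, simplified] cyc[of 3 1 2, simplified]
  note zero' = zero[of 1 2 3, simplified] zero[of 2 3 1, simplified] zero[of 3 1 2, simplified]
  show ?thesis
    unfolding scalar_relations_def
  proof (intro conjI ballI)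
    fix a b :: nat assume a: "a \<in> {1..3}"
    show "NN a b = NN b a" if "b \<in> {1..3}"
      using a that cyc' unfolding index_123 by (elim disjE) simp_all
    show "SN b a = NS a b" if "b \<in> {0..3}"
    proof -
      have "b = 0 \<or> b = 1 \<or> b = 2 \<or> b = 3" using that by auto
      then show ?thesis
        using a cyc' zero' diag[of 1] diag[of 2] diag[of 3] unfolding index_123 by (elim disjE) simp_all
    qed
  next
    fix abc :: "nat \<times> nat \<times> nat" assume mem: "abc \<in> {(1, 2, 3), (2, 3, 1), (3, 1, 2)}"
    obtain a b c where abc: "abc = (a, b, c)" by (cases abc)
    note cyc = cyc[OF mem[unfolded abc]] and zero = zero[OF mem[unfolded abc]]
    show "case abc of (a, b, c) \<Rightarrow> \<i> * (SS 0 a + SS a 0) = SS b c - SS c b \<and>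
       ?K a * (SS a 0 - SS 0 a) = \<i> * (?K c - ?K b) * (SS b c + SS c b) - 2 * \<i> * (NS b c - NS c b)"
      unfolding abc prod.case
    proof
      show "\<i> * (SS 0 a + SS a 0) = SS b c - SS c b" using cyc by simp
      have "SN b c = NS c b" "SN c b = NS b c" using cyc by simp_all
      with zero have "?K a * (SS 0 a - SS a 0) + \<i> * ((?K c - ?K b) * (SS b c + SS c b) + (NS c b + NS c b) - (NS b c + NS b c)) = 0"
        by simp
      then show "?K a * (SS a 0 - SS 0 a) = \<i> * (?K c - ?K b) * (SS b c + SS c b) - 2 * \<i> * (NS b c - NS c b)"
        by algebra
    qed
  qed
qed

end

section \<open>From functionals back to the algebra\<close>

context complex_algebra
begin

lemma functional_eq_iff: "x = y \<longleftrightarrow> (\<forall>\<Phi>. functional \<Phi> \<longrightarrow> \<Phi> x = \<Phi> y)"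
proof (intro iffI)
  assume *: "\<forall>\<Phi>. functional \<Phi> \<longrightarrow> \<Phi> x = \<Phi> y"
  have "x - y = 0"
  proof (rule functional_separates)
    fix \<Phi> assume \<Phi>: "functional \<Phi>"
    then interpret algebra_functional smul \<Phi> by unfold_locales
    show "\<Phi> (x - y) = 0" using * \<Phi> by (simp add: functional_diff)
  qed
  then show "x = y" by simp
qed simp

end

context reflection_data
begin

lemma Lhat_eq: "Lhat smul \<tau> h S \<nu> z = pauli_L smul (L_coord z)"
proof -
  have "(\<Sum>a\<in>{1..3}. map_matrix (\<lambda>c. smul c (smul (varphi \<tau> h a z) (S a)
      + smul (varphi \<tau> h a (z - omega \<tau> a)) (\<nu> a))) (sigma a)) =
    (\<Sum>a\<in>{1..3}. map_matrix (\<lambda>c. smul c (L_coord z a)) (sigma a))"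
    by (rule sum.cong) (auto simp: L_coord_def)
  then show ?thesis
    unfolding Lhat_def pauli_L_def by (simp add: L_coord_def[of z 0])
qed

lemma Rmat_eq: "Rmat \<tau> h x = pauli_R (\<lambda>a. varphi \<tau> (h/2) a x)"
  unfolding Rmat_def pauli_R_def ..

definition left_side :: "complex \<Rightarrow> complex \<Rightarrow> 'a ^ (2 \<times> 2) ^ (2 \<times> 2)" where
  "left_side z w = lift_mat smul (Rmat \<tau> h (z - w)) \<bullet>\<bullet> (Lhat smul \<tau> h S \<nu> z \<otimes>\<otimes> lift_mat smul (sigma 0))
     \<bullet>\<bullet> lift_mat smul (Rmat \<tau> h (z + w)) \<bullet>\<bullet> (lift_mat smul (sigma 0) \<otimes>\<otimes> Lhat smul \<tau> h S \<nu> w)"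

definition right_side :: "complex \<Rightarrow> complex \<Rightarrow> 'a ^ (2 \<times> 2) ^ (2 \<times> 2)" where
  "right_side z w = (lift_mat smul (sigma 0) \<otimes>\<otimes> Lhat smul \<tau> h S \<nu> w) \<bullet>\<bullet> lift_mat smul (Rmat \<tau> h (z + w))
     \<bullet>\<bullet> (Lhat smul \<tau> h S \<nu> z \<otimes>\<otimes> lift_mat smul (sigma 0)) \<bullet>\<bullet> lift_mat smul (Rmat \<tau> h (z - w))"

lemma entries_eq_iff_vanish_at:
  "(\<forall>r c. \<Phi> (left_side z w $ r $ c) = \<Phi> (right_side z w $ r $ c)) \<longleftrightarrow> vanish_at z w"
proof -
  have "(\<forall>r c. \<Phi> (left_side z w $ r $ c) - \<Phi> (right_side z w $ r $ c) = 0) \<longleftrightarrow> vanish_at z w"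
    unfolding vanish_at_def left_side_def right_side_def Rmat_eq Lhat_eq
    by (rule entries_vanish_iff) (rule refl)+
  then show ?thesis by simp
qed

lemma vanish_at_iff_relations:
  "(\<forall>z w. 2 * z \<notin> lattice \<tau> \<longrightarrow> 2 * w \<notin> lattice \<tau> \<longrightarrow> z - w \<notin> lattice \<tau> \<longrightarrow> z + w \<notin> lattice \<tau> \<longrightarrow> vanish_at z w)
    \<longleftrightarrow> rels"
proof (intro iffI allI impI)
  assume *: "\<forall>z w. 2 * z \<notin> lattice \<tau> \<longrightarrow> 2 * w \<notin> lattice \<tau> \<longrightarrow> z - w \<notin> lattice \<tau> \<longrightarrow> z + w \<notin> lattice \<tau> \<longrightarrow> vanish_at z w"
  show rels
  proof (rule relations_if_vanish)
    fix z w assume "generic \<tau> (h/2) z w"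
    from * generic_notin(6-9)[OF this] show "vanish_at z w" by simp
  qed
qed (rule vanish_at_if_relations)

definition second_relation_rhs :: "nat \<Rightarrow> nat \<Rightarrow> nat \<Rightarrow> 'a" where
  "second_relation_rhs a b c = smul (\<i> * ((K \<tau> h b - K \<tau> h a) / K \<tau> h c)) (anticommutator (S a) (S b))
     - smul (2 * \<i> / K \<tau> h c) (smul (rho \<tau> h a) (\<nu> a * S b) - smul (rho \<tau> h b) (\<nu> b * S a))"

lemma K_nonzero:
  assumes "a \<in> {1..3}"
  shows "K \<tau> h a \<noteq> 0"
proof -
  have nz: "ellf \<tau> 1 h \<noteq> 0" "ellf \<tau> 2 h \<noteq> 0" "ellf \<tau> 3 h \<noteq> 0"
    by (rule ellf_nonzero[OF _ h(1)]; simp)+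
  have "K \<tau> h 1 = - (ellf \<tau> 2 h * ellf \<tau> 3 h) / ellf \<tau> 1 h" "K \<tau> h 2 = - (ellf \<tau> 3 h * ellf \<tau> 1 h) / ellf \<tau> 2 h"
    "K \<tau> h 3 = - (ellf \<tau> 1 h * ellf \<tau> 2 h) / ellf \<tau> 3 h"
    using K_eq[OF triple_123(2) h(1)] K_eq[OF triple_123(3) h(1)] K_eq[OF triple_123(1) h(1)] by simp_all
  then have "K \<tau> h 1 \<noteq> 0" "K \<tau> h 2 \<noteq> 0" "K \<tau> h 3 \<noteq> 0"
    using nz by (simp_all del: One_nat_def)
  then show ?thesis using assms unfolding index_123 by blast
qed

lemma second_relation_iff:
  assumes "c \<in> {1..3}"
  shows "\<Phi> (commutator (S c) (S 0)) = \<Phi> (second_relation_rhs a b c) \<longleftrightarrow>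
    K \<tau> h c * (SS c 0 - SS 0 c) = \<i> * (K \<tau> h b - K \<tau> h a) * (SS a b + SS b a) - 2 * \<i> * (NS a b - NS b a)"
proof -
  have 1: "\<Phi> (second_relation_rhs a b c) =
      (\<i> * (K \<tau> h b - K \<tau> h a) * (SS a b + SS b a) - 2 * \<i> * (NS a b - NS b a)) / K \<tau> h c"
    by (simp add: second_relation_rhs_def anticommutator_def N_def functional_simps divide_inverse algebra_simps)
  have 2: "\<Phi> (commutator (S c) (S 0)) = SS c 0 - SS 0 c"
    by (simp add: commutator_def functional_simps)
  show ?thesis
    unfolding 1 2 nonzero_eq_divide_eq[OF K_nonzero[OF assms]] mult.commute[of _ "K \<tau> h c"] ..
qed

lemma first_relation_iff:
  "\<Phi> (smul \<i> (anticommutator (S 0) (S a))) = \<Phi> (commutator (S b) (S c)) \<longleftrightarrow> \<i> * (SS 0 a + SS a 0) = SS b c - SS c b"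
  by (simp add: commutator_def anticommutator_def functional_simps)

lemma commutator_relation_iff:
  assumes "a \<in> {1..3}"
  shows "\<Phi> (commutator (\<nu> a) (S b)) = \<Phi> 0 \<longleftrightarrow> SN b a = NS a b"
    and "b \<in> {1..3} \<Longrightarrow> \<Phi> (commutator (\<nu> a) (\<nu> b)) = \<Phi> 0 \<longleftrightarrow> NN a b = NN b a"
  using rho_nonzero[OF _ h(1)] assms by (auto simp: commutator_def N_def functional_simps)

lemma rels_iff:
  "rels \<longleftrightarrow> (\<forall>a\<in>{1..3}. \<forall>b\<in>{1..3}. \<Phi> (commutator (\<nu> a) (\<nu> b)) = \<Phi> 0) \<and>
    (\<forall>a\<in>{1..3}. \<forall>b\<in>{0..3}. \<Phi> (commutator (\<nu> a) (S b)) = \<Phi> 0) \<and>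
    (\<forall>(a, b, c) \<in> {(1, 2, 3), (2, 3, 1), (3, 1, 2)}.
       \<Phi> (smul \<i> (anticommutator (S 0) (S a))) = \<Phi> (commutator (S b) (S c)) \<and>
       \<Phi> (commutator (S c) (S 0)) = \<Phi> (second_relation_rhs a b c))"
  unfolding scalar_relations_def first_relation_iff
  using commutator_relation_iff second_relation_iff[of 1 2 3] second_relation_iff[of 2 3 1] second_relation_iff[of 3 1 2]
  by (simp del: One_nat_def) blast

end

theorem proposition8p1:
  fixes smul :: "complex \<Rightarrow> 'a::{ring, monoid_mult} \<Rightarrow> 'a"
    and \<tau> h :: complex
    and S \<nu> :: "nat \<Rightarrow> 'a"
  assumes "complex_algebra smul"
    and "Im \<tau> > 0"
    and "2 * h \<notin> lattice \<tau>"
  shows "reflection_equation smul \<tau> h S \<nu> \<longleftrightarrow>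
    (\<forall>\<alpha>\<in>{1..3}. \<forall>\<beta>\<in>{1..3}. commutator (\<nu> \<alpha>) (\<nu> \<beta>) = 0) \<and>
    (\<forall>\<alpha>\<in>{1..3}. \<forall>a\<in>{0..3}. commutator (\<nu> \<alpha>) (S a) = 0) \<and>
    (\<forall>(\<alpha>, \<beta>, \<gamma>) \<in> {(1, 2, 3), (2, 3, 1), (3, 1, 2)}.
       smul \<i> (anticommutator (S 0) (S \<alpha>)) = commutator (S \<beta>) (S \<gamma>) \<and>
       commutator (S \<gamma>) (S 0) =
         smul (\<i> * ((K \<tau> h \<beta> - K \<tau> h \<alpha>) / K \<tau> h \<gamma>)) (anticommutator (S \<alpha>) (S \<beta>))
         - smul (2 * \<i> / K \<tau> h \<gamma>)
             (smul (rho \<tau> h \<alpha>) (\<nu> \<alpha> * S \<beta>) - smul (rho \<tau> h \<beta>) (\<nu> \<beta> * S \<alpha>)))"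
    (is "_ \<longleftrightarrow> ?R")
proof -
  interpret complex_algebra smul by fact
  have data: "reflection_data smul \<Phi> \<tau> h" if "functional \<Phi>" for \<Phi>
    using assms(2,3) that by unfold_locales simp_all
  let ?N = "\<lambda>a. smul (rho \<tau> h a) (\<nu> a)"
  let ?rels = "\<lambda>\<Phi>. scalar_relations (K \<tau> h) (\<lambda>a b. \<Phi> (S a * S b)) (\<lambda>a b. \<Phi> (S a * ?N b))
    (\<lambda>a b. \<Phi> (?N a * S b)) (\<lambda>a b. \<Phi> (?N a * ?N b))"
  let ?left = "\<lambda>z w. lift_mat smul (Rmat \<tau> h (z - w)) \<bullet>\<bullet> (Lhat smul \<tau> h S \<nu> z \<otimes>\<otimes> lift_mat smul (sigma 0))
     \<bullet>\<bullet> lift_mat smul (Rmat \<tau> h (z + w)) \<bullet>\<bullet> (lift_mat smul (sigma 0) \<otimes>\<otimes> Lhat smul \<tau> h S \<nu> w)"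
  let ?right = "\<lambda>z w. (lift_mat smul (sigma 0) \<otimes>\<otimes> Lhat smul \<tau> h S \<nu> w) \<bullet>\<bullet> lift_mat smul (Rmat \<tau> h (z + w))
     \<bullet>\<bullet> (Lhat smul \<tau> h S \<nu> z \<otimes>\<otimes> lift_mat smul (sigma 0)) \<bullet>\<bullet> lift_mat smul (Rmat \<tau> h (z - w))"
  let ?adm = "\<lambda>z w. 2 * z \<notin> lattice \<tau> \<and> 2 * w \<notin> lattice \<tau> \<and> z - w \<notin> lattice \<tau> \<and> z + w \<notin> lattice \<tau>"
  have "reflection_equation smul \<tau> h S \<nu> \<longleftrightarrow> (\<forall>z w. ?adm z w \<longrightarrow> (\<forall>r c. ?left z w $ r $ c = ?right z w $ r $ c))"
    unfolding reflection_equation_def Let_def vec_eq_iff by blast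
  \<comment> \<open>The quantifier over functionals is moved to the front, so that the equivalence
    can be proved for each functional separately.\<close>
  also have "\<dots> \<longleftrightarrow> (\<forall>\<Phi>. functional \<Phi> \<longrightarrow>
      (\<forall>z w. ?adm z w \<longrightarrow> (\<forall>r c. \<Phi> (?left z w $ r $ c) = \<Phi> (?right z w $ r $ c))))"
    by (subst functional_eq_iff) blast
  also have "\<dots> \<longleftrightarrow> (\<forall>\<Phi>. functional \<Phi> \<longrightarrow> ?rels \<Phi>)"
  proof (rule iff_allI, rule imp_cong[OF refl])
    fix \<Phi> assume "functional \<Phi>"
    then interpret reflection_data smul \<Phi> \<tau> h S \<nu> by (rule data)
    show "(\<forall>z w. ?adm z w \<longrightarrow> (\<forall>r c. \<Phi> (?left z w $ r $ c) = \<Phi> (?right z w $ r $ c))) \<longleftrightarrow> ?rels \<Phi>"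
      using vanish_at_iff_relations
      unfolding entries_eq_iff_vanish_at[unfolded left_side_def right_side_def, symmetric] N_def by blast
  qed
  also have "\<dots> \<longleftrightarrow> ?R"
  proof
    assume R: ?R
    show "\<forall>\<Phi>. functional \<Phi> \<longrightarrow> ?rels \<Phi>"
    proof (intro allI impI)
      fix \<Phi> assume "functional \<Phi>"
      then interpret reflection_data smul \<Phi> \<tau> h S \<nu> by (rule data)
      have rels
        unfolding rels_iff second_relation_rhs_def using R by auto
      then show "?rels \<Phi>" by (simp only: N_def)
    qed
  next
    assume rels: "\<forall>\<Phi>. functional \<Phi> \<longrightarrow> ?rels \<Phi>"
    have *: "(\<forall>a\<in>{1..3}. \<forall>b\<in>{1..3}. \<Phi> (commutator (\<nu> a) (\<nu> b)) = \<Phi> 0) \<and>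
      (\<forall>a\<in>{1..3}. \<forall>b\<in>{0..3}. \<Phi> (commutator (\<nu> a) (S b)) = \<Phi> 0) \<and>
      (\<forall>(a, b, c) \<in> {(1, 2, 3), (2, 3, 1), (3, 1, 2)}.
         \<Phi> (smul \<i> (anticommutator (S 0) (S a))) = \<Phi> (commutator (S b) (S c)) \<and>
         \<Phi> (commutator (S c) (S 0)) = \<Phi> (smul (\<i> * ((K \<tau> h b - K \<tau> h a) / K \<tau> h c)) (anticommutator (S a) (S b))
          - smul (2 * \<i> / K \<tau> h c) (smul (rho \<tau> h a) (\<nu> a * S b) - smul (rho \<tau> h b) (\<nu> b * S a))))"
      if \<Phi>: "functional \<Phi>" for \<Phi>
    proof -
      interpret reflection_data smul \<Phi> \<tau> h S \<nu> by (rule data[OF \<Phi>])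
      have rels using rels \<Phi> by (simp only: N_def)
      then show ?thesis unfolding rels_iff second_relation_rhs_def .
    qed
    show ?R
      unfolding functional_eq_iff using * by blast
  qed
  finally show ?thesis .
qed

end
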